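(* Fix natural numbers $k$ and $m$. The following two problems are decidable. (1) The $k,m$-deterministic separability problem: given two nondeterministic timed automata $\mathcal{A}$ and $\mathcal{B}$ with $\varepsilon$-transitions over the same finite alphabet $\Sigma$, decide whether there exists a deterministic timed automaton $\mathcal{S}$ with at most $k$ clocks and all constants in clock constraints bounded in absolute value by $m$ such that $L(\mathcal{A}) \subseteq L(\mathcal{S})$ and $L(\mathcal{S}) \cap L(\mathcal{B}) = \emptyset$. (2) The $k$-deterministic separability problem: given $\mathcal{A}$ and $\mathcal{B}$ as in (1), decide whether there exist some $m \in \mathbb{N}$ and a deterministic timed automaton $\mathcal{S}$ with at most $k$ clocks and maximal constant at most $m$ such that $L(\mathcal{A}) \subseteq L(\mathcal{S})$ and $L(\mathcal{S}) \cap L(\mathcal{B}) = \emptyset$.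
   Context: Timed automata read finite timed words $(a_1,t_1)\cdots(a_n,t_n)$ with $a_i \in \Sigma$ and $0 \le t_1 \le \dots \le t_n$ real timestamps. A timed automaton has finitely many locations, real-valued clocks, and transitions labelled by a letter (or $\varepsilon$), a clock constraint (Boolean combination of $x \sim z$ and $x - y \sim z$ with $z \in \mathbb{Z}$), and a set of clocks to reset. $L(\mathcal{A})$ is the set of finite timed words over $\Sigma$ accepted by $\mathcal{A}$ (after erasing $\varepsilon$-letters). A timed automaton is deterministic if it has no $\varepsilon$-transitions, exactly one initial location, and any two transitions from the same location on the same letter with jointly satisfiable guards have the same target and reset set. *)

theory Defs
  imports Complex_Main "HOL-Library.Nat_Bijection"
begin

text \<open>Letters, locations and clocks are natural numbers. An automaton with
  clock_num A = n uses exactly the clocks 0, ..., n-1 (enforced by well-formedness).\<close>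

datatype cmp = Lt | Le | Eq | Ge | Gt

fun cmp_sem :: "cmp \<Rightarrow> real \<Rightarrow> real \<Rightarrow> bool" where
  "cmp_sem Lt a b = (a < b)"
| "cmp_sem Le a b = (a \<le> b)"
| "cmp_sem Eq a b = (a = b)"
| "cmp_sem Ge a b = (a \<ge> b)"
| "cmp_sem Gt a b = (a > b)"

datatype guard =
    GTrue
  | GAtom nat cmp int
  | GDiff nat nat cmp int
  | GNot guard
  | GAnd guard guard
  | GOr guard guard

type_synonym valuation = "nat \<Rightarrow> real"

fun gsat :: "guard \<Rightarrow> valuation \<Rightarrow> bool" where
  "gsat GTrue v = True"
| "gsat (GAtom x c z) v = cmp_sem c (v x) (of_int z)"
| "gsat (GDiff x y c z) v = cmp_sem c (v x - v y) (of_int z)"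
| "gsat (GNot g) v = (\<not> gsat g v)"
| "gsat (GAnd g h) v = (gsat g v \<and> gsat h v)"
| "gsat (GOr g h) v = (gsat g v \<or> gsat h v)"

fun gclocks :: "guard \<Rightarrow> nat set" where
  "gclocks GTrue = {}"
| "gclocks (GAtom x c z) = {x}"
| "gclocks (GDiff x y c z) = {x, y}"
| "gclocks (GNot g) = gclocks g"
| "gclocks (GAnd g h) = gclocks g \<union> gclocks h"
| "gclocks (GOr g h) = gclocks g \<union> gclocks h"

fun gconsts :: "guard \<Rightarrow> int set" where
  "gconsts GTrue = {}"
| "gconsts (GAtom x c z) = {z}"
| "gconsts (GDiff x y c z) = {z}"
| "gconsts (GNot g) = gconsts g"
| "gconsts (GAnd g h) = gconsts g \<union> gconsts h"
| "gconsts (GOr g h) = gconsts g \<union> gconsts h"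

text \<open>A transition: (source, letter or None for epsilon, guard, clocks to reset, target).\<close>
type_synonym transition = "nat \<times> nat option \<times> guard \<times> nat list \<times> nat"

record ta =
  clock_num :: nat
  initial :: "nat list"
  final :: "nat list"
  trans :: "transition list"

definition reset :: "nat list \<Rightarrow> valuation \<Rightarrow> valuation" where
  "reset R v = (\<lambda>x. if x \<in> set R then 0 else v x)"

inductive accepts_from :: "ta \<Rightarrow> nat \<Rightarrow> valuation \<Rightarrow> real \<Rightarrow> (nat option \<times> real) list \<Rightarrow> bool"
  for A :: ta where
  acc_nil: "q \<in> set (final A) \<Longrightarrow> accepts_from A q v t []"
| acc_step: "\<lbrakk> t \<le> t'; (q, b, g, R, q') \<in> set (trans A);
              gsat g (\<lambda>x. v x + (t' - t));
              accepts_from A q' (reset R (\<lambda>x. v x + (t' - t))) t' w \<rbrakk>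
            \<Longrightarrow> accepts_from A q v t ((b, t') # w)"

definition erase :: "(nat option \<times> real) list \<Rightarrow> (nat \<times> real) list" where
  "erase w = map (\<lambda>(b, t). (the b, t)) (filter (\<lambda>(b, t). b \<noteq> None) w)"

text \<open>Language: finite timed words (timestamps start at time 0 and are nondecreasing,
  enforced by the run semantics).\<close>
definition lang :: "ta \<Rightarrow> (nat \<times> real) list set" where
  "lang A = {erase w | w. \<exists>q0 \<in> set (initial A). accepts_from A q0 (\<lambda>_. 0) 0 w}"

definition wf_ta :: "nat list \<Rightarrow> ta \<Rightarrow> bool" where
  "wf_ta Sig A \<longleftrightarrow> (\<forall>(q, b, g, R, q') \<in> set (trans A).
      (\<forall>a. b = Some a \<longrightarrow> a \<in> set Sig) \<and>
      (\<forall>x \<in> gclocks g. x < clock_num A) \<and> (\<forall>x \<in> set R. x < clock_num A))"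

definition deterministic :: "ta \<Rightarrow> bool" where
  "deterministic A \<longleftrightarrow>
     (\<forall>(q, b, g, R, q') \<in> set (trans A). b \<noteq> None) \<and>
     card (set (initial A)) = 1 \<and>
     (\<forall>(q1, b1, g1, R1, q1') \<in> set (trans A). \<forall>(q2, b2, g2, R2, q2') \<in> set (trans A).
        (q1 = q2 \<and> b1 = b2 \<and> (\<exists>v. (\<forall>x. v x \<ge> 0) \<and> gsat g1 v \<and> gsat g2 v))
        \<longrightarrow> q1' = q2' \<and> set R1 = set R2)"

definition consts_bounded :: "nat \<Rightarrow> ta \<Rightarrow> bool" where
  "consts_bounded m A \<longleftrightarrow>
     (\<forall>(q, b, g, R, q') \<in> set (trans A). \<forall>z \<in> gconsts g. \<bar>z\<bar> \<le> int m)"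

definition km_separable :: "nat \<Rightarrow> nat \<Rightarrow> nat list \<Rightarrow> ta \<Rightarrow> ta \<Rightarrow> bool" where
  "km_separable k m Sig A B \<longleftrightarrow>
     (\<exists>S. wf_ta Sig S \<and> deterministic S \<and> clock_num S \<le> k \<and> consts_bounded m S \<and>
          lang A \<subseteq> lang S \<and> lang S \<inter> lang B = {})"

definition k_separable :: "nat \<Rightarrow> nat list \<Rightarrow> ta \<Rightarrow> ta \<Rightarrow> bool" where
  "k_separable k Sig A B \<longleftrightarrow> (\<exists>m. km_separable k m Sig A B)"

fun enc_cmp :: "cmp \<Rightarrow> nat" where
  "enc_cmp Lt = 0" | "enc_cmp Le = 1" | "enc_cmp Eq = 2" | "enc_cmp Ge = 3" | "enc_cmp Gt = 4"

fun enc_guard :: "guard \<Rightarrow> nat" where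
  "enc_guard GTrue = prod_encode (0, 0)"
| "enc_guard (GAtom x c z) = prod_encode (1, list_encode [x, enc_cmp c, int_encode z])"
| "enc_guard (GDiff x y c z) = prod_encode (2, list_encode [x, y, enc_cmp c, int_encode z])"
| "enc_guard (GNot g) = prod_encode (3, enc_guard g)"
| "enc_guard (GAnd g h) = prod_encode (4, prod_encode (enc_guard g, enc_guard h))"
| "enc_guard (GOr g h) = prod_encode (5, prod_encode (enc_guard g, enc_guard h))"

fun enc_opt :: "nat option \<Rightarrow> nat" where
  "enc_opt None = 0" | "enc_opt (Some a) = Suc a"

fun enc_trans :: "transition \<Rightarrow> nat" where
  "enc_trans (q, b, g, R, q') = list_encode [q, enc_opt b, enc_guard g, list_encode R, q']"

definition enc_ta :: "ta \<Rightarrow> nat" where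
  "enc_ta A = list_encode [clock_num A, list_encode (initial A), list_encode (final A),
                           list_encode (map enc_trans (trans A))]"

definition enc_instance :: "nat list \<times> ta \<times> ta \<Rightarrow> nat" where
  "enc_instance I = (case I of (Sig, A, B) \<Rightarrow>
     list_encode [list_encode Sig, enc_ta A, enc_ta B])"

datatype recf = Z | S | Proj nat | Comp recf "recf list" | Prim recf recf | Mn recf

inductive eval :: "recf \<Rightarrow> nat list \<Rightarrow> nat \<Rightarrow> bool" where
  eval_Z: "eval Z xs 0"
| eval_S: "eval S (x # xs) (Suc x)"
| eval_Proj: "i < length xs \<Longrightarrow> eval (Proj i) xs (xs ! i)"
| eval_Comp: "\<lbrakk> list_all2 (\<lambda>g y. eval g xs y) gs ys; eval f ys z \<rbrakk> \<Longrightarrow> eval (Comp f gs) xs z"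
| eval_Prim0: "eval f xs y \<Longrightarrow> eval (Prim f g) (0 # xs) y"
| eval_PrimS: "\<lbrakk> eval (Prim f g) (n # xs) r; eval g (r # n # xs) y \<rbrakk>
               \<Longrightarrow> eval (Prim f g) (Suc n # xs) y"
| eval_Mn: "\<lbrakk> eval f (n # xs) 0; \<forall>i<n. \<exists>y. y \<noteq> 0 \<and> eval f (i # xs) y \<rbrakk>
            \<Longrightarrow> eval (Mn f) xs n"

definition decidable :: "('a \<Rightarrow> nat) \<Rightarrow> ('a \<Rightarrow> bool) \<Rightarrow> ('a \<Rightarrow> bool) \<Rightarrow> bool" where
  "decidable enc valid P \<longleftrightarrow>
     (\<exists>f. \<forall>x. valid x \<longrightarrow> eval f [enc x] (if P x then 1 else 0))"

definition valid_instance :: "nat list \<times> ta \<times> ta \<Rightarrow> bool" where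
  "valid_instance I = (case I of (Sig, A, B) \<Rightarrow> wf_ta Sig A \<and> wf_ta Sig B)"

end

theory Submission
  imports Defs
begin

text \<open>
  A deterministic automaton with \<open>k\<close> clocks and constants at most \<open>m\<close> is a finite-state controller that
  sees the region of its clocks at each letter and answers with a reset. It separates iff no
  controller state is reached together with a final configuration of \<open>A\<close> and one of \<open>B\<close>.
  Attaching to each controller state the regions of joint configurations reached with it, such a
  controller exists iff there is a finite set of region sets that is closed under delays, silent steps and
  letters; representing regions by grid points makes this a bounded arithmetical condition.

  For unspecified \<open>m\<close> the constants are bounded as follows. Each controller clock is taken modulo 1,
  and the controller is told when it ticks; it must give up a clock after finitely many ticks without a reset.
  The resulting game has finitely many positions independently of \<open>m\<close>, and a latest appearance
  record argument turns arbitrary tick budgets into budgets bounded in the number of positions.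
\<close>

section \<open>Recursive functions\<close>

text \<open>For unbounded \<open>m\<close> the obstacle is the integer part of a controller clock,
  an unbounded memory. The joint behaviour with \<open>A\<close> and \<open>B\<close> involves only
  the fractional part; the integer part is information that a finite state can hold, provided that
  ticks are noticed and their number stays bounded. A clock beyond \<open>m\<close> shows itself to
  guards only through its differences with other clocks, and differences change at resets alone, so
  they can be remembered too. This is why a clock may be given up after \<open>m + 1\<close> ticks,
  and why \<open>m\<close> survives in the game only as a budget. The vertices do not mention
  \<open>m\<close>, so budgets bounded by the number of vertices bound the constants. The way back
  has its own obstacle: an automaton acts at letters only and is not woken by a tick. The strategy
  therefore replays the missed ticks at the next letter, in the order in which they occurred. This
  order can be read off the clock values, at the price of guards with constants one above the bound
  on the budgets.\<close>

definition recursive1 :: "(nat \<Rightarrow> nat) \<Rightarrow> bool" where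
  "recursive1 f \<longleftrightarrow> (\<exists>r. \<forall>x. eval r [x] (f x))"

definition recursive2 :: "(nat \<Rightarrow> nat \<Rightarrow> nat) \<Rightarrow> bool" where
  "recursive2 f \<longleftrightarrow> (\<exists>r. \<forall>x y. eval r [x, y] (f x y))"

definition recursive3 :: "(nat \<Rightarrow> nat \<Rightarrow> nat \<Rightarrow> nat) \<Rightarrow> bool" where
  "recursive3 f \<longleftrightarrow> (\<exists>r. \<forall>x y z. eval r [x, y, z] (f x y z))"

lemma eval_proj1: "eval (Proj 0) (x # xs) x"
  using eval_Proj[of 0 "x # xs"] by simp

lemma eval_proj2: "eval (Proj 1) (x # y # xs) y"
  using eval_Proj[of 1 "x # y # xs"] by simp

lemma eval_proj3: "eval (Proj 2) (x # y # z # xs) z"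
  using eval_Proj[of 2 "x # y # z # xs"] by simp

lemma eval_comp1: "eval g xs y \<Longrightarrow> eval f [y] z \<Longrightarrow> eval (Comp f [g]) xs z"
  by (rule eval_Comp[of _ _ "[y]"]) auto

lemma eval_comp2: "eval g xs y \<Longrightarrow> eval g' xs y' \<Longrightarrow> eval f [y, y'] z \<Longrightarrow> eval (Comp f [g, g']) xs z"
  by (rule eval_Comp[of _ _ "[y, y']"]) auto

lemma eval_const: "\<exists>r. \<forall>xs. eval r xs c"
proof (induction c)
  case 0
  then show ?case using eval_Z by blast
next
  case (Suc c)
  then obtain r where "\<forall>xs. eval r xs c" by blast
  then have "\<forall>xs. eval (Comp S [r]) xs (Suc c)" by (auto intro: eval_comp1 eval_S)
  then show ?case by blast
qed

lemma recursive1_const: "recursive1 (\<lambda>_. c)"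
  using eval_const[of c] unfolding recursive1_def by blast

lemma recursive1_id: "recursive1 (\<lambda>x. x)"
  unfolding recursive1_def using eval_proj1 by blast

lemma recursive1_Suc: "recursive1 Suc"
  unfolding recursive1_def using eval_S by blast

lemma recursive2_const: "recursive2 (\<lambda>_ _. c)"
  using eval_const[of c] unfolding recursive2_def by blast

lemma recursive2_proj: "recursive2 (\<lambda>x y. x)" "recursive2 (\<lambda>x y. y)"
  unfolding recursive2_def using eval_proj1 eval_proj2 by blast+

lemma recursive3_proj:
  "recursive3 (\<lambda>x y z. x)" "recursive3 (\<lambda>x y z. y)" "recursive3 (\<lambda>x y z. z)"
  unfolding recursive3_def using eval_proj1 eval_proj2 eval_proj3 by blast+

lemma recursive3_const: "recursive3 (\<lambda>_ _ _. c)"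
  using eval_const[of c] unfolding recursive3_def by blast

lemma recursive1_comp1:
  "recursive1 f \<Longrightarrow> recursive1 g \<Longrightarrow> recursive1 (\<lambda>x. f (g x))"
  unfolding recursive1_def by (elim exE, rule exI, intro allI, rule eval_comp1, blast, blast)

lemma recursive1_comp2:
  "recursive2 f \<Longrightarrow> recursive1 g \<Longrightarrow> recursive1 h \<Longrightarrow> recursive1 (\<lambda>x. f (g x) (h x))"
  unfolding recursive1_def recursive2_def
  by (elim exE, rule exI, intro allI, rule eval_comp2, blast, blast, blast)

lemma recursive2_comp1:
  "recursive1 f \<Longrightarrow> recursive2 g \<Longrightarrow> recursive2 (\<lambda>x y. f (g x y))"
  unfolding recursive1_def recursive2_def
  by (elim exE, rule exI, intro allI, rule eval_comp1, blast, blast)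

lemma recursive2_comp2:
  "recursive2 f \<Longrightarrow> recursive2 g \<Longrightarrow> recursive2 h \<Longrightarrow> recursive2 (\<lambda>x y. f (g x y) (h x y))"
  unfolding recursive2_def
  by (elim exE, rule exI, intro allI, rule eval_comp2, blast, blast, blast)

lemma recursive3_comp1:
  "recursive1 f \<Longrightarrow> recursive3 g \<Longrightarrow> recursive3 (\<lambda>x y z. f (g x y z))"
  unfolding recursive1_def recursive3_def
  by (elim exE, rule exI, intro allI, rule eval_comp1, blast, blast)

lemma recursive3_comp2:
  "recursive2 f \<Longrightarrow> recursive3 g \<Longrightarrow> recursive3 h \<Longrightarrow> recursive3 (\<lambda>x y z. f (g x y z) (h x y z))"
  unfolding recursive2_def recursive3_def
  by (elim exE, rule exI, intro allI, rule eval_comp2, blast, blast, blast)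

text \<open>\<open>Prim\<close> hands its step function the accumulator before the counter,
  \<open>rec_nat\<close> does the opposite; hence the order of arguments in
  \<open>g r i x\<close>.\<close>

lemma recursive2_prim:
  assumes "recursive1 a" "recursive3 g"
  shows "recursive2 (\<lambda>n x. rec_nat (a x) (\<lambda>i r. g r i x) n)"
proof -
  obtain ra rg where r: "\<And>x. eval ra [x] (a x)" "\<And>x y z. eval rg [x, y, z] (g x y z)"
    using assms unfolding recursive1_def recursive3_def by blast
  have "eval (Prim ra rg) [n, x] (rec_nat (a x) (\<lambda>i r. g r i x) n)" for n x
    by (induction n) (auto intro: eval_Prim0 eval_PrimS r)
  then show ?thesis unfolding recursive2_def by blast
qed

lemmas recursive_base_intros =
  recursive1_id recursive1_const recursive2_const recursive2_proj recursive3_proj recursive3_const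

lemma recursive2_add: "recursive2 (+)"
proof -
  have "rec_nat x (\<lambda>i r. Suc r) n = n + x" for n x :: nat by (induction n) auto
  moreover have "recursive2 (\<lambda>n x. rec_nat x (\<lambda>i r. Suc r) n)"
    by (intro recursive2_prim recursive3_comp1[OF recursive1_Suc] recursive_base_intros)
  ultimately show ?thesis by simp
qed

lemma recursive1_pred: "recursive1 (\<lambda>n. n - 1)"
proof -
  have "rec_nat 0 (\<lambda>i r. i) n = n - 1" for n :: nat by (cases n) auto
  moreover have "recursive2 (\<lambda>n x. rec_nat 0 (\<lambda>i r. i) n)"
    by (intro recursive2_prim recursive_base_intros)
  ultimately have "recursive2 (\<lambda>n x. n - 1)" by simp
  from recursive1_comp2[OF this recursive1_id recursive1_id] show ?thesis .
qed

lemma recursive2_sub_flip: "recursive2 (\<lambda>n x. x - n)"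
proof -
  have "rec_nat x (\<lambda>i r. r - 1) n = x - n" for n x :: nat by (induction n) auto
  moreover have "recursive2 (\<lambda>n x. rec_nat x (\<lambda>i r. r - 1) n)"
    by (intro recursive2_prim recursive3_comp1[OF recursive1_pred] recursive_base_intros)
  ultimately show ?thesis by simp
qed

lemma recursive2_sub: "recursive2 (-)"
  using recursive2_comp2[OF recursive2_sub_flip recursive2_proj(2) recursive2_proj(1)] by simp

lemma recursive2_mult: "recursive2 (*)"
proof -
  have "rec_nat 0 (\<lambda>i r. r + x) n = n * x" for n x :: nat by (induction n) auto
  moreover have "recursive2 (\<lambda>n x. rec_nat 0 (\<lambda>i r. r + x) n)"
    by (intro recursive2_prim recursive3_comp2[OF recursive2_add] recursive_base_intros)
  ultimately show ?thesis by simp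
qed

lemma recursive1_triangle: "recursive1 triangle"
proof -
  have "rec_nat 0 (\<lambda>i r. r + Suc i) n = triangle n" for n :: nat by (induction n) auto
  moreover have "recursive2 (\<lambda>n x. rec_nat 0 (\<lambda>i r. r + Suc i) n)"
    by (intro recursive2_prim recursive3_comp2[OF recursive2_add] recursive3_comp1[OF recursive1_Suc]
        recursive_base_intros)
  ultimately have "recursive2 (\<lambda>n x. triangle n)" by simp
  from recursive1_comp2[OF this recursive1_id recursive1_id] show ?thesis .
qed

section \<open>Pairing and unpairing\<close>

definition pfst :: "nat \<Rightarrow> nat" where "pfst n = fst (prod_decode n)"
definition psnd :: "nat \<Rightarrow> nat" where "psnd n = snd (prod_decode n)"

lemma pfst_encode [simp]: "pfst (prod_encode (a, b)) = a" by (simp add: pfst_def)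
lemma psnd_encode [simp]: "psnd (prod_encode (a, b)) = b" by (simp add: psnd_def)

lemma recursive2_prod_encode: "recursive2 (\<lambda>x y. prod_encode (x, y))"
  unfolding prod_encode_def split
  by (intro recursive2_comp2[OF recursive2_add] recursive2_comp1[OF recursive1_triangle] recursive_base_intros)

lemma triangle_mono: "a \<le> b \<Longrightarrow> triangle a \<le> triangle b"
  by (induction b) (auto simp: le_Suc_eq)

lemma le_triangle: "a \<le> triangle a"
  by (induction a) auto

text \<open>By truncated subtraction the summand at \<open>i\<close> is 1 if
  \<open>triangle (Suc i) \<le> x\<close> and 0 otherwise, so the recursion counts these
  \<open>i\<close> below \<open>k\<close>. For the given \<open>x\<close> they are the
  \<open>i < s\<close>: the count finds the diagonal of the pairing function on which
  \<open>x\<close> lies.\<close>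

lemma triangle_root:
  assumes "x = triangle s + a" "a \<le> s"
  shows "rec_nat 0 (\<lambda>i r. r + (1 - (triangle (Suc i) - x))) k = min k s"
proof (induction k)
  case (Suc k)
  show ?case
  proof (cases "k < s")
    case True
    then have "triangle (Suc k) \<le> x" using triangle_mono[of "Suc k" s] assms by linarith
    then show ?thesis using Suc True by (auto simp del: triangle_Suc)
  next
    case False
    then have "triangle (Suc k) > x" using triangle_mono[of "Suc s" "Suc k"] assms by simp
    then have "1 - (triangle (Suc k) - x) = 0" by linarith
    then show ?thesis using Suc False by (simp del: triangle_Suc)
  qed
qed auto

lemma recursive1_unpair: "recursive1 pfst" "recursive1 psnd"
proof -
  let ?rt = "\<lambda>x. rec_nat 0 (\<lambda>i r. r + (1 - (triangle (Suc i) - x))) x"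
  have "recursive2 (\<lambda>n x. rec_nat 0 (\<lambda>i r. r + (1 - (triangle (Suc i) - x))) n)"
    by (intro recursive2_prim recursive3_comp2[OF recursive2_add] recursive3_comp2[OF recursive2_sub]
        recursive3_comp1[OF recursive1_triangle] recursive3_comp1[OF recursive1_Suc] recursive_base_intros)
  from recursive1_comp2[OF this recursive1_id recursive1_id] have rt: "recursive1 ?rt" .
  have eq: "pfst x = x - triangle (?rt x) \<and> psnd x = ?rt x - (x - triangle (?rt x))" for x
  proof -
    obtain a b where ab: "prod_decode x = (a, b)" by force
    then have x: "x = prod_encode (a, b)" by (metis prod_decode_inverse)
    then have "x = triangle (a + b) + a" by (simp add: prod_encode_def)
    then have "?rt x = min x (a + b)" by (intro triangle_root) auto
    \<comment> \<open>Counting up to \<open>x\<close> goes far enough, since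
      \<open>a + b \<le> triangle (a + b) \<le> x\<close>.\<close>
    also have "\<dots> = a + b" using le_triangle[of "a + b"] x by (simp add: prod_encode_def)
    finally have "?rt x = a + b" .
    moreover have "pfst x = a" "psnd x = b" by (simp_all add: pfst_def psnd_def ab)
    moreover have "x - triangle (a + b) = a" using x by (simp add: prod_encode_def)
    ultimately show ?thesis by presburger
  qed
  have 1: "recursive1 (\<lambda>x. x - triangle (?rt x))"
    by (intro recursive1_comp2[OF recursive2_sub] recursive1_comp1[OF recursive1_triangle] rt recursive1_id)
  then show "recursive1 pfst" using eq by presburger
  have "recursive1 (\<lambda>x. ?rt x - (x - triangle (?rt x)))"
    by (intro recursive1_comp2[OF recursive2_sub] 1 rt)
  then show "recursive1 psnd" using eq by presburger
qed

text \<open>Below, an environment of several variables is a single number, a nested pair. A bound variable is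
  pushed with \<^term>\<open>prod_encode\<close>, which keeps the rules syntax directed.\<close>

named_theorems recursive_intros

lemmas [recursive_intros] = recursive1_id recursive1_const recursive1_comp1[OF recursive1_Suc]
  recursive1_comp1[OF recursive1_unpair(1)] recursive1_comp1[OF recursive1_unpair(2)]
  recursive1_comp2[OF recursive2_add] recursive1_comp2[OF recursive2_sub]
  recursive1_comp2[OF recursive2_mult] recursive1_comp2[OF recursive2_prod_encode]

text \<open>The body sees the index, the accumulator and the outer environment packed in this order
  into one number, so the same rule serves at every nesting depth.\<close>

lemma recursive1_rec_nat [recursive_intros]:
  assumes "recursive1 a" "recursive1 (\<lambda>p. g (pfst p) (pfst (psnd p)) (psnd (psnd p)))" "recursive1 t"
  shows "recursive1 (\<lambda>e. rec_nat (a e) (\<lambda>i r. g i r e) (t e))"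
proof -
  have "recursive3 (\<lambda>r i x. prod_encode (i, prod_encode (r, x)))"
    by (intro recursive3_comp2[OF recursive2_prod_encode] recursive_base_intros)
  from recursive3_comp1[OF assms(2) this] have "recursive3 (\<lambda>r i x. g i r x)" by simp
  from recursive1_comp2[OF recursive2_prim[OF assms(1) this] assms(3) recursive1_id]
  show ?thesis .
qed

section \<open>Recursive predicates and bounded quantifiers\<close>

definition recursive_pred :: "(nat \<Rightarrow> bool) \<Rightarrow> bool" where
  "recursive_pred p \<longleftrightarrow> recursive1 (\<lambda>x. if p x then 1 else 0)"

lemma recursive_pred_comp:
  "recursive_pred p \<Longrightarrow> recursive1 f \<Longrightarrow> recursive_pred (\<lambda>x. p (f x))"
  unfolding recursive_pred_def
  using recursive1_comp1[of "\<lambda>x. if p x then 1 else 0" f] by simp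

lemma recursive1_if [recursive_intros]:
  assumes "recursive_pred p" "recursive1 f" "recursive1 g"
  shows "recursive1 (\<lambda>x. if p x then f x else g x)"
proof -
  have "(if p x then f x else g x)
      = (if p x then 1 else 0) * f x + (1 - (if p x then 1 else 0)) * g x" for x by auto
  moreover have "recursive1 (\<lambda>x. (if p x then 1 else 0) * f x + (1 - (if p x then 1 else 0)) * g x)"
    by (intro recursive_intros assms assms(1)[unfolded recursive_pred_def])
  ultimately show ?thesis by presburger
qed

lemma recursive_pred_not [recursive_intros]:
  assumes "recursive_pred p" shows "recursive_pred (\<lambda>x. \<not> p x)"
proof -
  have "(\<lambda>x. if \<not> p x then 1 else (0::nat)) = (\<lambda>x. 1 - (if p x then 1 else 0))" by auto
  then show ?thesis unfolding recursive_pred_def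
    using recursive1_comp2[OF recursive2_sub recursive1_const[of 1] assms[unfolded recursive_pred_def]]
    by (simp only:)
qed

lemma recursive_pred_and [recursive_intros]:
  assumes "recursive_pred p" "recursive_pred q" shows "recursive_pred (\<lambda>x. p x \<and> q x)"
proof -
  have "(\<lambda>x. if p x \<and> q x then 1 else (0::nat)) = (\<lambda>x. (if p x then 1 else 0) * (if q x then 1 else 0))"
    by auto
  then show ?thesis unfolding recursive_pred_def
    using recursive1_comp2[OF recursive2_mult assms[unfolded recursive_pred_def]] by (simp only:)
qed

lemma recursive_pred_or [recursive_intros]:
  assumes "recursive_pred p" "recursive_pred q" shows "recursive_pred (\<lambda>x. p x \<or> q x)"
  by (rule back_subst[of recursive_pred, OF recursive_pred_not[OF recursive_pred_and[OF assms[THEN recursive_pred_not]]]], rule ext, auto)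

lemma recursive_pred_imp [recursive_intros]:
  assumes "recursive_pred p" "recursive_pred q" shows "recursive_pred (\<lambda>x. p x \<longrightarrow> q x)"
  by (rule back_subst[of recursive_pred, OF recursive_pred_or[OF assms(1)[THEN recursive_pred_not] assms(2)]], rule ext, auto)

lemma recursive_pred_iff [recursive_intros]:
  assumes "recursive_pred p" "recursive_pred q" shows "recursive_pred (\<lambda>x. p x \<longleftrightarrow> q x)"
  by (rule back_subst[of recursive_pred, OF recursive_pred_and[OF recursive_pred_imp[OF assms] recursive_pred_imp[OF assms(2,1)]]], rule ext, auto)

lemma recursive_pred_le [recursive_intros]:
  assumes "recursive1 f" "recursive1 g" shows "recursive_pred (\<lambda>x. f x \<le> g x)"
proof -
  have "(if f x \<le> g x then 1 else 0) = 1 - (f x - g x)" for x by auto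
  moreover have "recursive1 (\<lambda>x. 1 - (f x - g x))"
    by (intro recursive_intros assms)
  ultimately show ?thesis unfolding recursive_pred_def by presburger
qed

lemma recursive_pred_less [recursive_intros]:
  assumes "recursive1 f" "recursive1 g" shows "recursive_pred (\<lambda>x. f x < g x)"
  by (rule back_subst[of recursive_pred, OF recursive_pred_not[OF recursive_pred_le[OF assms(2,1)]]], rule ext, auto)

lemma recursive_pred_eq [recursive_intros]:
  assumes "recursive1 f" "recursive1 g" shows "recursive_pred (\<lambda>x. f x = g x)"
  by (rule back_subst[of recursive_pred, OF recursive_pred_and[OF recursive_pred_le[OF assms] recursive_pred_le[OF assms(2,1)]]], rule ext, auto)

text \<open>The search is a recursion over the candidates whose accumulator is set to 1 by a witness
  and kept otherwise. The candidate is pushed onto the environment as a new first component.\<close>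

lemma recursive_pred_bex [recursive_intros]:
  assumes "recursive1 t" "recursive_pred (\<lambda>e. P (pfst e) (psnd e))"
  shows "recursive_pred (\<lambda>e. \<exists>y<t e. P y e)"
proof -
  have "rec_nat 0 (\<lambda>i r. if P i e then 1 else r) n = (if \<exists>y<n. P y e then 1 else (0::nat))" for n e
    by (induction n) (auto simp: less_Suc_eq)
  moreover have "recursive1 (\<lambda>e. rec_nat 0 (\<lambda>i r. if P i e then 1 else r) (t e))"
  proof (intro recursive_intros assms(1))
    show "recursive_pred (\<lambda>p. P (pfst p) (psnd (psnd p)))"
    proof -
      have "recursive1 (\<lambda>p. prod_encode (pfst p, psnd (psnd p)))" by (intro recursive_intros)
      from recursive_pred_comp[OF assms(2) this] show ?thesis by simp
    qed
  qed
  ultimately show ?thesis unfolding recursive_pred_def by simp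
qed

lemma recursive_pred_ball [recursive_intros]:
  assumes "recursive1 t" "recursive_pred (\<lambda>e. P (pfst e) (psnd e))"
  shows "recursive_pred (\<lambda>e. \<forall>y<t e. P y e)"
  by (rule back_subst[of recursive_pred, OF recursive_pred_not[OF recursive_pred_bex[OF assms(1) recursive_pred_not[OF assms(2)]]]], rule ext, auto)

text \<open>The quotient is counted upwards: \<open>r\<close> grows as long as
  \<open>(r + 1) * y \<le> x\<close>. After \<open>x\<close> rounds it is final because
  \<open>x div y \<le> x\<close>; a zero divisor is treated apart.\<close>

lemma recursive1_div [recursive_intros]:
  assumes "recursive1 f" "recursive1 g" shows "recursive1 (\<lambda>e. f e div g e)"
proof -
  have rec: "rec_nat 0 (\<lambda>i r. if (r + 1) * y \<le> x then r + 1 else r) k = min k (x div y)" if "y > 0" for x y k :: nat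
  proof (induction k)
    case (Suc k)
    have "(k + 1) * y \<le> x \<longleftrightarrow> k < x div y"
      using that less_eq_div_iff_mult_less_eq[of y "k + 1" x] by (simp add: Suc_le_eq)
    moreover have "\<not> (x div y + 1) * y \<le> x"
      using that less_eq_div_iff_mult_less_eq[of y "x div y + 1" x] by simp
    ultimately show ?case using Suc by (auto simp: min_def)
  qed auto
  have "f e div g e = (if g e = 0 then 0
      else rec_nat 0 (\<lambda>i r. if (r + 1) * g e \<le> f e then r + 1 else r) (f e))" for e
    using rec[of "g e" "f e" "f e"] by (cases "g e = 0") (auto simp: min.absorb2)
  moreover have "recursive1 (\<lambda>e. if g e = 0 then 0
      else rec_nat 0 (\<lambda>i r. if (r + 1) * g e \<le> f e then r + 1 else r) (f e))"
    by (intro recursive_intros assms recursive1_comp1[OF assms(1)] recursive1_comp1[OF assms(2)])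
  ultimately show ?thesis by presburger
qed

lemma recursive1_mod [recursive_intros]:
  assumes "recursive1 f" "recursive1 g" shows "recursive1 (\<lambda>e. f e mod g e)"
  unfolding minus_div_mult_eq_mod[symmetric] by (intro recursive_intros assms)

lemma recursive1_power [recursive_intros]:
  assumes "recursive1 f" "recursive1 g" shows "recursive1 (\<lambda>e. f e ^ g e)"
proof -
  have "rec_nat 1 (\<lambda>i r. r * x) n = x ^ n" for n x :: nat by (induction n) auto
  moreover have "recursive1 (\<lambda>e. rec_nat 1 (\<lambda>i r. r * f e) (g e))"
    by (intro recursive_intros assms recursive1_comp1[OF assms(1)])
  ultimately show ?thesis by simp
qed

lemma recursive_pred_even [recursive_intros]:
  assumes "recursive1 f" shows "recursive_pred (\<lambda>e. even (f e))"
  unfolding even_iff_mod_2_eq_zero by (intro recursive_intros assms)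

lemma recursive_pred_set_decode [recursive_intros]:
  assumes "recursive1 f" "recursive1 g" shows "recursive_pred (\<lambda>e. f e \<in> set_decode (g e))"
  unfolding set_decode_def mem_Collect_eq by (intro recursive_intros assms)

section \<open>Access to coded lists\<close>

definition list_nth :: "nat \<Rightarrow> nat \<Rightarrow> nat" where
  "list_nth c i = pfst (rec_nat c (\<lambda>_ r. psnd (r - 1)) i - 1)"

text \<open>The code of a list is at least its length, so positions below \<open>c\<close> are
  enough; a zero tail marks the positions behind the end.\<close>

definition list_mem :: "nat \<Rightarrow> nat \<Rightarrow> bool" where
  "list_mem a c \<longleftrightarrow> (\<exists>i<c. rec_nat c (\<lambda>_ r. psnd (r - 1)) i \<noteq> 0 \<and> list_nth c i = a)"

lemma psnd_0: "psnd 0 = 0"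
  using psnd_encode[of 0 0] by (simp add: prod_encode_def)

text \<open>A nonempty list has a code of the form \<open>Suc (prod_encode (x, c))\<close> with
  \<open>c\<close> the code of its tail, hence \<open>psnd (r - 1)\<close> is the tail. The code 0
  of the empty list is mapped to itself, so dropping past the end does no harm.\<close>

lemma list_drop_encode:
  "rec_nat (list_encode xs) (\<lambda>_ r. psnd (r - 1)) i = list_encode (drop i xs)"
proof (induction i)
  case (Suc i)
  then show ?case
    by (cases "i < length xs") (auto simp: psnd_0 Cons_nth_drop_Suc[symmetric])
qed auto

lemma list_nth_encode [simp]: "i < length xs \<Longrightarrow> list_nth (list_encode xs) i = xs ! i"
  unfolding list_nth_def list_drop_encode by (simp add: Cons_nth_drop_Suc[symmetric])

lemma length_le_list_encode: "length xs \<le> list_encode xs"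
proof (induction xs)
  case (Cons x xs)
  then show ?case using le_prod_encode_2[of "list_encode xs" x] by simp
qed auto

lemma list_mem_encode [simp]: "list_mem a (list_encode xs) \<longleftrightarrow> a \<in> set xs"
proof -
  have "list_encode (drop i xs) \<noteq> 0 \<longleftrightarrow> i < length xs" for i
    by (cases "i < length xs") (auto simp: Cons_nth_drop_Suc[symmetric])
  then have "list_mem a (list_encode xs) \<longleftrightarrow> (\<exists>i<list_encode xs. i < length xs \<and> list_nth (list_encode xs) i = a)"
    unfolding list_mem_def list_drop_encode by simp
  also have "\<dots> \<longleftrightarrow> (\<exists>i<length xs. xs ! i = a)"
    using length_le_list_encode[of xs] by (auto intro: order_less_le_trans)
  finally show ?thesis by (simp add: in_set_conv_nth)
qed

lemma mem_less_list_encode: "a \<in> set xs \<Longrightarrow> a < list_encode xs"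
proof (induction xs)
  case (Cons x xs)
  then show ?case
    using le_prod_encode_2[of "list_encode xs" x] le_prod_encode_1[of x "list_encode xs"] by auto
qed auto

lemma recursive1_list_nth [recursive_intros]:
  assumes "recursive1 f" "recursive1 g" shows "recursive1 (\<lambda>e. list_nth (f e) (g e))"
  unfolding list_nth_def by (intro recursive_intros assms)

lemma recursive_pred_list_mem [recursive_intros]:
  assumes "recursive1 f" "recursive1 g" shows "recursive_pred (\<lambda>e. list_mem (f e) (g e))"
  unfolding list_mem_def
  by (intro recursive_intros assms recursive1_comp1[OF assms(1)] recursive1_comp1[OF assms(2)])

section \<open>Regions\<close>

text \<open>For values between 0 and \<open>M\<close>, comparing differences with integers amounts
  to comparing fractional parts. Differences are compared for all pairs, large values included,
  because guards may be diagonal: values beyond \<open>M\<close> are merged only as far as their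
  differences allow.\<close>

definition region_eq :: "nat \<Rightarrow> nat \<Rightarrow> valuation \<Rightarrow> valuation \<Rightarrow> bool" where
  "region_eq M L u u' \<longleftrightarrow> (\<forall>i<L. \<forall>z::int. \<bar>z\<bar> \<le> int M \<longrightarrow>
     (u i < of_int z \<longleftrightarrow> u' i < of_int z) \<and> (u i \<le> of_int z \<longleftrightarrow> u' i \<le> of_int z) \<and>
     (\<forall>j<L. u i - u j < of_int z \<longleftrightarrow> u' i - u' j < of_int z))"

lemma region_eqD:
  assumes "region_eq M L u u'" "i < L" "\<bar>z\<bar> \<le> int M"
  shows "u i < of_int z \<longleftrightarrow> u' i < of_int z" "u i \<le> of_int z \<longleftrightarrow> u' i \<le> of_int z"
    "j < L \<Longrightarrow> u i - u j < of_int z \<longleftrightarrow> u' i - u' j < of_int z"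
    "j < L \<Longrightarrow> u i - u j \<le> of_int z \<longleftrightarrow> u' i - u' j \<le> of_int z"
proof -
  note D = assms(1)[unfolded region_eq_def, rule_format, OF assms(2,3)]
  show "u i < of_int z \<longleftrightarrow> u' i < of_int z" "u i \<le> of_int z \<longleftrightarrow> u' i \<le> of_int z"
    using D by simp_all
  show "u i - u j < of_int z \<longleftrightarrow> u' i - u' j < of_int z" if "j < L"
    using D that by simp
  show "u i - u j \<le> of_int z \<longleftrightarrow> u' i - u' j \<le> of_int z" if "j < L"
  proof -
    have "\<bar>- z\<bar> \<le> int M" using assms by simp
    from assms(1)[unfolded region_eq_def, rule_format, OF that this] assms(2)
    have "u j - u i < of_int (- z) \<longleftrightarrow> u' j - u' i < of_int (- z)" by simp
    then show ?thesis by (simp; linarith)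
  qed
qed

lemma region_eq_refl [simp]: "region_eq M L u u"
  by (simp add: region_eq_def)

lemma region_eq_sym: "region_eq M L u u' \<Longrightarrow> region_eq M L u' u"
  by (simp add: region_eq_def)

lemma region_eq_trans: "region_eq M L u v \<Longrightarrow> region_eq M L v w \<Longrightarrow> region_eq M L u w"
  by (simp add: region_eq_def)

lemma region_eq_mono: "region_eq M L u v \<Longrightarrow> m \<le> M \<Longrightarrow> l \<le> L \<Longrightarrow> region_eq m l u v"
  unfolding region_eq_def by (meson of_nat_le_iff order_less_le_trans order_trans)

lemma region_eq_cong: "(\<And>i. i < L \<Longrightarrow> u i = v i) \<Longrightarrow> region_eq M L u v"
  by (simp add: region_eq_def)

lemma region_eq_shift:
  assumes "region_eq M (n + k) u v"
  shows "region_eq M k (\<lambda>x. u (n + x)) (\<lambda>x. v (n + x))"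
  using assms unfolding region_eq_def by simp

lemma cmp_sem_cong:
  "(a < z \<longleftrightarrow> a' < z) \<Longrightarrow> (a \<le> z \<longleftrightarrow> a' \<le> z) \<Longrightarrow> cmp_sem c a z \<longleftrightarrow> cmp_sem c a' z"
  by (cases c) auto

lemma gsat_region_eq:
  assumes "region_eq M L u u'" "\<forall>x\<in>gclocks g. x < L" "\<forall>z\<in>gconsts g. \<bar>z\<bar> \<le> int M"
  shows "gsat g u \<longleftrightarrow> gsat g u'"
  using assms(2,3)
proof (induction g)
  case (GAtom x c z)
  then show ?case using region_eqD(1,2)[OF assms(1), of x z] by (auto intro!: cmp_sem_cong)
next
  case (GDiff x y c z)
  then show ?case using region_eqD(3,4)[OF assms(1), of x z y] by (auto intro!: cmp_sem_cong)
qed auto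

lemma gsat_cong: "(\<And>x. x \<in> gclocks g \<Longrightarrow> u x = u' x) \<Longrightarrow> gsat g u \<longleftrightarrow> gsat g u'"
  by (induction g) auto

definition resets :: "nat set \<Rightarrow> valuation \<Rightarrow> valuation" where
  "resets X v = (\<lambda>x. if x \<in> X then 0 else v x)"

lemma reset_eq_resets: "reset R v = resets (set R) v"
  by (simp add: reset_def resets_def)

lemma region_eq_resets:
  assumes "region_eq M L u u'"
  shows "region_eq M L (resets X u) (resets X u')"
proof -
  \<comment> \<open>The difference between a reset clock and clock \<open>i\<close> is
    \<open>- u i\<close>. The range of constants is symmetric, so its comparisons are among the
    given ones.\<close>
  { fix i z assume i: "i < L" and z: "\<bar>z\<bar> \<le> int M"
    have "\<bar>- z\<bar> \<le> int M" using z by simp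
    then have "u i \<le> of_int (- z) \<longleftrightarrow> u' i \<le> of_int (- z)"
      using region_eqD(2)[OF assms i, of "- z"] by simp
    then have "- u i < of_int z \<longleftrightarrow> - u' i < of_int z" by (simp; linarith)
  }
  then show ?thesis unfolding region_eq_def resets_def
    using region_eqD[OF assms] by auto
qed

text \<open>The extra bound \<open>Max A + 1\<close> is what later keeps the matching delay below
  \<open>M + 1\<close>, and through it the representatives of regions bounded.\<close>

lemma finite_sets_between:
  fixes A B :: "real set"
  assumes "finite A" "finite B" "A \<noteq> {}" "\<And>a b. a \<in> A \<Longrightarrow> b \<in> B \<Longrightarrow> a < b"
  shows "\<exists>x. (\<forall>a\<in>A. a < x) \<and> (\<forall>b\<in>B. x < b) \<and> x \<le> Max A + 1"
proof (cases "B = {}")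
  case True
  have "\<forall>a\<in>A. a < Max A + 1"
    using Max_ge[OF assms(1)] by (meson add_strict_increasing2 le_less_trans less_add_one)
  then show ?thesis using True by auto
next
  case False
  have "Max A < Min B" using assms False by simp
  then obtain x where x: "Max A < x" "x < min (Min B) (Max A + 1)"
    using dense[of "Max A" "min (Min B) (Max A + 1)"] by auto
  have "\<forall>a\<in>A. a < x" using Max_ge[OF assms(1)] x(1) by fastforce
  moreover have "\<forall>b\<in>B. x < b" using Min_le[OF assms(2)] x(2) by fastforce
  ultimately show ?thesis using x(2) by (intro exI[of _ x]) auto
qed

text \<open>Differences do not change under a delay, and comparisons of nonnegative values with
  negative constants are settled. What remains are comparisons with \<open>0, ..., M\<close>. Each
  of them bounds \<open>d'\<close> from one side, and the bounds are compatible because their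
  relation is expressed by differences, on which \<open>u\<close> and \<open>u'\<close> agree. The
  bound on \<open>d'\<close> does not depend on \<open>d\<close>.\<close>

lemma region_eq_delay:
  assumes eq: "region_eq M L u u'" and nn: "\<And>i. i < L \<Longrightarrow> 0 \<le> u i" "\<And>i. i < L \<Longrightarrow> 0 \<le> u' i" and d: "0 \<le> d"
  shows "\<exists>d'\<ge>0. d' \<le> real M + 1 \<and> region_eq M L (\<lambda>i. u i + d) (\<lambda>i. u' i + d')"
proof -
  let ?Z = "{0..int M}"
  have goal: "region_eq M L (\<lambda>i. u i + d) (\<lambda>i. u' i + d')"
    if "0 \<le> d'"
      and "\<And>i z. i < L \<Longrightarrow> z \<in> ?Z \<Longrightarrow> (u i + d < of_int z \<longleftrightarrow> u' i + d' < of_int z)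
            \<and> (u i + d \<le> of_int z \<longleftrightarrow> u' i + d' \<le> of_int z)" for d'
    unfolding region_eq_def
  proof (intro allI impI conjI)
    fix i z assume i: "i < L" and z: "\<bar>z\<bar> \<le> int M"
    have *: "(u i + d < of_int z \<longleftrightarrow> u' i + d' < of_int z) \<and> (u i + d \<le> of_int z \<longleftrightarrow> u' i + d' \<le> of_int z)"
    proof (cases "0 \<le> z")
      case True
      then show ?thesis using that(2)[OF i, of z] z by auto
    next
      case False
      then have "real_of_int z < 0" by simp
      moreover have "0 \<le> u i + d" "0 \<le> u' i + d'" using nn[OF i] d that(1) by auto
      ultimately show ?thesis by linarith
    qed
    show "u i + d < of_int z \<longleftrightarrow> u' i + d' < of_int z" "u i + d \<le> of_int z \<longleftrightarrow> u' i + d' \<le> of_int z"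
      using * by auto
    fix j assume "j < L"
    then show "u i + d - (u j + d) < of_int z \<longleftrightarrow> u' i + d' - (u' j + d') < of_int z"
      using region_eqD(3)[OF eq i z, of j] by simp
  qed
  show ?thesis
  proof (cases "\<exists>i<L. \<exists>z\<in>?Z. u i + d = of_int z")
    case True
    then obtain i z where iz: "i < L" "z \<in> ?Z" "u i + d = of_int z" by blast
    \<comment> \<open>Some clock hits an integer, which forces the choice: the same clock must be
      taken to the same integer. Every other comparison then becomes one of differences with this
      clock.\<close>
    let ?d = "of_int z - u' i"
    have "u i \<le> of_int z" using iz d by linarith
    then have "u' i \<le> of_int z" using region_eqD(2)[OF eq iz(1), of z] iz(2) by auto
    then have d0: "0 \<le> ?d" by simp
    have "region_eq M L (\<lambda>i. u i + d) (\<lambda>i. u' i + ?d)"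
    proof (rule goal[OF d0])
      fix j z' assume j: "j < L" and z': "z' \<in> ?Z"
      have "\<bar>z' - z\<bar> \<le> int M" using iz z' by auto
      then have "(u j - u i < of_int (z' - z) \<longleftrightarrow> u' j - u' i < of_int (z' - z)) \<and>
         (u j - u i \<le> of_int (z' - z) \<longleftrightarrow> u' j - u' i \<le> of_int (z' - z))"
        using region_eqD(3,4)[OF eq j] iz by blast
      moreover have e: "u j + d = u j - u i + of_int z" "u' j + ?d = u' j - u' i + of_int z"
        using iz(3) by simp_all
      moreover have r: "a + of_int z < of_int z' \<longleftrightarrow> a < of_int (z' - z)"
        "a + of_int z \<le> of_int z' \<longleftrightarrow> a \<le> of_int (z' - z)" for a :: real by auto
      ultimately show "(u j + d < of_int z' \<longleftrightarrow> u' j + ?d < of_int z') \<and>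
          (u j + d \<le> of_int z' \<longleftrightarrow> u' j + ?d \<le> of_int z')"
        unfolding e r by blast
    qed
    moreover have "?d \<le> real M + 1"
    proof -
      have "real_of_int z \<le> real M" using iz(2) by (metis atLeastAtMost_iff of_int_le_iff of_int_of_nat_eq)
      then show ?thesis using nn(2)[OF iz(1)] by linarith
    qed
    ultimately show ?thesis using d0 by (intro exI[of _ ?d]) simp
  next
    case False
    \<comment> \<open>No clock is at an integer of the range, so all constraints on
      \<open>d'\<close> are strict: \<open>lo\<close> stems from the integers already passed, with 0
      added to keep the delay nonnegative, and \<open>hi\<close> from those not yet reached.\<close>
    define lo where "lo = insert 0 ((\<lambda>(i, z). of_int z - u' i) ` {(i, z) \<in> {..<L} \<times> ?Z. of_int z < u i + d})"
    define hi where "hi = (\<lambda>(i, z). of_int z - u' i) ` {(i, z) \<in> {..<L} \<times> ?Z. u i + d < of_int z}"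
    have "finite {(i, z) \<in> {..<L} \<times> ?Z. Q i z}" for Q
      by (rule finite_subset[of _ "{..<L} \<times> ?Z"]) auto
    then have fin: "finite lo" "finite hi" unfolding lo_def hi_def by simp_all
    have lohi: "a < b" if "a \<in> lo" "b \<in> hi" for a b
    proof -
      obtain j z where j: "j < L" "z \<in> ?Z" "u j + d < of_int z" and b: "b = of_int z - u' j"
        using \<open>b \<in> hi\<close> unfolding hi_def by auto
      consider "a = 0" | i z' where "i < L" "z' \<in> ?Z" "of_int z' < u i + d" "a = of_int z' - u' i"
        using \<open>a \<in> lo\<close> unfolding lo_def by auto
      then show ?thesis
      proof cases
        case 1
        have "u j < of_int z" using j d by linarith
        then show ?thesis using region_eqD(1)[OF eq j(1), of z] j(2) 1 b by auto
      next
        case (2 i z')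
        have "u j - u i < of_int (z - z')" using 2 j by simp
        moreover have "\<bar>z - z'\<bar> \<le> int M" using 2 j by auto
        ultimately have "u' j - u' i < of_int (z - z')" using region_eqD(3)[OF eq j(1)] 2 by blast
        then show ?thesis using 2 b by simp
      qed
    qed
    have ne: "lo \<noteq> {}" by (simp add: lo_def)
    obtain d' where d': "\<And>a. a \<in> lo \<Longrightarrow> a < d'" "\<And>b. b \<in> hi \<Longrightarrow> d' < b" "d' \<le> Max lo + 1"
      using finite_sets_between[OF fin ne lohi] by blast
    have d0: "0 \<le> d'" using d'(1)[of 0] by (simp add: lo_def)
    have "region_eq M L (\<lambda>i. u i + d) (\<lambda>i. u' i + d')"
    proof (rule goal[OF d0])
      fix j z assume j: "j < L" and z: "z \<in> ?Z"
      show "(u j + d < of_int z \<longleftrightarrow> u' j + d' < of_int z) \<and> (u j + d \<le> of_int z \<longleftrightarrow> u' j + d' \<le> of_int z)"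
      proof (cases "u j + d < of_int z")
        case True
        then have "of_int z - u' j \<in> hi" unfolding hi_def using j z by force
        then show ?thesis using d'(2) True by fastforce
      next
        case nl: False
        then have lt: "of_int z < u j + d" using False j z by (metis linorder_cases)
        then have "of_int z - u' j \<in> lo" unfolding lo_def using j z by force
        then have "of_int z - u' j < d'" using d'(1) by blast
        then show ?thesis using lt by auto
      qed
    qed
    moreover have "Max lo \<le> M"
    proof (subst Max_le_iff[OF fin(1)])
      show "lo \<noteq> {}" by (simp add: lo_def)
      show "\<forall>a\<in>lo. a \<le> real M"
      proof
        fix a assume "a \<in> lo"
        then consider "a = 0" | i z' where "i < L" "z' \<in> ?Z" "a = of_int z' - u' i"
          unfolding lo_def by auto
        then show "a \<le> real M"
        proof cases
          case (2 i z')
          have "real_of_int z' \<le> real M" using 2(2) by (metis atLeastAtMost_iff of_int_le_iff of_int_of_nat_eq)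
          then show ?thesis using 2 nn(2)[of i] by linarith
        qed simp
      qed
    qed
    ultimately show ?thesis using d0 d'(3) by (intro exI[of _ d']) auto
  qed
qed

text \<open>Induction on the number of nonzero clocks. Turning time back by the least nonzero value
  makes another clock zero. From a representative of that earlier valuation a delay of at most
  \<open>M + 1\<close> leads forward again, and the clocks that were zero are reset.\<close>

lemma region_bounded_representative:
  assumes "\<And>i. i < L \<Longrightarrow> 0 \<le> u i"
  shows "\<exists>u'. region_eq M L u u' \<and> (\<forall>i. 0 \<le> u' i \<and> u' i \<le> L * (M + 1))"
proof -
  have main: "\<exists>u'. region_eq M L u u' \<and> (\<forall>i. 0 \<le> u' i \<and> u' i \<le> c * (M + 1))"
    if "card {i. i < L \<and> u i \<noteq> 0} = c" "\<And>i. i < L \<Longrightarrow> 0 \<le> u i" for c u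
    using that
  proof (induction c arbitrary: u rule: less_induct)
    case (less c)
    let ?X = "{i. i < L \<and> u i \<noteq> 0}"
    show ?case
    proof (cases "?X = {}")
      case True
      then have "region_eq M L u (\<lambda>_. 0)" by (auto intro: region_eq_cong)
      then show ?thesis by (intro exI[of _ "\<lambda>_. 0"]) auto
    next
      case False
      define d where "d = Min (u ` ?X)"
      have d: "d \<in> u ` ?X" unfolding d_def using False by (intro Min_in) auto
      have dle: "d \<le> u i" if "i \<in> ?X" for i unfolding d_def using that by (intro Min_le) auto
      have d0: "0 \<le> d" using d less.prems(2) by auto
      define v where "v = (\<lambda>i. if i \<in> ?X then u i - d else 0)"
      have "{i. i < L \<and> v i \<noteq> 0} \<subset> ?X" using d by (auto simp: v_def)
      then have lt: "card {i. i < L \<and> v i \<noteq> 0} < c"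
        unfolding less.prems(1)[symmetric] by (intro psubset_card_mono) auto
      have vn: "0 \<le> v i" for i using dle by (auto simp: v_def)
      from less.IH[OF lt refl vn] obtain v' where v': "region_eq M L v v'"
        "\<And>i. 0 \<le> v' i \<and> v' i \<le> card {i. i < L \<and> v i \<noteq> 0} * (M + 1)" by auto
      obtain d' where d': "0 \<le> d'" "d' \<le> real M + 1" "region_eq M L (\<lambda>i. v i + d) (\<lambda>i. v' i + d')"
        using region_eq_delay[OF v'(1), of d] vn v'(2) d0 by auto
      let ?u' = "resets {i. i \<notin> ?X} (\<lambda>i. v' i + d')"
      have "region_eq M L (resets {i. i \<notin> ?X} (\<lambda>i. v i + d)) ?u'"
        using d'(3) by (rule region_eq_resets)
      moreover have "region_eq M L u (resets {i. i \<notin> ?X} (\<lambda>i. v i + d))"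
        by (rule region_eq_cong) (auto simp: resets_def v_def)
      ultimately have "region_eq M L u ?u'" using region_eq_trans by blast
      moreover have "0 \<le> ?u' i \<and> ?u' i \<le> c * (M + 1)" for i
      proof -
        have "v' i + d' \<le> Suc (card {i. i < L \<and> v i \<noteq> 0}) * (M + 1)"
          using v'(2)[of i] d'(2) by (simp add: algebra_simps)
        also have "\<dots> \<le> c * (M + 1)" using lt by (intro of_nat_mono mult_le_mono1) auto
        finally show ?thesis using v'(2)[of i] d'(1) by (auto simp: resets_def)
      qed
      ultimately show ?thesis by blast
    qed
  qed
  obtain u' where u': "region_eq M L u u'"
    "\<And>i. 0 \<le> u' i \<and> u' i \<le> real (card {i. i < L \<and> u i \<noteq> 0} * (M + 1))"
    using main[of u, OF refl assms] by blast
  have "card {i. i < L \<and> u i \<noteq> 0} \<le> L"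
    using card_mono[of "{..<L}" "{i. i < L \<and> u i \<noteq> 0}"] by auto
  then have "real (card {i. i < L \<and> u i \<noteq> 0} * (M + 1)) \<le> real (L * (M + 1))"
    by (intro of_nat_mono mult_le_mono1)
  then show ?thesis using u' by (intro exI[of _ u']) (auto intro: order_trans)
qed

lemma diff_less_int_iff:
  fixes a b :: real and z :: int
  shows "a - b < of_int z \<longleftrightarrow> \<lfloor>a\<rfloor> - \<lfloor>b\<rfloor> < z \<or> \<lfloor>a\<rfloor> - \<lfloor>b\<rfloor> = z \<and> frac a < frac b"
proof -
  have ab: "a - b = of_int (\<lfloor>a\<rfloor> - \<lfloor>b\<rfloor>) + (frac a - frac b)" by (simp add: frac_def)
  have f: "frac a - frac b < 1" "frac a - frac b > -1"
    using frac_lt_1[of a] frac_ge_0[of a] frac_lt_1[of b] frac_ge_0[of b] by linarith+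
  consider "\<lfloor>a\<rfloor> - \<lfloor>b\<rfloor> \<le> z - 1" | "\<lfloor>a\<rfloor> - \<lfloor>b\<rfloor> = z" | "\<lfloor>a\<rfloor> - \<lfloor>b\<rfloor> \<ge> z + 1" by linarith
  then show ?thesis
  proof cases
    case 1
    then have "real_of_int (\<lfloor>a\<rfloor> - \<lfloor>b\<rfloor>) \<le> of_int (z - 1)" by (simp only: of_int_le_iff)
    then show ?thesis using 1 ab f by (simp; linarith)
  next
    case 2
    then show ?thesis using ab by simp
  next
    case 3
    then have "real_of_int (\<lfloor>a\<rfloor> - \<lfloor>b\<rfloor>) \<ge> of_int (z + 1)" by (simp only: of_int_le_iff)
    then show ?thesis using 3 ab f by (simp; linarith)
  qed
qed

definition grid :: "nat \<Rightarrow> (nat \<Rightarrow> nat) \<Rightarrow> valuation" where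
  "grid Dn p = (\<lambda>i. real (p i) / real Dn)"

text \<open>Apart from the integer parts, only the order of the fractional parts matters and which
  of them vanish. So each fractional part is replaced by its rank among the nonzero ones, divided by
  \<open>Dn\<close>; there are at most \<open>L\<close> ranks above 0, and \<open>L < Dn\<close>
  keeps them below 1.\<close>

lemma region_grid_representative:
  assumes "\<And>i. i < L \<Longrightarrow> 0 \<le> u i" "L < Dn"
  shows "\<exists>p. region_eq M L u (grid Dn p) \<and> (\<forall>i. p i \<le> (L * (M + 1) + 1) * Dn)"
proof -
  obtain u' where u': "region_eq M L u u'" "\<And>i. 0 \<le> u' i" "\<And>i. u' i \<le> L * (M + 1)"
    using region_bounded_representative[of L u M, OF assms(1)] by blast
  \<comment> \<open>0 is excluded so that a clock gets rank 0 exactly if it is an integer.\<close>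
  define F where "F = (\<lambda>i. frac (u' i)) ` {..<L} - {0}"
  define rk where "rk f = card {y \<in> F. y \<le> f}" for f :: real
  define p where "p i = nat \<lfloor>u' i\<rfloor> * Dn + rk (frac (u' i))" for i
  have finF: "finite F" by (simp add: F_def)
  have rkL: "rk f < Dn" for f
  proof -
    have "card F \<le> L" unfolding F_def by (metis card_Diff1_le card_image_le card_lessThan finite_imageI finite_lessThan le_trans)
    moreover have "rk f \<le> card F" unfolding rk_def by (rule card_mono[OF finF]) auto
    ultimately show ?thesis using assms(2) by linarith
  qed
  have D0: "0 < Dn" using assms(2) by auto
  have val: "grid Dn p i = of_int \<lfloor>u' i\<rfloor> + real (rk (frac (u' i))) / Dn" for i
    using u'(2)[of i] D0 unfolding grid_def p_def by (simp add: add_divide_distrib)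
  have rk01: "0 \<le> real (rk f) / Dn" "real (rk f) / Dn < 1" for f
    using rkL[of f] D0 by (auto simp: divide_simps)
  have floor: "\<lfloor>grid Dn p i\<rfloor> = \<lfloor>u' i\<rfloor>" for i
    unfolding val using rk01[of "frac (u' i)"] by (intro floor_unique) auto
  have frac: "frac (grid Dn p i) = real (rk (frac (u' i))) / Dn" for i
    unfolding frac_def floor by (simp add: val frac_def)
  have lt: "frac (grid Dn p i) < frac (grid Dn p j) \<longleftrightarrow> frac (u' i) < frac (u' j)" if "j < L" "i < L" for i j
  proof -
    have mono: "rk a \<le> rk b" if "a \<le> b" for a b
      unfolding rk_def using that finF by (intro card_mono) auto
    have "rk (frac (u' i)) < rk (frac (u' j))" if "frac (u' i) < frac (u' j)"
    proof -
      have "0 \<le> frac (u' i)" by simp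
      then have "frac (u' j) \<noteq> 0" using that by linarith
      then have "frac (u' j) \<in> F" using \<open>j < L\<close> unfolding F_def by (simp del: frac_eq_0_iff)
      then have "frac (u' j) \<in> {y \<in> F. y \<le> frac (u' j)}" by simp
      moreover have "frac (u' j) \<notin> {y \<in> F. y \<le> frac (u' i)}" using that by simp
      moreover have "{y \<in> F. y \<le> frac (u' i)} \<subseteq> {y \<in> F. y \<le> frac (u' j)}" using that by auto
      ultimately have "{y \<in> F. y \<le> frac (u' i)} \<subset> {y \<in> F. y \<le> frac (u' j)}" by blast
      then show ?thesis unfolding rk_def using finF by (intro psubset_card_mono) auto
    qed
    then have "rk (frac (u' i)) < rk (frac (u' j)) \<longleftrightarrow> frac (u' i) < frac (u' j)"
      using mono[of "frac (u' j)" "frac (u' i)"] by (meson leD not_le)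
    then show ?thesis unfolding frac using D0 by (simp add: divide_less_cancel)
  qed
  have z: "frac (grid Dn p i) = 0 \<longleftrightarrow> frac (u' i) = 0" if "i < L" for i
  proof
    assume "frac (u' i) = 0"
    moreover have "0 < y" if y: "y \<in> F" for y
    proof -
      obtain j where "y = frac (u' j)" "y \<noteq> 0" using y unfolding F_def by blast
      then show ?thesis using frac_ge_0[of "u' j"] by linarith
    qed
    ultimately have "\<not> y \<le> frac (u' i)" if "y \<in> F" for y using that by (metis not_le)
    then have "{y \<in> F. y \<le> frac (u' i)} = {}" by blast
    then have "rk (frac (u' i)) = 0" unfolding rk_def by (simp only: card.empty)
    then show "frac (grid Dn p i) = 0" unfolding frac by simp
  next
    assume 0: "frac (grid Dn p i) = 0"
    show "frac (u' i) = 0"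
    proof (rule ccontr)
      assume "frac (u' i) \<noteq> 0"
      then have "frac (u' i) \<in> {y \<in> F. y \<le> frac (u' i)}" unfolding F_def using that by auto
      then have "rk (frac (u' i)) \<noteq> 0" unfolding rk_def using finF by auto
      then show False using 0 frac D0 by simp
    qed
  qed
  have "region_eq M L u' (grid Dn p)"
    unfolding region_eq_def
  proof (intro allI impI conjI)
    fix i z0 assume i: "i < L"
    show "u' i < of_int z0 \<longleftrightarrow> grid Dn p i < of_int z0"
      using floor[of i] by (metis floor_less_iff)
    have "x \<le> of_int z0 \<longleftrightarrow> \<lfloor>x\<rfloor> < z0 \<or> \<lfloor>x\<rfloor> = z0 \<and> frac x = 0" for x :: real
      unfolding frac_def using floor_less_iff[of x z0] of_int_floor_le[of x] by (smt (verit) of_int_less_iff floor_less_iff)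
    then show "u' i \<le> of_int z0 \<longleftrightarrow> grid Dn p i \<le> of_int z0"
      using floor[of i] z[OF i] by metis
    fix j assume j: "j < L"
    show "u' i - u' j < of_int z0 \<longleftrightarrow> grid Dn p i - grid Dn p j < of_int z0"
      unfolding diff_less_int_iff floor using lt[OF j i] by simp
  qed
  moreover have "p i \<le> (L * (M + 1) + 1) * Dn" for i
  proof -
    have "\<lfloor>u' i\<rfloor> \<le> int (L * (M + 1))" using u'(3)[of i] by linarith
    then have "nat \<lfloor>u' i\<rfloor> \<le> L * (M + 1)" by linarith
    then have "nat \<lfloor>u' i\<rfloor> * Dn \<le> L * (M + 1) * Dn" by (rule mult_le_mono1)
    then have "p i \<le> L * (M + 1) * Dn + Dn" unfolding p_def using rkL[of "frac (u' i)"] by linarith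
    then show ?thesis by (simp add: algebra_simps)
  qed
  ultimately show ?thesis using u'(1) region_eq_trans by blast
qed

text \<open>Adding the delay itself as one more clock reduces a pair of valuations to a single one.\<close>

lemma region_grid_delay:
  assumes nn: "\<And>i. i < L \<Longrightarrow> 0 \<le> u i" "0 \<le> d" "Suc L < Dn"
  shows "\<exists>p e. region_eq M L u (grid Dn p) \<and> region_eq M L (\<lambda>i. u i + d) (grid Dn (\<lambda>i. p i + e))
    \<and> (\<forall>i. p i \<le> (Suc L * (M + 1) + 1) * Dn) \<and> e \<le> (Suc L * (M + 1) + 1) * Dn"
proof -
  define v where "v i = (if i < L then u i + d else d)" for i
  have vn: "0 \<le> v i" if "i < Suc L" for i using nn that by (auto simp: v_def)
  from region_grid_representative[of "Suc L" v Dn M, OF vn nn(3)] obtain q where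
    q: "region_eq M (Suc L) v (grid Dn q)" "\<And>i. q i \<le> (Suc L * (M + 1) + 1) * Dn" by blast
  define p where "p i = q i - q L" for i
  have D0: "0 < real Dn" using nn(3) by auto
  \<comment> \<open>Coordinate \<open>L\<close> is the delay, and a clock after the delay is at
    least as large; hence the truncated subtraction in \<open>p\<close> is exact.\<close>
  have ge: "q L \<le> q i" if "i < L" for i
  proof -
    have "v L - v i \<le> of_int 0" using nn that by (simp add: v_def)
    then have "grid Dn q L - grid Dn q i \<le> of_int 0" using region_eqD(4)[OF q(1), of L 0 i] that by auto
    then show ?thesis using D0 by (simp add: grid_def divide_le_cancel)
  qed
  have gp: "grid Dn p i = grid Dn q i - grid Dn q L" if "i < L" for i
    unfolding grid_def p_def using ge[OF that] by (simp add: of_nat_diff diff_divide_distrib)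
  have "region_eq M L u (grid Dn p)" unfolding region_eq_def
  proof (intro allI impI conjI)
    fix i z assume i: "i < L" and z: "\<bar>z\<bar> \<le> int M"
    have vi: "u i = v i - v L" using i by (simp add: v_def)
    show "u i < of_int z \<longleftrightarrow> grid Dn p i < of_int z" "u i \<le> of_int z \<longleftrightarrow> grid Dn p i \<le> of_int z"
      unfolding vi gp[OF i] using region_eqD(3,4)[OF q(1), of i z L] i z by auto
    fix j assume j: "j < L"
    have "v i - v j < of_int z \<longleftrightarrow> grid Dn q i - grid Dn q j < of_int z"
      using region_eqD(3)[OF q(1), of i z j] i j z by auto
    then show "u i - u j < of_int z \<longleftrightarrow> grid Dn p i - grid Dn p j < of_int z"
      using i j gp by (simp add: v_def)
  qed
  moreover have "region_eq M L (\<lambda>i. u i + d) (grid Dn (\<lambda>i. p i + q L))"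
  proof -
    have "region_eq M L v (grid Dn q)" using q(1) by (rule region_eq_mono) auto
    moreover have "region_eq M L (\<lambda>i. u i + d) v" by (rule region_eq_cong) (simp add: v_def)
    moreover have "region_eq M L (grid Dn q) (grid Dn (\<lambda>i. p i + q L))"
      by (rule region_eq_cong) (use ge in \<open>simp add: grid_def p_def\<close>)
    ultimately show ?thesis using region_eq_trans by blast
  qed
  moreover have "p i \<le> (Suc L * (M + 1) + 1) * Dn" for i
    unfolding p_def using q(2)[of i] by (meson diff_le_self order_trans)
  ultimately show ?thesis using q(2) by blast
qed

section \<open>Controllers\<close>

type_synonym 'l edge = "'l \<times> nat option \<times> guard \<times> nat list \<times> 'l"
type_synonym 'q strategy = "'q \<Rightarrow> nat \<Rightarrow> valuation \<Rightarrow> nat set \<times> 'q"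

text \<open>A controller is the semantic form of a deterministic timed automaton: on a letter it sees the
  region of its clocks and answers with the clocks to reset and its next state.\<close>

definition controller :: "nat \<Rightarrow> nat \<Rightarrow> 'q set \<Rightarrow> 'q \<Rightarrow> 'q strategy \<Rightarrow> bool" where
  "controller k m Q s0 \<delta> \<longleftrightarrow> finite Q \<and> s0 \<in> Q \<and>
     (\<forall>s\<in>Q. \<forall>a w. (\<forall>x. 0 \<le> w x) \<longrightarrow> fst (\<delta> s a w) \<subseteq> {..<k} \<and> snd (\<delta> s a w) \<in> Q \<and>
        (\<forall>w'. (\<forall>x. 0 \<le> w' x) \<longrightarrow> region_eq m k w w' \<longrightarrow> \<delta> s a w' = \<delta> s a w))"

lemma controllerD:
  assumes "controller k m Q s0 \<delta>"
  shows "finite Q" "s0 \<in> Q"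
    "s \<in> Q \<Longrightarrow> (\<And>x. 0 \<le> w x) \<Longrightarrow> fst (\<delta> s a w) \<subseteq> {..<k}"
    "s \<in> Q \<Longrightarrow> (\<And>x. 0 \<le> w x) \<Longrightarrow> snd (\<delta> s a w) \<in> Q"
    "s \<in> Q \<Longrightarrow> (\<And>x. 0 \<le> w x) \<Longrightarrow> (\<And>x. 0 \<le> w' x) \<Longrightarrow> region_eq m k w w' \<Longrightarrow> \<delta> s a w' = \<delta> s a w"
proof -
  note D = assms[unfolded controller_def]
  show "finite Q" "s0 \<in> Q" using D by simp_all
  assume s: "s \<in> Q" and w: "\<And>x. 0 \<le> w x"
  have *: "fst (\<delta> s a w) \<subseteq> {..<k} \<and> snd (\<delta> s a w) \<in> Q \<and>
        (\<forall>w'. (\<forall>x. 0 \<le> w' x) \<longrightarrow> region_eq m k w w' \<longrightarrow> \<delta> s a w' = \<delta> s a w)"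
    using D s w by blast
  show "fst (\<delta> s a w) \<subseteq> {..<k}" "snd (\<delta> s a w) \<in> Q" using * by simp_all
  show "(\<And>x. 0 \<le> w' x) \<Longrightarrow> region_eq m k w w' \<Longrightarrow> \<delta> s a w' = \<delta> s a w" using * by blast
qed

fun control_run :: "'q strategy \<Rightarrow> 'q \<Rightarrow> valuation \<Rightarrow> real \<Rightarrow> (nat \<times> real) list \<Rightarrow> 'q" where
  "control_run \<delta> s w t [] = s"
| "control_run \<delta> s w t ((a, t') # ws) =
     control_run \<delta> (snd (\<delta> s a (\<lambda>x. w x + (t' - t))))
       (resets (fst (\<delta> s a (\<lambda>x. w x + (t' - t)))) (\<lambda>x. w x + (t' - t))) t' ws"

text \<open>A run depends on \<open>w\<close> and \<open>t\<close> only through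
  \<open>w x - t\<close>, so elapsed time can be charged to the past or to the next letter.\<close>

lemma control_run_delay: "control_run \<delta> s (\<lambda>x. w x + (t' - t)) t' ws = control_run \<delta> s w t ws"
  by (cases ws) auto

fun timed :: "nat list \<Rightarrow> real \<Rightarrow> (nat \<times> real) list \<Rightarrow> bool" where
  "timed Sig t [] \<longleftrightarrow> True"
| "timed Sig t ((a, t') # ws) \<longleftrightarrow> t \<le> t' \<and> a \<in> set Sig \<and> timed Sig t' ws"

lemma timed_earlier: "timed Sig t' ws \<Longrightarrow> t \<le> t' \<Longrightarrow> timed Sig t ws"
  by (cases ws) auto

lemma erase_simps [simp]:
  "erase [] = []" "erase ((None, t) # w) = erase w" "erase ((Some a, t) # w) = (a, t) # erase w"
  "erase (v @ w) = erase v @ erase w"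
  by (simp_all add: erase_def)

lemma erase_map_Some [simp]: "erase (map (\<lambda>(a, t). (Some a, t)) ws) = ws"
  by (induction ws) auto

lemma accepts_from_timed:
  assumes "accepts_from A q v t w" "wf_ta Sig A"
  shows "timed Sig t (erase w)"
  using assms(1)
proof induction
  case (acc_step t t' q b g R q' v w)
  then have "\<And>a. b = Some a \<Longrightarrow> a \<in> set Sig" using assms(2) unfolding wf_ta_def by fast
  then show ?case using acc_step by (cases b) (auto intro: timed_earlier)
qed auto

lemma accepts_from_cong:
  assumes "accepts_from A q v t w" "wf_ta Sig A" "\<And>i. i < clock_num A \<Longrightarrow> v i = v' i"
  shows "accepts_from A q v' t w"
  using assms(1,3)
proof (induction arbitrary: v')
  case (acc_nil q v t)
  then show ?case by (intro accepts_from.acc_nil)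
next
  case (acc_step t t' q b g R q' v w)
  have "\<forall>x\<in>gclocks g. x < clock_num A" using assms(2) acc_step(2) unfolding wf_ta_def by fast
  then have "gsat g (\<lambda>x. v' x + (t' - t))"
    using acc_step(3) gsat_cong[of g "\<lambda>x. v x + (t' - t)" "\<lambda>x. v' x + (t' - t)"] acc_step(6) by auto
  moreover have "accepts_from A q' (reset R (\<lambda>x. v' x + (t' - t))) t' w"
    using acc_step(6) by (intro acc_step(5)) (auto simp: reset_def)
  ultimately show ?case using acc_step(1,2) by (intro accepts_from.acc_step)
qed

text \<open>The delay is absorbed by the waiting time of the next step; before the empty word it
  leaves no trace.\<close>

lemma accepts_from_delay:
  assumes "accepts_from A q (\<lambda>x. v x + d) (t + d) w" "0 \<le> d"
  shows "accepts_from A q v t w"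
  using assms(1)
proof cases
  case acc_nil
  then show ?thesis by (auto intro: accepts_from.acc_nil)
next
  case (acc_step t' b g R q' w')
  have "(\<lambda>x. v x + d + (t' - (t + d))) = (\<lambda>x. v x + (t' - t))" by auto
  then show ?thesis using acc_step assms(2) by (auto intro!: accepts_from.acc_step)
qed

text \<open>One valuation holds all clocks: indices below \<open>n\<close> belong to the automaton,
  and \<open>n + x\<close> is clock \<open>x\<close> of the controller. Delays are separate steps
  and timestamps are absent, so that the relation can be studied on regions. A silent step is
  invisible to the controller and keeps its state.\<close>

inductive joint_reach ::
  "nat \<Rightarrow> 'l edge set \<Rightarrow> 'l set \<Rightarrow> 'q \<Rightarrow> 'q strategy \<Rightarrow> 'l \<Rightarrow> valuation \<Rightarrow> 'q \<Rightarrow> bool"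
  for n T I s0 \<delta> where
  init: "l \<in> I \<Longrightarrow> joint_reach n T I s0 \<delta> l (\<lambda>_. 0) s0"
| delay: "joint_reach n T I s0 \<delta> l u s \<Longrightarrow> 0 \<le> d \<Longrightarrow> joint_reach n T I s0 \<delta> l (\<lambda>i. u i + d) s"
| eps: "joint_reach n T I s0 \<delta> l u s \<Longrightarrow> (l, None, g, R, l') \<in> T \<Longrightarrow> gsat g u
    \<Longrightarrow> joint_reach n T I s0 \<delta> l' (resets (set R) u) s"
| letter: "joint_reach n T I s0 \<delta> l u s \<Longrightarrow> (l, Some a, g, R, l') \<in> T \<Longrightarrow> gsat g u
    \<Longrightarrow> \<delta> s a (\<lambda>x. u (n + x)) = (Y, s')
    \<Longrightarrow> joint_reach n T I s0 \<delta> l' (resets (set R \<union> (+) n ` Y) u) s'"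

lemma joint_reach_nonneg: "joint_reach n T I s0 \<delta> l u s \<Longrightarrow> 0 \<le> u i"
  by (induction rule: joint_reach.induct) (auto simp: resets_def)

lemma joint_reach_state:
  "joint_reach n T I s0 \<delta> l u s \<Longrightarrow> controller k m Q s0 \<delta> \<Longrightarrow> s \<in> Q"
proof (induction rule: joint_reach.induct)
  case (letter l u s a g R l' Y s')
  then have "s \<in> Q" by blast
  then have "snd (\<delta> s a (\<lambda>x. u (n + x))) \<in> Q"
    by (rule controllerD(4)[OF letter.prems]) (rule joint_reach_nonneg[OF letter.hyps(1)])
  then show ?case using letter.hyps(4) by simp
qed (blast dest: controllerD(2))+

text \<open>\<open>emb\<close> places the automaton inside a larger edge set, so the lemma serves
  both given automata. A step of the run becomes a delay and a discrete step. Its resets concern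
  clocks below \<open>n\<close> only, which keeps the controller clocks in line with
  \<open>control_run\<close>.\<close>

lemma accepts_joint_reach:
  assumes "accepts_from A q v t w" "wf_ta Sig A" "clock_num A \<le> n"
    and T: "\<And>q b g R q'. (q, b, g, R, q') \<in> set (trans A) \<Longrightarrow> (emb q, b, g, R, emb q') \<in> T"
    and "joint_reach n T I s0 \<delta> (emb q) u s" "\<And>i. i < n \<Longrightarrow> u i = v i"
  shows "\<exists>qf uf. qf \<in> set (final A) \<and>
    joint_reach n T I s0 \<delta> (emb qf) uf (control_run \<delta> s (\<lambda>x. u (n + x)) t (erase w))"
  using assms(1,5,6)
proof (induction arbitrary: u s)
  case (acc_nil q v t)
  then show ?case by auto
next
  case (acc_step t t' q b g R q' v w)
  let ?u = "\<lambda>i. u i + (t' - t)" and ?v = "\<lambda>i. v i + (t' - t)"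
  have wf: "\<forall>x\<in>gclocks g. x < n" "\<forall>x\<in>set R. x < n" "(emb q, b, g, R, emb q') \<in> T"
    using assms(2,3) acc_step(2) T unfolding wf_ta_def by fastforce+
  have reach: "joint_reach n T I s0 \<delta> (emb q) ?u s"
    using acc_step(1,6) by (intro joint_reach.delay) auto
  have g: "gsat g ?u" using acc_step(3,7) wf(1) gsat_cong[of g ?u ?v] by auto
  show ?case
  proof (cases b)
    case None
    have "joint_reach n T I s0 \<delta> (emb q') (resets (set R) ?u) s"
      using reach wf(3) g None by (auto intro: joint_reach.eps)
    moreover have "resets (set R) ?u i = reset R ?v i" if "i < n" for i
      using acc_step(7) that by (simp add: reset_def resets_def)
    ultimately obtain qf uf where f: "qf \<in> set (final A)"
      "joint_reach n T I s0 \<delta> (emb qf) uf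
         (control_run \<delta> s (\<lambda>x. resets (set R) ?u (n + x)) t' (erase w))"
      using acc_step(5) by blast
    moreover have "(\<lambda>x. resets (set R) ?u (n + x)) = (\<lambda>x. u (n + x) + (t' - t))"
      using wf(2) by (fastforce simp: resets_def)
    ultimately show ?thesis using None by (auto simp: control_run_delay)
  next
    case (Some a)
    obtain Y s' where Y: "\<delta> s a (\<lambda>x. ?u (n + x)) = (Y, s')" by force
    have "joint_reach n T I s0 \<delta> (emb q') (resets (set R \<union> (+) n ` Y) ?u) s'"
      using reach wf(3) g Some Y by (auto intro: joint_reach.letter)
    moreover have "resets (set R \<union> (+) n ` Y) ?u i = reset R ?v i" if "i < n" for i
      using acc_step(7) that by (auto simp: reset_def resets_def)
    ultimately obtain qf uf where f: "qf \<in> set (final A)"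
      "joint_reach n T I s0 \<delta> (emb qf) uf
         (control_run \<delta> s' (\<lambda>x. resets (set R \<union> (+) n ` Y) ?u (n + x)) t' (erase w))"
      using acc_step(5) by blast
    moreover have "(\<lambda>x. resets (set R \<union> (+) n ` Y) ?u (n + x)) = resets Y (\<lambda>x. u (n + x) + (t' - t))"
      using wf(2) by (fastforce simp: resets_def)
    ultimately show ?thesis using Some Y by auto
  qed
qed

text \<open>\<open>accepts_from\<close> knows complete accepted words only, so the partial run that
  reaches the configuration is described by its effect on every continuation: any word accepted from
  here is accepted after \<open>wp\<close>, and the controller continues after \<open>wp\<close> as
  it does from \<open>s\<close>.\<close>

lemma joint_reach_prefix:
  assumes "joint_reach n T I s0 \<delta> l u s" "l = emb q" "inj emb" "wf_ta Sig A" "clock_num A \<le> n"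
    and T: "\<And>l b g R q'. (l, b, g, R, emb q') \<in> T \<Longrightarrow> \<exists>q. l = emb q \<and> (q, b, g, R, q') \<in> set (trans A)"
    and I: "\<And>q. emb q \<in> I \<Longrightarrow> q \<in> set (initial A)"
  shows "\<exists>q0\<in>set (initial A). \<exists>wp t.
    (\<forall>w. accepts_from A q u t w \<longrightarrow> accepts_from A q0 (\<lambda>_. 0) 0 (wp @ w)) \<and>
    (\<forall>ws. control_run \<delta> s0 (\<lambda>_. 0) 0 (erase wp @ ws) = control_run \<delta> s (\<lambda>x. u (n + x)) t ws)"
  using assms(1,2)
proof (induction arbitrary: q)
  case (init l)
  then show ?case using I by (intro bexI[of _ q] exI[of _ "[]"] exI[of _ 0]) auto
next
  case (delay l u s d)
  then obtain q0 wp t where *: "q0 \<in> set (initial A)"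
    "\<And>w. accepts_from A q u t w \<Longrightarrow> accepts_from A q0 (\<lambda>_. 0) 0 (wp @ w)"
    "\<And>ws. control_run \<delta> s0 (\<lambda>_. 0) 0 (erase wp @ ws) = control_run \<delta> s (\<lambda>x. u (n + x)) t ws"
    by blast
  have "control_run \<delta> s (\<lambda>x. u (n + x) + d) (t + d) ws = control_run \<delta> s (\<lambda>x. u (n + x)) t ws" for ws
    using control_run_delay[of \<delta> s "\<lambda>x. u (n + x)" "t + d" t ws] by simp
  then show ?case using * accepts_from_delay[OF _ delay(2)]
    by (intro bexI[of _ q0] exI[of _ wp] exI[of _ "t + d"]) auto
next
  case (eps l u s g R l')
  then obtain q1 where q1: "l = emb q1" "(q1, None, g, R, q) \<in> set (trans A)" using T by blast
  then obtain q0 wp t where *: "q0 \<in> set (initial A)"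
    "\<And>w. accepts_from A q1 u t w \<Longrightarrow> accepts_from A q0 (\<lambda>_. 0) 0 (wp @ w)"
    "\<And>ws. control_run \<delta> s0 (\<lambda>_. 0) 0 (erase wp @ ws) = control_run \<delta> s (\<lambda>x. u (n + x)) t ws"
    using eps.IH by blast
  have "\<forall>x\<in>set R. x < n" using assms(4,5) q1(2) unfolding wf_ta_def by fastforce
  then have "(\<lambda>x. resets (set R) u (n + x)) = (\<lambda>x. u (n + x))" by (fastforce simp: resets_def)
  moreover have "accepts_from A q1 u t ((None, t) # w)" if "accepts_from A q (resets (set R) u) t w" for w
    using that q1(2) eps.hyps(3)
    by (intro accepts_from.acc_step[of t t q1 None g R q]) (auto simp: reset_eq_resets)
  ultimately show ?case using *
    by (intro bexI[of _ q0] exI[of _ "wp @ [(None, t)]"] exI[of _ t]) auto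
next
  case (letter l u s a g R l' Y s')
  then obtain q1 where q1: "l = emb q1" "(q1, Some a, g, R, q) \<in> set (trans A)" using T by blast
  then obtain q0 wp t where *: "q0 \<in> set (initial A)"
    "\<And>w. accepts_from A q1 u t w \<Longrightarrow> accepts_from A q0 (\<lambda>_. 0) 0 (wp @ w)"
    "\<And>ws. control_run \<delta> s0 (\<lambda>_. 0) 0 (erase wp @ ws) = control_run \<delta> s (\<lambda>x. u (n + x)) t ws"
    using letter.IH by blast
  have "\<forall>x\<in>set R. x < n" using assms(4,5) q1(2) unfolding wf_ta_def by fastforce
  then have "(\<lambda>x. resets (set R \<union> (+) n ` Y) u (n + x)) = resets Y (\<lambda>x. u (n + x))"
    by (fastforce simp: resets_def)
  moreover have "accepts_from A q1 u t ((Some a, t) # w)"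
    if acc: "accepts_from A q (resets (set R \<union> (+) n ` Y) u) t w" for w
  proof -
    have "accepts_from A q (resets (set R) u) t w"
      by (rule accepts_from_cong[OF acc assms(4)]) (use assms(5) in \<open>auto simp: resets_def\<close>)
    then show ?thesis using q1(2) letter.hyps(3)
      by (intro accepts_from.acc_step[of t t q1 "Some a" g R q]) (auto simp: reset_eq_resets)
  qed
  ultimately show ?case using * letter.hyps(4)
    by (intro bexI[of _ q0] exI[of _ "wp @ [(Some a, t)]"] exI[of _ t]) auto
qed

text \<open>\<open>f\<close> gives the location of \<open>X\<close> that mirrors a controller state,
  and \<open>step\<close> says that an enabled transition does what the controller does. Both
  translations use it, once with \<open>Q\<close> the live states of a strategy read off
  \<open>X\<close>, once with \<open>Q\<close> the states of the controller from which
  \<open>X\<close> is built.\<close>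

lemma accepts_control_run:
  assumes "accepts_from X q v t w" "q = f s" "s \<in> Q" "\<And>x. 0 \<le> v x"
    and step: "\<And>s b g R q' v. s \<in> Q \<Longrightarrow> (f s, b, g, R, q') \<in> set (trans X) \<Longrightarrow> (\<And>x. 0 \<le> v x) \<Longrightarrow> gsat g v
       \<Longrightarrow> \<exists>a s'. b = Some a \<and> \<delta> s a v = (set R, s') \<and> q' = f s' \<and> s' \<in> Q"
  shows "control_run \<delta> s v t (erase w) \<in> Q \<and> f (control_run \<delta> s v t (erase w)) \<in> set (final X)"
  using assms(1-4)
proof (induction arbitrary: s)
  case (acc_step t t' q b g R q' v w)
  have nn: "\<And>x. 0 \<le> v x + (t' - t)" using acc_step(1,8) by (simp add: add_nonneg_nonneg)
  obtain a s' where "b = Some a" "\<delta> s a (\<lambda>x. v x + (t' - t)) = (set R, s')" "q' = f s'" "s' \<in> Q"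
    using step[OF acc_step(7) _ nn acc_step(3)] acc_step(2,6) by blast
  moreover have "control_run \<delta> s' (reset R (\<lambda>x. v x + (t' - t))) t' (erase w) \<in> Q \<and>
     f (control_run \<delta> s' (reset R (\<lambda>x. v x + (t' - t))) t' (erase w)) \<in> set (final X)"
    using calculation nn by (intro acc_step(5)) (auto simp: reset_def)
  ultimately show ?case by (simp add: reset_eq_resets)
qed auto

text \<open>By \<open>dead\<close> the set \<open>Q\<close> is never entered from outside, so a run
  that ends in \<open>Q\<close> has been there all along and each of its steps can be copied by
  \<open>X\<close>.\<close>

lemma control_run_accepts:
  assumes "timed Sig t ws" "\<And>x. 0 \<le> v x" "control_run \<delta> s v t ws \<in> Q" "f (control_run \<delta> s v t ws) \<in> set (final X)"
    and dead: "\<And>s a v. s \<notin> Q \<Longrightarrow> snd (\<delta> s a v) \<notin> Q"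
    and step: "\<And>s a v. s \<in> Q \<Longrightarrow> a \<in> set Sig \<Longrightarrow> (\<And>x. 0 \<le> v x) \<Longrightarrow> snd (\<delta> s a v) \<in> Q
      \<Longrightarrow> \<exists>g R. (f s, Some a, g, R, f (snd (\<delta> s a v))) \<in> set (trans X) \<and> gsat g v \<and> set R = fst (\<delta> s a v)"
  shows "accepts_from X (f s) v t (map (\<lambda>(a, t). (Some a, t)) ws)"
proof -
  have alive: "s \<in> Q" if "control_run \<delta> s v t ws \<in> Q" for s v t ws
    using that
  proof (induction ws arbitrary: s v t)
    case (Cons p ws)
    obtain a t' where "p = (a, t')" by force
    then show ?case using Cons dead by fastforce
  qed auto
  show ?thesis using assms(1-4)
  proof (induction ws arbitrary: s v t)
    case Nil
    then show ?case by (auto intro: acc_nil)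
  next
    case (Cons p ws)
    obtain a t' where p: "p = (a, t')" by force
    let ?v = "\<lambda>x. v x + (t' - t)"
    let ?s = "snd (\<delta> s a ?v)" and ?w = "resets (fst (\<delta> s a ?v)) ?v"
    have nn: "\<And>x. 0 \<le> ?v x" using Cons.prems(1,2) p by (simp add: add_nonneg_nonneg)
    have Q: "s \<in> Q" "?s \<in> Q" using alive[OF Cons.prems(3)] alive[of ?s ?w t' ws] Cons.prems(3) p by auto
    obtain g R where gR: "(f s, Some a, g, R, f ?s) \<in> set (trans X)" "gsat g ?v" "set R = fst (\<delta> s a ?v)"
      using step[OF Q(1) _ nn Q(2)] Cons.prems(1) p by auto
    have "accepts_from X (f ?s) ?w t' (map (\<lambda>(a, t). (Some a, t)) ws)"
      using Cons.prems p nn by (intro Cons.IH) (auto simp: resets_def)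
    then have "accepts_from X (f s) v t ((Some a, t') # map (\<lambda>(a, t). (Some a, t)) ws)"
      using gR Cons.prems(1) p by (intro acc_step[of t t' "f s" "Some a" g R "f ?s"]) (auto simp: reset_eq_resets)
    then show ?case using p by simp
  qed
qed

section \<open>From deterministic automata to controllers\<close>

definition union_edges :: "ta \<Rightarrow> ta \<Rightarrow> nat edge set" where
  "union_edges A B = {(2 * q, b, g, R, 2 * q') | q b g R q'. (q, b, g, R, q') \<in> set (trans A)}
     \<union> {(2 * q + 1, b, g, R, 2 * q' + 1) | q b g R q'. (q, b, g, R, q') \<in> set (trans B)}"

definition union_init :: "ta \<Rightarrow> ta \<Rightarrow> nat set" where
  "union_init A B = (\<lambda>q. 2 * q) ` set (initial A) \<union> (\<lambda>q. 2 * q + 1) ` set (initial B)"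

text \<open>Locations of \<open>A\<close> are the even numbers and those of \<open>B\<close> the odd
  ones, so one reachability relation covers both. A controller has no accepting states of its own: a
  suitable choice of them exists precisely if no state is reached with final configurations of both
  automata.\<close>

definition separating :: "nat \<Rightarrow> ta \<Rightarrow> ta \<Rightarrow> 'q \<Rightarrow> 'q strategy \<Rightarrow> bool" where
  "separating n A B s0 \<delta> \<longleftrightarrow> \<not> (\<exists>s q u q' u'. q \<in> set (final A) \<and> q' \<in> set (final B) \<and>
     joint_reach n (union_edges A B) (union_init A B) s0 \<delta> (2 * q) u s \<and>
     joint_reach n (union_edges A B) (union_init A B) s0 \<delta> (2 * q' + 1) u' s)"

lemma union_edges_A: "(q, b, g, R, q') \<in> set (trans A) \<Longrightarrow> (2 * q, b, g, R, 2 * q') \<in> union_edges A B"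
  by (auto simp: union_edges_def)

lemma union_edges_B: "(q, b, g, R, q') \<in> set (trans B) \<Longrightarrow> (2 * q + 1, b, g, R, 2 * q' + 1) \<in> union_edges A B"
  by (auto simp: union_edges_def)

lemma union_edges_A_inv:
  "(l, b, g, R, 2 * q') \<in> union_edges A B \<Longrightarrow> \<exists>q. l = 2 * q \<and> (q, b, g, R, q') \<in> set (trans A)"
  by (auto simp: union_edges_def Suc_double_not_eq_double double_not_eq_Suc_double)

lemma union_edges_B_inv:
  "(l, b, g, R, 2 * q' + 1) \<in> union_edges A B \<Longrightarrow> \<exists>q. l = 2 * q + 1 \<and> (q, b, g, R, q') \<in> set (trans B)"
  by (auto simp: union_edges_def Suc_double_not_eq_double double_not_eq_Suc_double)

lemma union_init_A_inv: "2 * q \<in> union_init A B \<Longrightarrow> q \<in> set (initial A)"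
  by (auto simp: union_init_def Suc_double_not_eq_double double_not_eq_Suc_double)

lemma union_init_B_inv: "2 * q + 1 \<in> union_init A B \<Longrightarrow> q \<in> set (initial B)"
  by (auto simp: union_init_def Suc_double_not_eq_double double_not_eq_Suc_double)

text \<open>\<open>None\<close> is a sink, entered when no transition can read the letter. The
  choice operator picks the only candidate, by determinism.\<close>

definition dta_strategy :: "ta \<Rightarrow> nat option strategy" where
  "dta_strategy X s a v = (case s of None \<Rightarrow> ({}, None)
     | Some q \<Rightarrow> if \<exists>g R q'. (q, Some a, g, R, q') \<in> set (trans X) \<and> gsat g v
         then (SOME p. \<exists>g R q'. (q, Some a, g, R, q') \<in> set (trans X) \<and> gsat g v \<and> p = (set R, Some q'))
         else ({}, None))"

lemma dta_strategy_step:
  assumes "deterministic X" "(q, Some a, g, R, q') \<in> set (trans X)" "gsat g v" "\<And>x. 0 \<le> v x"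
  shows "dta_strategy X (Some q) a v = (set R, Some q')"
proof -
  let ?P = "\<lambda>p. \<exists>g R q'. (q, Some a, g, R, q') \<in> set (trans X) \<and> gsat g v \<and> p = (set R, Some q')"
  have det: "q1 = q2 \<and> set R1 = set R2"
    if "(q, Some a, g1, R1, q1) \<in> set (trans X)" "(q, Some a, g2, R2, q2) \<in> set (trans X)"
      "gsat g1 v" "gsat g2 v" for g1 R1 q1 g2 R2 q2
  proof -
    have "\<forall>(q1, b1, g1, R1, q1') \<in> set (trans X). \<forall>(q2, b2, g2, R2, q2') \<in> set (trans X).
        (q1 = q2 \<and> b1 = b2 \<and> (\<exists>v. (\<forall>x. v x \<ge> 0) \<and> gsat g1 v \<and> gsat g2 v))
        \<longrightarrow> q1' = q2' \<and> set R1 = set R2"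
      using assms(1) unfolding deterministic_def by (elim conjE)
    from bspec[OF bspec[OF this that(1), unfolded split_conv] that(2), unfolded split_conv]
    show ?thesis using that(3,4) assms(4) by blast
  qed
  have "?P (set R, Some q')" using assms by blast
  then have "?P (Eps ?P)" by (rule someI)
  then have "Eps ?P = (set R, Some q')" using det assms(2,3) by blast
  moreover have "\<exists>g R q'. (q, Some a, g, R, q') \<in> set (trans X) \<and> gsat g v" using assms(2,3) by blast
  ultimately show ?thesis unfolding dta_strategy_def option.case by (simp only: if_True)
qed

lemma dta_strategy_no_step:
  "\<not> (\<exists>g R q'. (q, Some a, g, R, q') \<in> set (trans X) \<and> gsat g v) \<Longrightarrow> dta_strategy X (Some q) a v = ({}, None)"
  unfolding dta_strategy_def option.case by (rule if_not_P)

text \<open>Suppose that a state \<open>s\<close> is reached with final configurations of both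
  automata. The word leading there with \<open>A\<close> is accepted by \<open>X\<close>, so
  \<open>s\<close> is an accepting location; then the word leading there with \<open>B\<close> is
  accepted by \<open>X\<close> as well, against disjointness.\<close>

lemma km_separable_controller:
  assumes sep: "km_separable k m Sig A B" and wf: "wf_ta Sig A" "wf_ta Sig B"
    and n: "clock_num A \<le> n" "clock_num B \<le> n"
  shows "\<exists>(Q :: nat option set) s0 \<delta>. controller k m Q s0 \<delta> \<and> separating n A B s0 \<delta>"
proof -
  obtain X where X: "wf_ta Sig X" "deterministic X" "clock_num X \<le> k" "consts_bounded m X"
    "lang A \<subseteq> lang X" "lang X \<inter> lang B = {}"
    using sep unfolding km_separable_def by blast
  obtain i where i: "set (initial X) = {i}"
    using X(2) unfolding deterministic_def by (metis card_1_singletonE)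
  let ?\<delta> = "dta_strategy X"
  define Q where "Q = insert i ((\<lambda>(q, b, g, R, q'). q') ` set (trans X))"
  have Q: "q' \<in> Q" if "(q, b, g, R, q') \<in> set (trans X)" for q b g R q'
    using that unfolding Q_def by force
  have dec: "\<delta> = ({}, None) \<or> (\<exists>q q' g R. s = Some q \<and> (q, Some a, g, R, q') \<in> set (trans X) \<and> gsat g w
      \<and> \<delta> = (set R, Some q'))" if "\<delta> = ?\<delta> s a w" "\<And>x. 0 \<le> w x" for \<delta> s a and w :: valuation
  proof (cases s)
    case None
    then show ?thesis using that by (simp add: dta_strategy_def)
  next
    case (Some q)
    then show ?thesis using that dta_strategy_no_step[of q a X w] dta_strategy_step[OF X(2), of q a _ _ _ w] by blast
  qed
  have "controller k m (insert None (Some ` Q)) (Some i) ?\<delta>"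
    unfolding controller_def
  proof (intro conjI ballI allI impI)
    fix s a and w :: valuation assume w: "\<forall>x. 0 \<le> w x"
    show "fst (?\<delta> s a w) \<subseteq> {..<k}" "snd (?\<delta> s a w) \<in> insert None (Some ` Q)"
    proof -
      show "fst (?\<delta> s a w) \<subseteq> {..<k}"
        using dec[OF refl, of w s a] w X(1,3) unfolding wf_ta_def by fastforce
      show "snd (?\<delta> s a w) \<in> insert None (Some ` Q)"
        using dec[OF refl, of w s a] w Q by fastforce
    qed
    fix w' :: valuation assume w': "\<forall>x. 0 \<le> w' x" "region_eq m k w w'"
    have g: "gsat g w \<longleftrightarrow> gsat g w'" if "(q, b, g, R, q') \<in> set (trans X)" for q b g R q'
    proof (rule gsat_region_eq[OF w'(2)])
      show "\<forall>x\<in>gclocks g. x < k" using that X(1,3) unfolding wf_ta_def by fastforce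
      show "\<forall>z\<in>gconsts g. \<bar>z\<bar> \<le> int m" using that X(4) unfolding consts_bounded_def by fast
    qed
    \<comment> \<open>The strategy depends on \<open>w\<close> only through the set of enabled
      transitions, also inside the choice operator, and this set is determined by the
      region.\<close>
    then have eq: "(\<exists>g R q'. (q, Some a, g, R, q') \<in> set (trans X) \<and> gsat g w \<and> P R q') \<longleftrightarrow>
        (\<exists>g R q'. (q, Some a, g, R, q') \<in> set (trans X) \<and> gsat g w' \<and> P R q')"
      "(\<exists>g R q'. (q, Some a, g, R, q') \<in> set (trans X) \<and> gsat g w) \<longleftrightarrow>
        (\<exists>g R q'. (q, Some a, g, R, q') \<in> set (trans X) \<and> gsat g w')" for q P by blast+
    show "?\<delta> s a w' = ?\<delta> s a w" unfolding dta_strategy_def eq ..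
  qed (auto simp: Q_def)
  moreover have "separating n A B (Some i) ?\<delta>"
    unfolding separating_def
  proof
    let ?reach = "joint_reach n (union_edges A B) (union_init A B) (Some i) ?\<delta>"
    assume "\<exists>s q u q' u'. q \<in> set (final A) \<and> q' \<in> set (final B) \<and> ?reach (2 * q) u s \<and> ?reach (2 * q' + 1) u' s"
    then obtain s q u q' u' where *: "q \<in> set (final A)" "q' \<in> set (final B)"
      "?reach (2 * q) u s" "?reach (2 * q' + 1) u' s" by blast
    have inj: "inj (\<lambda>q::nat. 2 * q)" "inj (\<lambda>q::nat. 2 * q + 1)" by (auto intro: injI)
    obtain q0 wp t where A: "q0 \<in> set (initial A)"
      "\<And>w. accepts_from A q u t w \<Longrightarrow> accepts_from A q0 (\<lambda>_. 0) 0 (wp @ w)"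
      "\<And>ws. control_run ?\<delta> (Some i) (\<lambda>_. 0) 0 (erase wp @ ws) = control_run ?\<delta> s (\<lambda>x. u (n + x)) t ws"
      using joint_reach_prefix[OF *(3) refl inj(1) wf(1) n(1) union_edges_A_inv[of _ _ _ _ _ A B] union_init_A_inv[of _ A B]] by blast
    have "accepts_from A q0 (\<lambda>_. 0) 0 wp" using A(2)[OF acc_nil[OF *(1)]] by simp
    then have "erase wp \<in> lang X" using A(1) X(5) unfolding lang_def by blast
    then obtain w where w: "erase w = erase wp" "accepts_from X i (\<lambda>_. 0) 0 w"
      unfolding lang_def using i by auto
    have "control_run ?\<delta> (Some i) (\<lambda>_. 0) 0 (erase w) \<in> range Some \<and>
        the (control_run ?\<delta> (Some i) (\<lambda>_. 0) 0 (erase w)) \<in> set (final X)"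
    proof (rule accepts_control_run[OF w(2)])
      show "i = the (Some i)" "Some i \<in> range Some" by (auto simp: Q_def)
      fix s b g R q' and v :: valuation
      assume s: "s \<in> range Some" "(the s, b, g, R, q') \<in> set (trans X)" "\<And>x. 0 \<le> v x" "gsat g v"
      obtain q where q: "s = Some q" using s(1) by blast
      obtain a where a: "b = Some a" using X(2) s(2) unfolding deterministic_def by fast
      then show "\<exists>a s'. b = Some a \<and> ?\<delta> s a v = (set R, s') \<and> q' = the s' \<and> s' \<in> range Some"
        using dta_strategy_step[OF X(2), of q a g R q' v] s q Q[OF s(2)] by auto
    qed auto
    then have s: "s \<in> range Some" "the s \<in> set (final X)" using A(3)[of "[]"] w(1) by simp_all
    obtain q0' wp' t' where B: "q0' \<in> set (initial B)"
      "\<And>w. accepts_from B q' u' t' w \<Longrightarrow> accepts_from B q0' (\<lambda>_. 0) 0 (wp' @ w)"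
      "\<And>ws. control_run ?\<delta> (Some i) (\<lambda>_. 0) 0 (erase wp' @ ws) = control_run ?\<delta> s (\<lambda>x. u' (n + x)) t' ws"
      using joint_reach_prefix[OF *(4) refl inj(2) wf(2) n(2) union_edges_B_inv[of _ _ _ _ _ A B] union_init_B_inv[of _ A B]] by blast
    have acc: "accepts_from B q0' (\<lambda>_. 0) 0 wp'" using B(2)[OF acc_nil[OF *(2)]] by simp
    then have "erase wp' \<in> lang B" using B(1) unfolding lang_def by blast
    moreover have "accepts_from X (the (Some i)) (\<lambda>_. 0) 0 (map (\<lambda>(a, t). (Some a, t)) (erase wp'))"
    proof (rule control_run_accepts[where f = the and Q = "range Some" and \<delta> = ?\<delta>, OF accepts_from_timed[OF acc wf(2)]])
      show "control_run ?\<delta> (Some i) (\<lambda>_. 0) 0 (erase wp') \<in> range Some"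
        "the (control_run ?\<delta> (Some i) (\<lambda>_. 0) 0 (erase wp')) \<in> set (final X)"
        using B(3)[of "[]"] s by simp_all
      fix s a and v :: valuation
      show "snd (?\<delta> s a v) \<notin> range Some" if "s \<notin> range Some"
        using that by (cases s) (auto simp: dta_strategy_def)
      assume "s \<in> range Some" "\<And>x. 0 \<le> v x" "snd (?\<delta> s a v) \<in> range Some"
      then show "\<exists>g R. (the s, Some a, g, R, the (snd (?\<delta> s a v))) \<in> set (trans X) \<and> gsat g v \<and> set R = fst (?\<delta> s a v)"
        using dec[OF refl, of v s a] by fastforce
    qed auto
    ultimately show False using X(6) i unfolding lang_def
      by (smt (verit) disjoint_iff erase_map_Some mem_Collect_eq option.sel singletonI)
  qed
  ultimately show ?thesis by blast
qed

section \<open>From controllers to deterministic automata\<close>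

fun gconj :: "guard list \<Rightarrow> guard" where
  "gconj [] = GTrue"
| "gconj (g # gs) = GAnd g (gconj gs)"

lemma gconj_simps [simp]:
  "gsat (gconj gs) v \<longleftrightarrow> (\<forall>g\<in>set gs. gsat g v)"
  "gclocks (gconj gs) = (\<Union>g\<in>set gs. gclocks g)" "gconsts (gconj gs) = (\<Union>g\<in>set gs. gconsts g)"
  by (induction gs) auto

definition region_atoms :: "nat \<Rightarrow> nat \<Rightarrow> guard list" where
  "region_atoms k m = (SOME gs. set gs = {GAtom x c z | x c z. x < k \<and> c \<in> {Lt, Le} \<and> \<bar>z\<bar> \<le> int m}
     \<union> {GDiff x y Lt z | x y z. x < k \<and> y < k \<and> \<bar>z\<bar> \<le> int m})"

definition region_guard :: "nat \<Rightarrow> nat \<Rightarrow> valuation \<Rightarrow> guard" where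
  "region_guard k m w = gconj (map (\<lambda>g. if gsat g w then g else GNot g) (region_atoms k m))"

lemma set_region_atoms:
  "set (region_atoms k m) = {GAtom x c z | x c z. x < k \<and> c \<in> {Lt, Le} \<and> \<bar>z\<bar> \<le> int m}
     \<union> {GDiff x y Lt z | x y z. x < k \<and> y < k \<and> \<bar>z\<bar> \<le> int m}" (is "_ = ?A \<union> ?B")
proof -
  let ?Z = "{- int m..int m}"
  have "?A \<subseteq> (\<lambda>(x, c, z). GAtom x c z) ` ({..<k} \<times> {Lt, Le} \<times> ?Z)"
  proof clarify
    fix x c z assume "x < k" "c \<in> {Lt, Le}" "\<bar>z\<bar> \<le> int m"
    then show "GAtom x c z \<in> (\<lambda>(x, c, z). GAtom x c z) ` ({..<k} \<times> {Lt, Le} \<times> ?Z)"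
      by (intro image_eqI[of _ _ "(x, c, z)"]) auto
  qed
  then have "finite ?A" by (rule finite_subset) (intro finite_imageI finite_cartesian_product, auto)
  moreover have "?B \<subseteq> (\<lambda>(x, y, z). GDiff x y Lt z) ` ({..<k} \<times> {..<k} \<times> ?Z)"
  proof clarify
    fix x y z assume "x < k" "y < k" "\<bar>z\<bar> \<le> int m"
    then show "GDiff x y Lt z \<in> (\<lambda>(x, y, z). GDiff x y Lt z) ` ({..<k} \<times> {..<k} \<times> ?Z)"
      by (intro image_eqI[of _ _ "(x, y, z)"]) auto
  qed
  then have "finite ?B" by (rule finite_subset) (intro finite_imageI finite_cartesian_product, auto)
  ultimately have "\<exists>gs. set gs = ?A \<union> ?B" by (intro finite_list) simp
  then show ?thesis unfolding region_atoms_def by (rule someI_ex)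
qed

lemma gsat_region_guard: "gsat (region_guard k m w) w' \<longleftrightarrow> region_eq m k w w'"
proof -
  have *: "gsat (region_guard k m w) w' \<longleftrightarrow> (\<forall>g\<in>set (region_atoms k m). gsat g w \<longleftrightarrow> gsat g w')"
  proof -
    have "gsat (if gsat g w then g else GNot g) w' \<longleftrightarrow> (gsat g w \<longleftrightarrow> gsat g w')" for g by simp
    then show ?thesis unfolding region_guard_def gconj_simps set_map ball_simps by simp
  qed
  show ?thesis
  proof
    assume "gsat (region_guard k m w) w'"
    then have g: "\<And>g. g \<in> set (region_atoms k m) \<Longrightarrow> gsat g w \<longleftrightarrow> gsat g w'" using * by blast
    show "region_eq m k w w'" unfolding region_eq_def
    proof (intro allI impI conjI)
      fix x z assume x: "x < k" and z: "\<bar>z\<bar> \<le> int m"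
      show "w x < of_int z \<longleftrightarrow> w' x < of_int z" "w x \<le> of_int z \<longleftrightarrow> w' x \<le> of_int z"
        using g[of "GAtom x Lt z"] g[of "GAtom x Le z"] x z by (simp_all add: set_region_atoms)
      fix y assume "y < k"
      then show "w x - w y < of_int z \<longleftrightarrow> w' x - w' y < of_int z"
        using g[of "GDiff x y Lt z"] x z by (simp add: set_region_atoms)
    qed
  next
    assume "region_eq m k w w'"
    then show "gsat (region_guard k m w) w'" unfolding * set_region_atoms
      by (intro ballI, intro gsat_region_eq) auto
  qed
qed

lemma region_guard_bounds:
  "x \<in> gclocks (region_guard k m w) \<Longrightarrow> x < k" "z \<in> gconsts (region_guard k m w) \<Longrightarrow> \<bar>z\<bar> \<le> int m"
proof -
  have "gclocks (if gsat g w then g else GNot g) = gclocks g"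
    "gconsts (if gsat g w then g else GNot g) = gconsts g" for g by simp_all
  then have "gclocks (region_guard k m w) = (\<Union>g\<in>set (region_atoms k m). gclocks g)"
    "gconsts (region_guard k m w) = (\<Union>g\<in>set (region_atoms k m). gconsts g)"
    unfolding region_guard_def gconj_simps set_map image_image by simp_all
  then show "x \<in> gclocks (region_guard k m w) \<Longrightarrow> x < k" "z \<in> gconsts (region_guard k m w) \<Longrightarrow> \<bar>z\<bar> \<le> int m"
    unfolding set_region_atoms by auto
qed

text \<open>Such a guard is fixed by one sign per atom. This makes the transitions of the
  constructed automaton finite in number although they are indexed by valuations.\<close>

lemma finite_range_region_guard: "finite (range (region_guard k m))"
proof -
  let ?G = "set (region_atoms k m) \<union> GNot ` set (region_atoms k m)"
  have "range (region_guard k m) \<subseteq> gconj ` {gs. set gs \<subseteq> ?G \<and> length gs = length (region_atoms k m)}"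
    unfolding region_guard_def by (auto intro!: imageI)
  moreover have "finite {gs. set gs \<subseteq> ?G \<and> length gs = length (region_atoms k m)}"
    by (rule finite_lists_length_eq) simp
  ultimately show ?thesis by (meson finite_imageI finite_subset)
qed

text \<open>Each state, letter and region gives one transition. A state is accepting if it is
  reached with a final configuration of \<open>A\<close>, so \<open>lang A\<close> is accepted,
  while an accepted word of \<open>B\<close> would bring final configurations of both automata to
  one state.\<close>

lemma controller_km_separable:
  assumes ctrl: "controller k m Q s0 \<delta>" and sep: "separating n A B s0 \<delta>"
    and wf: "wf_ta Sig A" "wf_ta Sig B" and n: "clock_num A \<le> n" "clock_num B \<le> n"
  shows "km_separable k m Sig A B"
proof -
  let ?reach = "joint_reach n (union_edges A B) (union_init A B) s0 \<delta>"
  note C = controllerD[OF ctrl]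
  from finite_imp_inj_to_nat_seg[OF C(1)] obtain f :: "_ \<Rightarrow> nat" where f: "inj_on f Q" by (elim exE conjE)
  define Acc where "Acc = {s \<in> Q. \<exists>q u. q \<in> set (final A) \<and> ?reach (2 * q) u s}"
  define Tr where "Tr = {(f s, Some a, region_guard k m w, sorted_list_of_set (fst (\<delta> s a w)), f (snd (\<delta> s a w)))
      | s a w. s \<in> Q \<and> a \<in> set Sig \<and> (\<forall>x. 0 \<le> w x)}"
  have "Tr \<subseteq> f ` Q \<times> Some ` set Sig \<times> range (region_guard k m) \<times> sorted_list_of_set ` Pow {..<k} \<times> f ` Q"
  proof
    fix p assume "p \<in> Tr"
    then obtain s a w where s: "s \<in> Q" "a \<in> set Sig" and w: "\<forall>x. 0 \<le> w x"
      and p: "p = (f s, Some a, region_guard k m w, sorted_list_of_set (fst (\<delta> s a w)), f (snd (\<delta> s a w)))"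
      unfolding Tr_def by blast
    have "fst (\<delta> s a w) \<subseteq> {..<k}" "snd (\<delta> s a w) \<in> Q" using C(3,4)[OF s(1), of w a] w by blast+
    then show "p \<in> f ` Q \<times> Some ` set Sig \<times> range (region_guard k m) \<times> sorted_list_of_set ` Pow {..<k} \<times> f ` Q"
      using s p by simp
  qed
  then have "finite Tr"
    by (rule finite_subset) (intro finite_cartesian_product finite_imageI C(1) finite_range_region_guard, auto)
  then obtain tr where tr: "set tr = Tr" using finite_list by blast
  have "finite (f ` Acc)" unfolding Acc_def using C(1) by simp
  from finite_list[OF this] obtain fin where fin: "set fin = f ` Acc" by (elim exE)
  define X where "X = \<lparr>clock_num = k, initial = [f s0], final = fin, trans = tr\<rparr>"
  have Xtr: "(q, b, g, R, q') \<in> set (trans X) \<longleftrightarrow> (\<exists>s a w. s \<in> Q \<and> a \<in> set Sig \<and> (\<forall>x. 0 \<le> w x) \<and> q = f s \<and> b = Some a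
      \<and> g = region_guard k m w \<and> R = sorted_list_of_set (fst (\<delta> s a w)) \<and> q' = f (snd (\<delta> s a w)))" for q b g R q'
    unfolding X_def ta.simps tr Tr_def mem_Collect_eq prod.inject by blast
  have setY: "set (sorted_list_of_set (fst (\<delta> s a w))) = fst (\<delta> s a w)" if "s \<in> Q" "\<forall>x. 0 \<le> w x" for s a w
  proof -
    have "fst (\<delta> s a w) \<subseteq> {..<k}" using C(3)[OF that(1), of w a] that(2) by blast
    then have "finite (fst (\<delta> s a w))" by (rule finite_subset) simp
    then show ?thesis by simp
  qed
  have wfX: "wf_ta Sig X"
  proof -
    have "(\<forall>a. b = Some a \<longrightarrow> a \<in> set Sig) \<and> (\<forall>x\<in>gclocks g. x < clock_num X) \<and> (\<forall>x\<in>set R. x < clock_num X)"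
      if t: "(q, b, g, R, q') \<in> set (trans X)" for q b g R q'
    proof -
      obtain s a w where *: "s \<in> Q" "a \<in> set Sig" "\<forall>x. 0 \<le> w x" "b = Some a"
        "g = region_guard k m w" "R = sorted_list_of_set (fst (\<delta> s a w))" using Xtr t by blast
      have "set R \<subseteq> {..<k}" using setY[OF *(1,3), of a] C(3)[OF *(1), of w a] *(3,6) by simp
      then show ?thesis using *(2,4,5) region_guard_bounds(1)[of _ k m w] by (auto simp: X_def)
    qed
    then show ?thesis unfolding wf_ta_def by blast
  qed
  have detX: "deterministic X"
    unfolding deterministic_def
  proof (intro conjI)
    show "\<forall>(q, b, g, R, q')\<in>set (trans X). b \<noteq> None" using Xtr by fastforce
    show "card (set (initial X)) = 1" by (simp add: X_def)
    have "q1' = q2' \<and> set R1 = set R2" if t: "(q, b, g1, R1, q1') \<in> set (trans X)" "(q, b, g2, R2, q2') \<in> set (trans X)"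
      "gsat g1 v" "gsat g2 v" for q b g1 R1 q1' g2 R2 q2' v
    proof -
      obtain s a w where *: "s \<in> Q" "\<forall>x. 0 \<le> w x" "b = Some a" "q = f s"
        "g1 = region_guard k m w" "R1 = sorted_list_of_set (fst (\<delta> s a w))" "q1' = f (snd (\<delta> s a w))"
        using Xtr[THEN iffD1, OF t(1)] by blast
      obtain s2 w2 where **: "s2 \<in> Q" "\<forall>x. 0 \<le> w2 x" "q = f s2"
        "g2 = region_guard k m w2" "R2 = sorted_list_of_set (fst (\<delta> s2 a w2))" "q2' = f (snd (\<delta> s2 a w2))"
        using Xtr[THEN iffD1, OF t(2)] *(3) by blast
      have "s = s2" using inj_onD[OF f, of s s2] *(1,4) **(1,3) by simp
      \<comment> \<open>Guards that hold at a common point describe the same region, where the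
        controller has a single answer.\<close>
      moreover have "region_eq m k w w2"
        using t(3,4) region_eq_trans[of m k w v w2] region_eq_sym[of m k w2 v]
        unfolding *(5) **(4) gsat_region_guard by blast
      then have "\<delta> s a w2 = \<delta> s a w" using C(5)[OF *(1), of w w2] *(2) **(2) by blast
      ultimately show ?thesis using * ** by simp
    qed
    then show "\<forall>(q1, b1, g1, R1, q1')\<in>set (trans X). \<forall>(q2, b2, g2, R2, q2')\<in>set (trans X).
        q1 = q2 \<and> b1 = b2 \<and> (\<exists>v. (\<forall>x. 0 \<le> v x) \<and> gsat g1 v \<and> gsat g2 v) \<longrightarrow> q1' = q2' \<and> set R1 = set R2"
      by fast
  qed
  have cbX: "consts_bounded m X"
  proof -
    have "\<forall>z\<in>gconsts g. \<bar>z\<bar> \<le> int m" if t: "(q, b, g, R, q') \<in> set (trans X)" for q b g R q'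
    proof -
      obtain w where "g = region_guard k m w" using Xtr[THEN iffD1, OF t] by blast
      then show ?thesis using region_guard_bounds(2) by simp
    qed
    then show ?thesis unfolding consts_bounded_def by fast
  qed
  have init: "?reach l (\<lambda>_. 0) s0" if "l \<in> union_init A B" for l using that by (rule joint_reach.init)
  have "lang A \<subseteq> lang X"
  proof
    fix ws assume "ws \<in> lang A"
    then obtain w q0 where w: "ws = erase w" "q0 \<in> set (initial A)" "accepts_from A q0 (\<lambda>_. 0) 0 w"
      unfolding lang_def by blast
    have q0: "?reach (2 * q0) (\<lambda>_. 0) s0" using w(2) by (intro init) (auto simp: union_init_def)
    obtain qf uf where qf: "qf \<in> set (final A)" "?reach (2 * qf) uf (control_run \<delta> s0 (\<lambda>_. 0) 0 ws)"
      using accepts_joint_reach[where emb = "\<lambda>q. 2 * q", OF w(3) wf(1) n(1) union_edges_A q0] w(1) by auto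
    then have acc: "control_run \<delta> s0 (\<lambda>_. 0) 0 ws \<in> Acc"
      unfolding Acc_def using joint_reach_state[OF qf(2) ctrl] by blast
    have "accepts_from X (f s0) (\<lambda>_. 0) 0 (map (\<lambda>(a, t). (Some a, t)) ws)"
    \<comment> \<open>Nothing is known about \<delta> outside \<open>Q\<close>. There it is replaced
      by idling, so that \<open>Q\<close> cannot be entered from outside.\<close>
    proof (rule control_run_accepts[where Q = Q and \<delta> = "\<lambda>s a v. if s \<in> Q then \<delta> s a v else ({}, s)"])
      show "timed Sig 0 ws" using accepts_from_timed[OF w(3) wf(1)] w(1) by simp
      have eq: "control_run (\<lambda>s a v. if s \<in> Q then \<delta> s a v else ({}, s)) s v t ws = control_run \<delta> s v t ws"
        if "s \<in> Q" "\<And>x. 0 \<le> v x" "timed Sig t ws" for s v t ws using that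
      proof (induction ws arbitrary: s v t)
        case (Cons p ws)
        obtain a t' where p: "p = (a, t')" by force
        have nn: "\<And>x. 0 \<le> v x + (t' - t)" using Cons.prems p by (simp add: add_nonneg_nonneg)
        have "snd (\<delta> s a (\<lambda>x. v x + (t' - t))) \<in> Q" using C(4)[OF Cons.prems(1) nn] .
        then show ?case using Cons.prems p nn Cons.IH by (auto simp: resets_def)
      qed simp
      show "control_run (\<lambda>s a v. if s \<in> Q then \<delta> s a v else ({}, s)) s0 (\<lambda>_. 0) 0 ws \<in> Q"
        "f (control_run (\<lambda>s a v. if s \<in> Q then \<delta> s a v else ({}, s)) s0 (\<lambda>_. 0) 0 ws) \<in> set (final X)"
        using acc eq[OF C(2) _ \<open>timed Sig 0 ws\<close>] by (auto simp: X_def fin Acc_def)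
      fix s a and v :: valuation
      assume s: "s \<in> Q" "a \<in> set Sig" "\<And>x. 0 \<le> v x"
      let ?R = "sorted_list_of_set (fst (\<delta> s a v))"
      have "(f s, Some a, region_guard k m v, ?R, f (snd (\<delta> s a v))) \<in> set (trans X)"
        using Xtr s by blast
      moreover have "gsat (region_guard k m v) v" by (simp add: gsat_region_guard)
      ultimately show "\<exists>g R. (f s, Some a, g, R, f (snd (if s \<in> Q then \<delta> s a v else ({}, s)))) \<in> set (trans X) \<and>
          gsat g v \<and> set R = fst (if s \<in> Q then \<delta> s a v else ({}, s))"
        using s setY[of s v a] by auto
    qed auto
    then show "ws \<in> lang X" unfolding lang_def
      by (auto simp: X_def intro!: exI[of _ "map (\<lambda>(a, t). (Some a, t)) ws"])
  qed
  moreover have "lang X \<inter> lang B = {}"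
  proof (rule ccontr)
    assume "lang X \<inter> lang B \<noteq> {}"
    then obtain w w' q0 where w: "erase w = erase w'" "accepts_from X (f s0) (\<lambda>_. 0) 0 w" "q0 \<in> set (initial B)"
      "accepts_from B q0 (\<lambda>_. 0) 0 w'" unfolding lang_def by (auto simp: X_def)
    have q0: "?reach (2 * q0 + 1) (\<lambda>_. 0) s0" using w(3) by (intro init) (auto simp: union_init_def)
    obtain qf uf where qf: "qf \<in> set (final B)" "?reach (2 * qf + 1) uf (control_run \<delta> s0 (\<lambda>_. 0) 0 (erase w))"
      using accepts_joint_reach[where emb = "\<lambda>q. 2 * q + 1", OF w(4) wf(2) n(2) union_edges_B q0] w(1) by auto
    have "control_run \<delta> s0 (\<lambda>_. 0) 0 (erase w) \<in> Q \<and> f (control_run \<delta> s0 (\<lambda>_. 0) 0 (erase w)) \<in> set (final X)"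
    proof (rule accepts_control_run[where f = f, OF w(2) refl C(2)])
      fix s b g R q' and v :: valuation
      assume s: "s \<in> Q" "(f s, b, g, R, q') \<in> set (trans X)" "\<And>x. 0 \<le> v x" "gsat g v"
      obtain s2 a w2 where *: "s2 \<in> Q" "\<forall>x. 0 \<le> w2 x" "b = Some a" "f s = f s2"
        "g = region_guard k m w2" "R = sorted_list_of_set (fst (\<delta> s2 a w2))" "q' = f (snd (\<delta> s2 a w2))"
        using Xtr[THEN iffD1, OF s(2)] by blast
      have [simp]: "s2 = s" using inj_onD[OF f, of s s2] *(1,4) s(1) by simp
      have "region_eq m k w2 v" using s(4) * by (simp add: gsat_region_guard)
      then have "\<delta> s a v = \<delta> s a w2" using C(5)[OF s(1), of w2 v] *(2) s(3) by blast
      then show "\<exists>a s'. b = Some a \<and> \<delta> s a v = (set R, s') \<and> q' = f s' \<and> s' \<in> Q"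
        using * s setY[of s w2 a] C(4)[OF s(1), of w2 a]
        by (intro exI[of _ a] exI[of _ "snd (\<delta> s a w2)"]) auto
    qed auto
    then obtain s where "control_run \<delta> s0 (\<lambda>_. 0) 0 (erase w) \<in> Q" "s \<in> Acc"
      "f (control_run \<delta> s0 (\<lambda>_. 0) 0 (erase w)) = f s" unfolding X_def using fin by auto
    then have "control_run \<delta> s0 (\<lambda>_. 0) 0 (erase w) \<in> Acc" 
      using inj_onD[OF f, of "control_run \<delta> s0 (\<lambda>_. 0) 0 (erase w)" s] unfolding Acc_def by simp
    then show False using sep qf unfolding Acc_def separating_def by blast
  qed
  ultimately show ?thesis unfolding km_separable_def using wfX detX cbX
    by (intro exI[of _ X]) (auto simp: X_def)
qed

section \<open>Bounding the budgets of a counter game\<close>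

text \<open>Here \<open>e\<close> is a move of the opponent, and \<open>b x\<close> is the number of ticks that clock \<open>x\<close> may still
  make before it has to be reset.\<close>

definition budgeted :: "nat \<Rightarrow> ('v \<Rightarrow> 'e \<Rightarrow> nat set \<Rightarrow> nat set \<Rightarrow> 'v \<Rightarrow> bool) \<Rightarrow> ('v \<times> (nat \<Rightarrow> nat)) set \<Rightarrow> bool" where
  "budgeted k ok W \<longleftrightarrow> (\<forall>v b e. (v, b) \<in> W \<longrightarrow> (\<exists>Y T v' b'. ok v e Y T v' \<and> (v', b') \<in> W \<and>
     (\<forall>x<k. x \<notin> Y \<longrightarrow> b' x \<le> b x \<and> (x \<in> T \<longrightarrow> b' x < b x))))"

abbreviation lex_less :: "(nat list \<times> nat list) set" where "lex_less \<equiv> lex less_than"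

text \<open>Lists of equal length are totally ordered, so the premise says that \<open>xs\<close> is
  at most \<open>ys\<close>, and this passes to prefixes.\<close>

lemma lex_less_take:
  "length xs = length ys \<Longrightarrow> (ys, xs) \<notin> lex_less \<Longrightarrow> take i xs = take i ys \<or> (take i xs, take i ys) \<in> lex_less"
proof (induction xs ys arbitrary: i rule: list_induct2)
  case (Cons x xs y ys)
  show ?case
  proof (cases i)
    case (Suc j)
    have "x \<le> y" using Cons by (auto simp: not_less)
    then show ?thesis using Cons Suc by (cases "x = y") auto
  qed simp
qed simp

lemma lex_less_map:
  assumes "\<And>y. y \<in> set ys \<Longrightarrow> f y \<le> g y"
  shows "map f ys = map g ys \<or> (map f ys, map g ys) \<in> lex_less"
  using assms
proof (induction ys)
  case (Cons y ys)
  have "f y \<le> g y" using Cons.prems[of y] by simp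
  then have "f y = g y \<or> f y < g y" by linarith
  moreover have "map f ys = map g ys \<or> (map f ys, map g ys) \<in> lex_less" using Cons by simp
  ultimately show ?case by auto
qed simp

lemma trans_lex_less: "(xs, ys) \<in> lex_less \<Longrightarrow> (ys, zs) \<in> lex_less \<Longrightarrow> (xs, zs) \<in> lex_less"
  using lex_transI[OF trans_less_than] by (rule transD)

lemma wf_lex_less: "wf lex_less"
  by (rule wf_lex) simp

text \<open>The latest appearance record \<open>\<sigma>\<close> lists the counters by the time since their last reset, the
  oldest first. Answering as from a budget that is lexicographically least along \<open>\<sigma>\<close>, the part of that
  budget up to \<open>x\<close> never increases until a counter in front of \<open>x\<close> is reset, and drops when
  \<open>x\<close> ticks; its rank among the finitely many possible values is the new budget of \<open>x\<close>.\<close>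

lemma budget_bound:
  fixes W :: "('v \<times> (nat \<Rightarrow> nat)) set"
  assumes fin: "finite V" "fst ` W \<subseteq> V" "card V \<le> N" and bud: "budgeted k ok W"
  shows "\<exists>W'. finite W' \<and> fst ` W' = fst ` W \<and> budgeted k ok W' \<and>
     (\<forall>(v, b)\<in>W'. \<forall>x<k. b x < k * (N * k ^ k * k + 1))"
proof -
  define P where "P = {\<sigma>. distinct \<sigma> \<and> set \<sigma> = {..<k}}"
  have Plen: "length \<sigma> = k" if "\<sigma> \<in> P" for \<sigma>
    using that distinct_card[of \<sigma>] unfolding P_def by auto
  have PS: "P \<subseteq> {\<sigma>. set \<sigma> \<subseteq> {..<k} \<and> length \<sigma> = k}"
    using Plen unfolding P_def by auto
  have finL: "finite {\<sigma>. set \<sigma> \<subseteq> {..<k} \<and> length \<sigma> = k}" by (rule finite_lists_length_eq) simp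
  have finP: "finite P" using PS finL by (rule finite_subset)
  \<comment> \<open>Permutations are counted crudely as words of length \<open>k\<close>; this is
    the origin of \<open>k ^ k\<close> in the bound.\<close>
  have cardP: "card P \<le> k ^ k"
    using card_mono[OF finL PS] card_lists_length_eq[of "{..<k}" k] by simp
  define V0 where "V0 = fst ` W"
  have finV0: "finite V0" and cV0: "card V0 \<le> N"
    using fin card_mono[OF fin(1,2)] finite_subset[OF fin(2,1)] unfolding V0_def by auto
  \<comment> \<open>A vertex may carry infinitely many budgets, but the order along \<sigma> is well
    founded, so a least one exists.\<close>
  have "\<exists>b. (v, b) \<in> W \<and> (\<forall>b'. (v, b') \<in> W \<longrightarrow> (map b' \<sigma>, map b \<sigma>) \<notin> lex_less)" if v: "v \<in> V0" for v \<sigma>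
  proof -
    let ?B = "{b. (v, b) \<in> W}"
    obtain b0 where b0: "b0 \<in> ?B" using v unfolding V0_def by auto
    obtain b where "b \<in> ?B" "\<And>b'. (b', b) \<in> inv_image lex_less (\<lambda>b. map b \<sigma>) \<Longrightarrow> b' \<notin> ?B"
      using wfE_min[OF wf_inv_image[OF wf_lex_less, of "\<lambda>b. map b \<sigma>"] b0] by blast
    then show ?thesis by (auto simp: in_inv_image)
  qed
  then obtain \<beta> where \<beta>: "\<And>v \<sigma>. v \<in> V0 \<Longrightarrow> (v, \<beta> v \<sigma>) \<in> W"
    "\<And>v \<sigma> b. v \<in> V0 \<Longrightarrow> (v, b) \<in> W \<Longrightarrow> (map b \<sigma>, map (\<beta> v \<sigma>) \<sigma>) \<notin> lex_less" by metis
  define pre where "pre \<sigma> x = takeWhile (\<lambda>y. y \<noteq> x) \<sigma>" for \<sigma> and x :: nat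
  have preI: "pre (ys @ x # zs) x = ys" if "x \<notin> set ys" for x ys zs
  proof -
    have "\<And>y. y \<in> set ys \<Longrightarrow> y \<noteq> x" using that by blast
    then show ?thesis unfolding pre_def by simp
  qed
  define key where "key v \<sigma> x = map (\<beta> v \<sigma>) (pre \<sigma> x @ [x])" for v \<sigma> x
  define Keys where "Keys = (\<lambda>(v, \<sigma>, x). key v \<sigma> x) ` (V0 \<times> P \<times> {..<k})"
  have finKeys: "finite Keys" unfolding Keys_def using finV0 finP by simp
  have "card Keys \<le> card (V0 \<times> P \<times> {..<k})"
    unfolding Keys_def by (rule card_image_le) (use finV0 finP in simp)
  also have "\<dots> = card V0 * (card P * k)" by (simp add: card_cartesian_product)
  also have "\<dots> \<le> N * (k ^ k * k)" using cV0 cardP by (intro mult_le_mono) auto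
  finally have cK: "card Keys \<le> N * k ^ k * k" by (simp add: mult.assoc)
  define K where "K = N * k ^ k * k"
  define rk where "rk l = card {l' \<in> Keys. (l', l) \<in> lex_less}" for l
  have rkK: "rk l \<le> K" for l
    unfolding rk_def K_def using card_mono[OF finKeys, of "{l' \<in> Keys. (l', l) \<in> lex_less}"] cK by auto
  have rk_mono: "rk l \<le> rk l'" if "l = l' \<or> (l, l') \<in> lex_less" for l l'
    unfolding rk_def using that trans_lex_less[of _ l l'] finKeys by (intro card_mono) auto
  have rk_less: "rk l < rk l'" if "(l, l') \<in> lex_less" "l \<in> Keys" for l l'
  proof -
    have "(l, l) \<notin> lex_less" using wf_lex_less by (simp add: wf_not_refl)
    then have "{x \<in> Keys. (x, l) \<in> lex_less} \<subset> {x \<in> Keys. (x, l') \<in> lex_less}"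
      using that trans_lex_less[of _ l l'] by blast
    then show ?thesis unfolding rk_def using finKeys by (intro psubset_card_mono) auto
  qed
  \<comment> \<open>The number of counters in front of \<open>x\<close> is the leading digit and the
    rank, at most \<open>K\<close>, the lower one in base \<open>K + 1\<close>. A reset in front of
    \<open>x\<close> lowers the leading digit and thereby pays for any change of the rank.\<close>
  define r where "r v \<sigma> x = (if x < k then length (pre \<sigma> x) * (K + 1) + rk (key v \<sigma> x) else 0)" for v \<sigma> x
  define W' where "W' = (\<lambda>(v, \<sigma>). (v, r v \<sigma>)) ` (V0 \<times> P)"
  have "[0..<k] \<in> P" unfolding P_def by auto
  then have "fst ` W' = fst ` W" unfolding W'_def V0_def[symmetric] by force
  moreover have "finite W'" unfolding W'_def using finV0 finP by simp
  moreover have "b x < k * (K + 1)" if vb: "(v, b) \<in> W'" "x < k" for v b x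
  proof -
    obtain \<sigma> where \<sigma>: "\<sigma> \<in> P" "b = r v \<sigma>" using vb unfolding W'_def by auto
    have "x \<in> set \<sigma>" using \<sigma>(1) vb(2) unfolding P_def by auto
    from split_list_first[OF this] have "length (pre \<sigma> x) < length \<sigma>" using preI by force
    then have "Suc (length (pre \<sigma> x)) \<le> k" using Plen[OF \<sigma>(1)] by simp
    then have "Suc (length (pre \<sigma> x)) * (K + 1) \<le> k * (K + 1)" by (rule mult_le_mono1)
    then show ?thesis using \<sigma>(2) vb(2) rkK[of "key v \<sigma> x"] unfolding r_def by simp
  qed
  moreover have "budgeted k ok W'"
    unfolding budgeted_def
  proof (intro allI impI)
    fix v b0 e assume "(v, b0) \<in> W'"
    then obtain \<sigma> where v: "v \<in> V0" and \<sigma>: "\<sigma> \<in> P" and b0: "b0 = r v \<sigma>" unfolding W'_def by auto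
    define b where "b = \<beta> v \<sigma>"
    obtain Y T v' b' where step: "ok v e Y T v'" "(v', b') \<in> W"
      "\<And>x. x < k \<Longrightarrow> x \<notin> Y \<Longrightarrow> b' x \<le> b x \<and> (x \<in> T \<longrightarrow> b' x < b x)"
      using bud[unfolded budgeted_def, rule_format, OF \<beta>(1)[OF v, of \<sigma>], of e] unfolding b_def by blast
    have v': "v' \<in> V0" using step(2) unfolding V0_def by force
    define \<sigma>' where "\<sigma>' = filter (\<lambda>y. y \<notin> Y) \<sigma> @ filter (\<lambda>y. y \<in> Y) \<sigma>"
    have \<sigma>': "\<sigma>' \<in> P" using \<sigma> unfolding \<sigma>'_def P_def by auto
    have "r v' \<sigma>' x \<le> r v \<sigma> x \<and> (x \<in> T \<longrightarrow> r v' \<sigma>' x < r v \<sigma> x)" if x: "x < k" "x \<notin> Y" for x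
    proof -
      define p where "p = pre \<sigma> x"
      have "x \<in> set \<sigma>" using \<sigma> x unfolding P_def by auto
      from split_list_first[OF this] obtain ys q where yq: "\<sigma> = ys @ x # q" "x \<notin> set ys" by blast
      have "p = ys" unfolding p_def yq(1) by (rule preI[OF yq(2)])
      then have q: "\<sigma> = p @ x # q" "x \<notin> set p" using yq by auto
      define p' where "p' = filter (\<lambda>y. y \<notin> Y) p"
      have \<sigma>'_eq: "\<sigma>' = p' @ x # (filter (\<lambda>y. y \<notin> Y) q @ filter (\<lambda>y. y \<in> Y) \<sigma>)"
        unfolding \<sigma>'_def p'_def using q(1) x(2) by simp
      have pre': "pre \<sigma>' x = p'"
        unfolding \<sigma>'_eq by (rule preI) (use q(2) in \<open>simp add: p'_def\<close>)
      show ?thesis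
      proof (cases "p' = p")
        case False
        then have "length p' < length p" unfolding p'_def
          by (metis filter_True length_filter_less)
        then have "Suc (length p') * (K + 1) \<le> length p * (K + 1)" by (intro mult_le_mono1) simp
        then have "r v' \<sigma>' x < r v \<sigma> x"
          unfolding r_def using x(1) pre' p_def rkK[of "key v' \<sigma>' x"] by simp
        then show ?thesis by simp
      next
        case True
        \<comment> \<open>Nothing in front of \<open>x\<close> was reset, so on this prefix
          \<open>b'\<close> is at most \<open>b\<close> pointwise, and the least budget at the new
          vertex is at most \<open>b'\<close> by its choice. If \<open>x\<close> ticks, the last
          entry drops and the comparison is strict.\<close>
        let ?px = "p @ [x]"
        have nY: "y \<notin> Y" "y < k" if "y \<in> set ?px" for y
        proof -
          show "y \<notin> Y" using that True x(2) unfolding p'_def by (auto simp: filter_id_conv)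
          show "y < k" using that q(1) \<sigma> unfolding P_def by auto
        qed
        have k1: "key v \<sigma> x = map b ?px" unfolding key_def b_def p_def ..
        have k2: "key v' \<sigma>' x = map (\<beta> v' \<sigma>') ?px" unfolding key_def pre' True ..
        have "\<sigma>' = ?px @ (filter (\<lambda>y. y \<notin> Y) q @ filter (\<lambda>y. y \<in> Y) \<sigma>)"
          using \<sigma>'_eq True by simp
        then have tk: "take (length ?px) (map f \<sigma>') = map f ?px" for f :: "nat \<Rightarrow> nat" by simp
        have "map (\<beta> v' \<sigma>') ?px = map b' ?px \<or> (map (\<beta> v' \<sigma>') ?px, map b' ?px) \<in> lex_less"
          using lex_less_take[of "map (\<beta> v' \<sigma>') \<sigma>'" "map b' \<sigma>'" "length ?px"] \<beta>(2)[OF v' step(2)]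
          unfolding tk by simp
        moreover have "map b' ?px = map b ?px \<or> (map b' ?px, map b ?px) \<in> lex_less"
          by (rule lex_less_map) (use step(3) nY in blast)
        moreover have "(map b' ?px, map b ?px) \<in> lex_less" if "x \<in> T"
          using calculation(2) step(3)[OF x] that by auto
        ultimately have le: "key v' \<sigma>' x = key v \<sigma> x \<or> (key v' \<sigma>' x, key v \<sigma> x) \<in> lex_less"
          and lt: "x \<in> T \<Longrightarrow> (key v' \<sigma>' x, key v \<sigma> x) \<in> lex_less"
          unfolding k1 k2 using trans_lex_less by metis+
        have "key v' \<sigma>' x \<in> Keys" unfolding Keys_def using v' \<sigma>' x(1) by force
        then have "rk (key v' \<sigma>' x) \<le> rk (key v \<sigma> x)" "x \<in> T \<Longrightarrow> rk (key v' \<sigma>' x) < rk (key v \<sigma> x)"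
          using rk_mono[OF le] rk_less[OF lt] by auto
        then show ?thesis unfolding r_def using x(1) pre' p_def True by auto
      qed
    qed
    moreover have "(v', r v' \<sigma>') \<in> W'" unfolding W'_def using v' \<sigma>' by force
    ultimately show "\<exists>Y T v' b'. ok v e Y T v' \<and> (v', b') \<in> W' \<and>
        (\<forall>x<k. x \<notin> Y \<longrightarrow> b' x \<le> b0 x \<and> (x \<in> T \<longrightarrow> b' x < b0 x))"
      using step(1) unfolding b0 by blast
  qed
  ultimately show ?thesis unfolding K_def by (intro exI[of _ W']) auto
qed

section \<open>The tick game\<close>

text \<open>A region as the finite set of its true atoms, where \<open>c\<close> is 0 for
  \<open><\<close>, 1 for \<open>\<le>\<close> and 2 for a difference. Equality replaces
  equivalence, and vertices become finite objects that can be counted.\<close>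

definition region_class :: "nat \<Rightarrow> nat \<Rightarrow> valuation \<Rightarrow> (nat \<times> nat \<times> nat \<times> int) set" where
  "region_class M L u = {(c, i, j, z). c < 3 \<and> i < L \<and> j < L \<and> \<bar>z\<bar> \<le> int M \<and>
     (c = 0 \<and> u i < of_int z \<or> c = 1 \<and> u i \<le> of_int z \<or> c = 2 \<and> u i - u j < of_int z)}"

lemma region_class_eq_iff: "region_class M L u = region_class M L u' \<longleftrightarrow> region_eq M L u u'"
proof
  assume eq: "region_class M L u = region_class M L u'"
  have mem: "p \<in> region_class M L u \<longleftrightarrow> p \<in> region_class M L u'" for p using eq by simp
  show "region_eq M L u u'" unfolding region_eq_def
  proof (intro allI impI conjI)
    fix i z assume "i < L" "\<bar>z\<bar> \<le> int M"
    then show "u i < of_int z \<longleftrightarrow> u' i < of_int z" "u i \<le> of_int z \<longleftrightarrow> u' i \<le> of_int z"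
      using mem[of "(0, i, i, z)"] mem[of "(1, i, i, z)"] by (simp_all add: region_class_def)
    fix j assume "j < L"
    then show "u i - u j < of_int z \<longleftrightarrow> u' i - u' j < of_int z"
      using \<open>i < L\<close> \<open>\<bar>z\<bar> \<le> int M\<close> mem[of "(2, i, j, z)"] by (simp add: region_class_def)
  qed
next
  assume eq: "region_eq M L u u'"
  show "region_class M L u = region_class M L u'"
    unfolding region_class_def using region_eqD(1,2,3)[OF eq] by (intro Collect_cong) auto
qed

definition atom_space :: "nat \<Rightarrow> nat \<Rightarrow> (nat \<times> nat \<times> nat \<times> int) set" where
  "atom_space M L = {..<3} \<times> {..<L} \<times> {..<L} \<times> {- int M..int M}"

lemma region_class_subset: "region_class M L u \<subseteq> atom_space M L"
  unfolding region_class_def atom_space_def by auto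

lemma card_atom_space: "finite (atom_space M L)" "card (atom_space M L) = 3 * (L * (L * (2 * M + 1)))"
  unfolding atom_space_def by (auto simp: card_cartesian_product nat_add_distrib nat_mult_distrib)

text \<open>\<open>region_eq\<close> with constant 1 on a set of clocks. Events of the game are
  announced at this granularity, which is independent of \<open>m\<close>.\<close>

definition tracked_eq :: "nat set \<Rightarrow> valuation \<Rightarrow> valuation \<Rightarrow> bool" where
  "tracked_eq X w w' \<longleftrightarrow> (\<forall>x\<in>X. \<forall>z::int. \<bar>z\<bar> \<le> 1 \<longrightarrow>
     (w x < of_int z \<longleftrightarrow> w' x < of_int z) \<and> (w x \<le> of_int z \<longleftrightarrow> w' x \<le> of_int z) \<and>
     (\<forall>y\<in>X. w x - w y < of_int z \<longleftrightarrow> w' x - w' y < of_int z))"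

lemma tracked_eq_refl [simp]: "tracked_eq X w w"
  by (simp add: tracked_eq_def)

lemma tracked_eq_sym: "tracked_eq X w w' \<Longrightarrow> tracked_eq X w' w"
  by (simp add: tracked_eq_def)

lemma tracked_eq_trans: "tracked_eq X u v \<Longrightarrow> tracked_eq X v w \<Longrightarrow> tracked_eq X u w"
  by (simp add: tracked_eq_def)

lemma tracked_eqD:
  assumes "tracked_eq X w w'" "x \<in> X"
  shows "w x \<le> 0 \<longleftrightarrow> w' x \<le> 0" "w x < 1 \<longleftrightarrow> w' x < 1" "w x \<le> 1 \<longleftrightarrow> w' x \<le> 1" "w x = 1 \<longleftrightarrow> w' x = 1"
proof -
  have *: "(w x < of_int z \<longleftrightarrow> w' x < of_int z) \<and> (w x \<le> of_int z \<longleftrightarrow> w' x \<le> of_int z)" if "\<bar>z\<bar> \<le> 1" for z :: int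
    using assms that unfolding tracked_eq_def by blast
  show "w x \<le> 0 \<longleftrightarrow> w' x \<le> 0" "w x < 1 \<longleftrightarrow> w' x < 1" "w x \<le> 1 \<longleftrightarrow> w' x \<le> 1"
    using *[of 0] *[of 1] by simp_all
  then show "w x = 1 \<longleftrightarrow> w' x = 1" by linarith
qed

lemma region_eq_tracked_eq:
  assumes "region_eq M (n + k) u u'" "1 \<le> M" "X \<subseteq> {..<k}"
  shows "tracked_eq X (\<lambda>x. u (n + x)) (\<lambda>x. u' (n + x))"
  unfolding tracked_eq_def
proof (intro ballI allI impI conjI)
  fix x z assume x: "x \<in> X" and z: "\<bar>z\<bar> \<le> (1::int)"
  have z': "\<bar>z\<bar> \<le> int M" and xk: "n + x < n + k" using z assms(2,3) x by auto
  show "u (n + x) < of_int z \<longleftrightarrow> u' (n + x) < of_int z" "u (n + x) \<le> of_int z \<longleftrightarrow> u' (n + x) \<le> of_int z"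
    using region_eqD(1,2)[OF assms(1) xk z'] by auto
  fix y assume "y \<in> X"
  then have "n + y < n + k" using assms(3) by auto
  then show "u (n + x) - u (n + y) < of_int z \<longleftrightarrow> u' (n + x) - u' (n + y) < of_int z"
    using region_eqD(3)[OF assms(1) xk z'] by blast
qed

lemma plus_mem_image_iff [simp]: "(n::nat) + x \<in> (+) n ` A \<longleftrightarrow> x \<in> A"
  by auto

text \<open>The true value of controller clock \<open>x\<close> is \<open>u (n + x) + c x\<close>
  throughout. Time cannot carry a counted clock past 1, a tick sets it back to 0, and letters
  require it below 1, so a tick at 1 has to come before the letter. A tick at
  \<open>m \<le> c x\<close> ends the counting: from then on the clock exceeds \<open>m\<close>
  until it is reset, and \<open>u (n + x)\<close> grows freely.\<close>

inductive tick_reach ::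
  "nat \<Rightarrow> nat \<Rightarrow> nat \<Rightarrow> 'l edge set \<Rightarrow> 'l set \<Rightarrow> 'q \<Rightarrow> 'q strategy \<Rightarrow>
   'l \<Rightarrow> valuation \<Rightarrow> 'q \<Rightarrow> nat set \<Rightarrow> (nat \<Rightarrow> nat) \<Rightarrow> bool"
  for n k m T I s0 \<delta> where
  init: "l \<in> I \<Longrightarrow> tick_reach n k m T I s0 \<delta> l (\<lambda>_. 0) s0 {..<k} (\<lambda>_. 0)"
| delay: "tick_reach n k m T I s0 \<delta> l u s Tr c \<Longrightarrow> 0 \<le> d \<Longrightarrow> \<forall>x\<in>Tr. u (n + x) + d \<le> 1
    \<Longrightarrow> tick_reach n k m T I s0 \<delta> l (\<lambda>i. u i + d) s Tr c"
| eps: "tick_reach n k m T I s0 \<delta> l u s Tr c \<Longrightarrow> (l, None, g, R, l') \<in> T \<Longrightarrow> gsat g u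
    \<Longrightarrow> tick_reach n k m T I s0 \<delta> l' (resets (set R) u) s Tr c"
| tick: "tick_reach n k m T I s0 \<delta> l u s Tr c \<Longrightarrow> \<forall>x\<in>Tr. u (n + x) \<le> 1 \<Longrightarrow> Tk = {x \<in> Tr. u (n + x) = 1}
    \<Longrightarrow> tick_reach n k m T I s0 \<delta> l (resets ((+) n ` Tk) u) s (Tr - {x \<in> Tk. m \<le> c x})
          (\<lambda>x. if x \<in> Tk then c x + 1 else c x)"
| letter: "tick_reach n k m T I s0 \<delta> l u s Tr c \<Longrightarrow> \<forall>x\<in>Tr. u (n + x) < 1 \<Longrightarrow> (l, Some a, g, R, l') \<in> T
    \<Longrightarrow> gsat g u \<Longrightarrow> \<delta> s a (\<lambda>x. u (n + x) + real (c x)) = (Y, s')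
    \<Longrightarrow> tick_reach n k m T I s0 \<delta> l' (resets (set R \<union> (+) n ` Y) u) s' (Tr \<union> Y) (\<lambda>x. if x \<in> Y then 0 else c x)"

text \<open>A vertex \<open>(Tr, D, \<beta>)\<close> consists of the clocks whose integer part is still counted, the possible
  configurations with counted clocks taken modulo 1, and the verdict on the word read so far. An event
  \<open>(None, w)\<close> announces that some counted clocks reach 1, an event \<open>(Some a, w)\<close> a letter; \<open>w\<close> stands for the
  region of the counted clocks at that moment.\<close>

type_synonym 'l vertex = "nat set \<times> ('l \<times> (nat \<times> nat \<times> nat \<times> int) set) set \<times> bool"

locale tick_game =
  fixes n k M :: nat and T :: "'l edge set" and I FA FB Loc :: "'l set"
  assumes M1: "1 \<le> M"
    and edge: "(l, b, g, R, l') \<in> T \<Longrightarrow>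
      (\<forall>x\<in>gclocks g. x < n) \<and> (\<forall>z\<in>gconsts g. \<bar>z\<bar> \<le> int M) \<and> (\<forall>x\<in>set R. x < n) \<and> l' \<in> Loc"
    and ILoc: "I \<subseteq> Loc"
begin

abbreviation rc :: "valuation \<Rightarrow> (nat \<times> nat \<times> nat \<times> int) set" where
  "rc \<equiv> region_class M (n + k)"

fun good :: "'l vertex \<Rightarrow> bool" where
  "good (Tr, D, \<beta>) \<longleftrightarrow> Tr \<subseteq> {..<k} \<and>
     (\<forall>l u d. (l, rc u) \<in> D \<and> (\<forall>i. 0 \<le> u i) \<and> 0 \<le> d \<and> (\<forall>x\<in>Tr. u (n + x) + d \<le> 1)
        \<longrightarrow> (l, rc (\<lambda>i. u i + d)) \<in> D) \<and>
     (\<forall>l u g R l'. (l, rc u) \<in> D \<and> (\<forall>i. 0 \<le> u i) \<and> (l, None, g, R, l') \<in> T \<and> gsat g u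
        \<longrightarrow> (l', rc (resets (set R) u)) \<in> D) \<and>
     (\<forall>l \<alpha>. (l, \<alpha>) \<in> D \<longrightarrow> l \<notin> (if \<beta> then FB else FA))"

text \<open>An impossible event leaves the answer unconstrained. At a tick, \<open>Y\<close>
  consists of the clocks whose counting is given up; in the budget game this acts as a reset, so
  nothing is asked of their budgets at that moment. At a letter, \<open>Y\<close> is the actual
  reset and its clocks are counted again. One answer has to serve all configurations that match
  \<open>w\<close>.\<close>

fun ok :: "'l vertex \<Rightarrow> nat option \<times> valuation \<Rightarrow> nat set \<Rightarrow> nat set \<Rightarrow> 'l vertex \<Rightarrow> bool" where
  "ok (Tr, D, \<beta>) (None, w) Y Tk (Tr', D', \<beta>') \<longleftrightarrow> ((\<forall>x\<in>Tr. w x \<le> 1) \<longrightarrow>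
     Tk = {x \<in> Tr. w x = 1} \<and> Y \<subseteq> Tk \<and> Tr' = Tr - Y \<and> \<beta>' = \<beta> \<and>
     (\<forall>l u. (l, rc u) \<in> D \<and> (\<forall>i. 0 \<le> u i) \<and> tracked_eq Tr (\<lambda>x. u (n + x)) w
        \<longrightarrow> (l, rc (resets ((+) n ` Tk) u)) \<in> D'))"
| "ok (Tr, D, \<beta>) (Some a, w) Y Tk (Tr', D', \<beta>') \<longleftrightarrow> ((\<forall>x\<in>Tr. w x < 1) \<longrightarrow>
     Y \<subseteq> {..<k} \<and> Tr' = Tr \<union> Y \<and>
     (\<forall>l u g R l'. (l, rc u) \<in> D \<and> (\<forall>i. 0 \<le> u i) \<and> tracked_eq Tr (\<lambda>x. u (n + x)) w \<and>
        (l, Some a, g, R, l') \<in> T \<and> gsat g u \<longrightarrow> (l', rc (resets (set R \<union> (+) n ` Y) u)) \<in> D'))"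

lemma gsat_rc: "(l, b, g, R, l') \<in> T \<Longrightarrow> region_eq M (n + k) u u' \<Longrightarrow> gsat g u \<longleftrightarrow> gsat g u'"
  using edge by (intro gsat_region_eq) fastforce+

definition vertices :: "'l vertex set" where
  "vertices = Pow {..<k} \<times> Pow (Loc \<times> Pow (atom_space M (n + k))) \<times> UNIV"

text \<open>A vertex collects the configurations that agree in all that the controller can know: its
  state, the counted clocks, the counts and the differences \<Delta> of its clocks. The budget of a
  counted clock is \<open>m - c x\<close>, the number of ticks left before it is given up at the
  next one.\<close>

lemma controller_budgeted:
  assumes ctrl: "controller k m Q s0 \<delta>"
    and sep: "\<forall>s l u l' u'. l \<in> FA \<longrightarrow> l' \<in> FB \<longrightarrow> joint_reach n T I s0 \<delta> l u s \<longrightarrow> \<not> joint_reach n T I s0 \<delta> l' u' s"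
  shows "\<exists>W D0 \<beta>0 b0. budgeted k ok W \<and> fst ` W \<subseteq> vertices \<and> (\<forall>v\<in>fst ` W. good v) \<and>
    (({..<k}, D0, \<beta>0), b0) \<in> W \<and> (\<forall>l\<in>I. (l, rc (\<lambda>_. 0)) \<in> D0)"
proof -
  let ?TR = "tick_reach n k m T I s0 \<delta>" and ?JR = "joint_reach n T I s0 \<delta>"
  note C = controllerD[OF ctrl]
  \<comment> \<open>The essential part is \<open>m < c x\<close> for a clock no longer counted:
    guards comparing it with a constant up to \<open>m\<close> cannot tell its values apart.\<close>
  have inv: "s \<in> Q \<and> Tr \<subseteq> {..<k} \<and> (\<forall>i. 0 \<le> u i) \<and> (\<forall>x<k. x \<notin> Tr \<longrightarrow> m < c x) \<and> l \<in> Loc"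
    if "?TR l u s Tr c" for l u s Tr c
    using that
  proof induction
    case (init l)
    then show ?case using C(2) ILoc by auto
  next
    case (eps l u s Tr c g R l')
    then show ?case using edge by (auto simp: resets_def)
  next
    case (tick l u s Tr c Tk)
    then show ?case by (auto simp: resets_def)
  next
    case (letter l u s Tr c a g R l' Y s')
    let ?w = "\<lambda>x. u (n + x) + real (c x)"
    have s: "s \<in> Q" and w: "\<And>x. 0 \<le> ?w x" using letter.IH by auto
    have "Y \<subseteq> {..<k}" "s' \<in> Q" using C(3)[of s ?w a, OF s w] C(4)[of s ?w a, OF s w] letter.hyps(5) by auto
    then show ?case using letter.IH edge[OF letter.hyps(3)] by (auto simp: resets_def)
  qed auto
  \<comment> \<open>Adding the counts back gives an ordinary joint run, in which a tick is no step
    at all.\<close>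
  have TRJR: "?JR l (\<lambda>i. u i + (if n \<le> i then real (c (i - n)) else 0)) s" if "?TR l u s Tr c" for l u s Tr c
    using that
  proof induction
    case (init l)
    have "(\<lambda>i. 0 + (if n \<le> i then real 0 else 0)) = (\<lambda>_. 0 :: real)" by auto
    then show ?case using joint_reach.init[OF init, of n T s0 \<delta>] by (simp only:)
  next
    case (delay l u s Tr c d)
    from joint_reach.delay[OF delay.IH delay.hyps(2)] show ?case by (simp only: ac_simps)
  next
    case (eps l u s Tr c g R l')
    let ?u = "\<lambda>i. u i + (if n \<le> i then real (c (i - n)) else 0)"
    have e: "\<forall>x\<in>gclocks g. x < n" "\<forall>x\<in>set R. x < n" using edge[OF eps.hyps(2)] by auto
    have "gsat g u \<longleftrightarrow> gsat g ?u" by (rule gsat_cong) (use e(1) in fastforce)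
    then have "gsat g ?u" using eps.hyps(3) by simp
    from joint_reach.eps[OF eps.IH eps.hyps(2) this]
    have "?JR l' (resets (set R) ?u) s" .
    moreover have "resets (set R) ?u = (\<lambda>i. resets (set R) u i + (if n \<le> i then real (c (i - n)) else 0))"
      using e(2) by (fastforce simp: resets_def)
    ultimately show ?case by simp
  next
    case (tick l u s Tr c Tk)
    have "(\<lambda>i. resets ((+) n ` Tk) u i + (if n \<le> i then real (if i - n \<in> Tk then c (i - n) + 1 else c (i - n)) else 0))
        = (\<lambda>i. u i + (if n \<le> i then real (c (i - n)) else 0))"
    proof
      fix i
      show "resets ((+) n ` Tk) u i + (if n \<le> i then real (if i - n \<in> Tk then c (i - n) + 1 else c (i - n)) else 0)
        = u i + (if n \<le> i then real (c (i - n)) else 0)"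
      proof (cases "n \<le> i")
        case True
        then have "i \<in> (+) n ` Tk \<longleftrightarrow> i - n \<in> Tk" by (auto simp: image_iff) (metis le_add_diff_inverse)
        then show ?thesis using True tick.hyps(3) by (auto simp: resets_def)
      next
        case False
        then have "i \<notin> (+) n ` Tk" by auto
        then show ?thesis using False by (simp add: resets_def)
      qed
    qed
    then show ?case using tick.IH by simp
  next
    case (letter l u s Tr c a g R l' Y s')
    let ?u = "\<lambda>i. u i + (if n \<le> i then real (c (i - n)) else 0)"
    have e: "\<forall>x\<in>gclocks g. x < n" "\<forall>x\<in>set R. x < n" using edge[OF letter.hyps(3)] by auto
    have "gsat g u \<longleftrightarrow> gsat g ?u" by (rule gsat_cong) (use e(1) in fastforce)
    then have "gsat g ?u" using letter.hyps(4) by simp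
    moreover have "\<delta> s a (\<lambda>x. ?u (n + x)) = (Y, s')" using letter.hyps(5) by simp
    ultimately have "?JR l' (resets (set R \<union> (+) n ` Y) ?u) s'"
      by (rule joint_reach.letter[OF letter.IH letter.hyps(3)])
    moreover have "resets (set R \<union> (+) n ` Y) ?u = (\<lambda>i. resets (set R \<union> (+) n ` Y) u i
        + (if n \<le> i then real (if i - n \<in> Y then 0 else c (i - n)) else 0))"
    proof
      fix i
      show "resets (set R \<union> (+) n ` Y) ?u i = resets (set R \<union> (+) n ` Y) u i
        + (if n \<le> i then real (if i - n \<in> Y then 0 else c (i - n)) else 0)"
      proof (cases "n \<le> i")
        case True
        then have "i \<in> (+) n ` Y \<longleftrightarrow> i - n \<in> Y" by (auto simp: image_iff) (metis le_add_diff_inverse)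
        then show ?thesis using True e(2) by (fastforce simp: resets_def)
      next
        case False
        then show ?thesis by (simp add: resets_def)
      qed
    qed
    ultimately show ?case by simp
  qed
  \<comment> \<open>Diagonal guards still see an uncounted clock through its differences with the
    others. These are recorded as \<Delta>, which changes at letters only.\<close>
  define diffs where "diffs w = {(x, y, z). x < k \<and> y < k \<and> \<bar>z\<bar> \<le> int m \<and> w x - w y < real_of_int z}" for w :: valuation
  define wv where "wv u c = (\<lambda>x. u (n + x) + real (c x))" for u :: valuation and c :: "nat \<Rightarrow> nat"
  define Ds where "Ds s Tr c \<Delta> = {(l, rc u) | l u. ?TR l u s Tr c \<and> diffs (wv u c) = \<Delta>}" for s Tr c \<Delta>
  define bet where "bet s \<longleftrightarrow> (\<exists>l\<in>FA. \<exists>u. ?JR l u s)" for s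
  \<comment> \<open>\<open>Tr\<close>, \<open>c\<close> and \<Delta> need not be reachable together
    with \<open>s\<close>: for an impossible combination \<open>Ds\<close> is empty and nothing has
    to be shown about configurations.\<close>
  define W where "W = {((Tr, Ds s Tr c \<Delta>, bet s), \<lambda>x. if x \<in> Tr then m - c x else 0) | s Tr c \<Delta>. Tr \<subseteq> {..<k}}"
  have WI: "((Tr, Ds s Tr c \<Delta>, bet s), \<lambda>x. if x \<in> Tr then m - c x else 0) \<in> W" if "Tr \<subseteq> {..<k}" for s Tr c \<Delta>
    using that unfolding W_def by blast
  have DsD: "\<exists>u0. ?TR l u0 s Tr c \<and> diffs (wv u0 c) = \<Delta> \<and> region_eq M (n + k) u0 u" if "(l, rc u) \<in> Ds s Tr c \<Delta>" for l u s Tr c \<Delta>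
    using that unfolding Ds_def by (auto simp: region_class_eq_iff intro: region_eq_sym)
  have DsI: "(l, rc u) \<in> Ds s Tr c \<Delta>" if "?TR l u0 s Tr c" "diffs (wv u0 c) = \<Delta>" "region_eq M (n + k) u0 u" for l u u0 s Tr c \<Delta>
    using that unfolding Ds_def region_class_eq_iff[symmetric] by auto
  have diffs_delay: "diffs (wv (\<lambda>i. u i + d) c) = diffs (wv u c)" for u d c
    unfolding diffs_def wv_def by (simp add: algebra_simps)
  have good: "good (Tr, Ds s Tr c \<Delta>, bet s)" if Tr: "Tr \<subseteq> {..<k}" for s Tr c \<Delta>
    unfolding good.simps
  proof (intro conjI allI impI)
    fix l u d assume a: "(l, rc u) \<in> Ds s Tr c \<Delta> \<and> (\<forall>i. 0 \<le> u i) \<and> 0 \<le> d \<and> (\<forall>x\<in>Tr. u (n + x) + d \<le> 1)"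
    then obtain u0 where u0: "?TR l u0 s Tr c" "diffs (wv u0 c) = \<Delta>" "region_eq M (n + k) u u0"
      using DsD region_eq_sym by blast
    obtain d' where d': "0 \<le> d'" "region_eq M (n + k) (\<lambda>i. u i + d) (\<lambda>i. u0 i + d')"
      using region_eq_delay[OF u0(3), of d] a inv[OF u0(1)] by blast
    have "\<forall>x\<in>Tr. u0 (n + x) + d' \<le> 1"
      using tracked_eqD(3)[OF region_eq_tracked_eq[OF d'(2) M1 Tr]] a by auto
    then have "?TR l (\<lambda>i. u0 i + d') s Tr c" by (rule tick_reach.delay[OF u0(1) d'(1)])
    then show "(l, rc (\<lambda>i. u i + d)) \<in> Ds s Tr c \<Delta>"
      by (rule DsI) (use u0(2) d'(2) diffs_delay region_eq_sym in auto)
  next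
    fix l u g R l' assume a: "(l, rc u) \<in> Ds s Tr c \<Delta> \<and> (\<forall>i. 0 \<le> u i) \<and> (l, None, g, R, l') \<in> T \<and> gsat g u"
    then obtain u0 where u0: "?TR l u0 s Tr c" "diffs (wv u0 c) = \<Delta>" "region_eq M (n + k) u0 u"
      using DsD by blast
    have "gsat g u0" using gsat_rc u0(3) a by blast
    then have "?TR l' (resets (set R) u0) s Tr c" using a by (intro tick_reach.eps[OF u0(1)]) auto
    moreover have "wv (resets (set R) u0) c = wv u0 c"
      using edge[of l None g R l'] a unfolding wv_def resets_def by fastforce
    ultimately show "(l', rc (resets (set R) u)) \<in> Ds s Tr c \<Delta>"
      using u0 by (intro DsI[OF _ _ region_eq_resets]) auto
  next
    fix l \<alpha> assume "(l, \<alpha>) \<in> Ds s Tr c \<Delta>"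
    then obtain u0 where "?TR l u0 s Tr c" unfolding Ds_def by blast
    from TRJR[OF this] show "l \<notin> (if bet s then FB else FA)"
      using sep unfolding bet_def by (cases "bet s") (auto simp: bet_def)
  qed (rule Tr)
  have sub: "(Tr, Ds s Tr c \<Delta>, bet s) \<in> vertices" if "Tr \<subseteq> {..<k}" for s Tr c \<Delta>
  proof -
    have "Ds s Tr c \<Delta> \<subseteq> Loc \<times> Pow (atom_space M (n + k))"
      unfolding Ds_def by (auto dest: inv intro: region_class_subset[THEN subsetD])
    then show ?thesis using that unfolding vertices_def by simp
  qed
  have "budgeted k ok W"
    unfolding budgeted_def
  proof (intro allI impI)
    fix v b and e :: "nat option \<times> valuation" assume "(v, b) \<in> W"
    then obtain s Tr c \<Delta> where v: "v = (Tr, Ds s Tr c \<Delta>, bet s)" and b: "b = (\<lambda>x. if x \<in> Tr then m - c x else 0)"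
      and Tr: "Tr \<subseteq> {..<k}" unfolding W_def by blast
    obtain oa w where e: "e = (oa, w)" by force
    let ?goal = "\<exists>Y T v' b'. ok v e Y T v' \<and> (v', b') \<in> W \<and>
      (\<forall>x<k. x \<notin> Y \<longrightarrow> b' x \<le> b x \<and> (x \<in> T \<longrightarrow> b' x < b x))"
    \<comment> \<open>An event that cannot occur at this vertex is answered by staying there with
      the same budget.\<close>
    have idle: ?goal if "ok v e {} {} v"
      by (intro exI[of _ "{}"] exI[of _ v] exI[of _ b]) (use that \<open>(v, b) \<in> W\<close> in auto)
    show ?goal
    proof (cases oa)
      case None
      show ?thesis
      proof (cases "\<forall>x\<in>Tr. w x \<le> 1")
        case False
        then show ?thesis by (intro idle) (unfold v e None ok.simps, blast)
      next
        case pre: True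
        define Tk where "Tk = {x \<in> Tr. w x = 1}"
        \<comment> \<open>A ticking clock is given up exactly when its budget \<open>m - c x\<close>
          is used up; otherwise the tick lowers it.\<close>
        define Y where "Y = {x \<in> Tk. m \<le> c x}"
        define c' where "c' = (\<lambda>x. if x \<in> Tk then c x + 1 else c x)"
        let ?v = "(Tr - Y, Ds s (Tr - Y) c' \<Delta>, bet s)"
        let ?b = "\<lambda>x. if x \<in> Tr - Y then m - c' x else 0"
        have "(l, rc (resets ((+) n ` Tk) u)) \<in> Ds s (Tr - Y) c' \<Delta>"
          if a: "(l, rc u) \<in> Ds s Tr c \<Delta>" "tracked_eq Tr (\<lambda>x. u (n + x)) w" for l u
        proof -
          obtain u0 where u0: "?TR l u0 s Tr c" "diffs (wv u0 c) = \<Delta>" "region_eq M (n + k) u0 u"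
            using DsD[OF a(1)] by blast
          have te: "tracked_eq Tr (\<lambda>x. u0 (n + x)) w"
            using tracked_eq_trans[OF region_eq_tracked_eq[OF u0(3) M1 Tr] a(2)] .
          have 1: "\<forall>x\<in>Tr. u0 (n + x) \<le> 1" using tracked_eqD(3)[OF te] pre by blast
          have 2: "Tk = {x \<in> Tr. u0 (n + x) = 1}" using tracked_eqD(4)[OF te] unfolding Tk_def by blast
          have "?TR l (resets ((+) n ` Tk) u0) s (Tr - Y) c'"
            using tick_reach.tick[OF u0(1) 1 2] unfolding Y_def c'_def by simp
          moreover have "wv (resets ((+) n ` Tk) u0) c' = wv u0 c"
            unfolding wv_def c'_def resets_def by (rule ext) (use 2 in simp)
          ultimately show ?thesis using u0 by (intro DsI[OF _ _ region_eq_resets]) auto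
        qed
        then have "ok v e Y Tk ?v" unfolding v e None ok.simps Tk_def Y_def by blast
        moreover have "(?v, ?b) \<in> W" using Tr by (intro WI) auto
        moreover have "\<forall>x<k. x \<notin> Y \<longrightarrow> ?b x \<le> b x \<and> (x \<in> Tk \<longrightarrow> ?b x < b x)"
          unfolding b c'_def Y_def Tk_def by auto
        ultimately show ?thesis by blast
      qed
    next
      case (Some a)
      show ?thesis
      proof (cases "(\<forall>x\<in>Tr. w x < 1) \<and> (\<exists>l1 u1. ?TR l1 u1 s Tr c \<and> diffs (wv u1 c) = \<Delta> \<and> tracked_eq Tr (\<lambda>x. u1 (n + x)) w)")
        case False
        have "\<not> ((l, rc u) \<in> Ds s Tr c \<Delta> \<and> tracked_eq Tr (\<lambda>x. u (n + x)) w)" if "\<forall>x\<in>Tr. w x < 1" for l u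
          using False that DsD region_eq_tracked_eq[OF _ M1 Tr] tracked_eq_trans by meson
        then show ?thesis by (intro idle) (auto simp: v e Some)
      next
        case True
        then obtain l1 u1 where u1: "?TR l1 u1 s Tr c" "diffs (wv u1 c) = \<Delta>" "tracked_eq Tr (\<lambda>x. u1 (n + x)) w"
          and pre: "\<forall>x\<in>Tr. w x < 1" by blast
        \<comment> \<open>The controller is asked at one configuration that matches
          \<open>w\<close>. Any other one gets the same answer: counted clocks have the same count
          and the same position between 0 and 1, uncounted clocks lie beyond \<open>m\<close>, and
          the differences agree by \<Delta>.\<close>
        obtain Y s' where Y: "\<delta> s a (wv u1 c) = (Y, s')" by force
        have s: "s \<in> Q" and nn1: "\<And>i. 0 \<le> u1 i" using inv[OF u1(1)] by auto
        have nw1: "\<And>x. 0 \<le> wv u1 c x" using nn1 by (simp add: wv_def)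
        have Yk: "Y \<subseteq> {..<k}" using C(3)[of s "wv u1 c" a, OF s nw1] Y by simp
        define c' where "c' = (\<lambda>x. if x \<in> Y then 0 else c x)"
        define \<Delta>' where "\<Delta>' = diffs (resets Y (wv u1 c))"
        let ?v = "(Tr \<union> Y, Ds s' (Tr \<union> Y) c' \<Delta>', bet s')"
        let ?b = "\<lambda>x. if x \<in> Tr \<union> Y then m - c' x else 0"
        have "(l', rc (resets (set R \<union> (+) n ` Y) u)) \<in> Ds s' (Tr \<union> Y) c' \<Delta>'"
          if a: "(l, rc u) \<in> Ds s Tr c \<Delta>" "tracked_eq Tr (\<lambda>x. u (n + x)) w" "(l, Some a, g, R, l') \<in> T" "gsat g u" for l u g R l'
        proof -
          obtain u0 where u0: "?TR l u0 s Tr c" "diffs (wv u0 c) = \<Delta>" "region_eq M (n + k) u0 u"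
            using DsD[OF a(1)] by blast
          have te: "tracked_eq Tr (\<lambda>x. u0 (n + x)) w"
            using tracked_eq_trans[OF region_eq_tracked_eq[OF u0(3) M1 Tr] a(2)] .
          have te1: "tracked_eq Tr (\<lambda>x. u0 (n + x)) (\<lambda>x. u1 (n + x))"
            using tracked_eq_trans[OF te tracked_eq_sym[OF u1(3)]] .
          have lt: "\<forall>x\<in>Tr. u0 (n + x) < 1" using tracked_eqD(2)[OF te] pre by blast
          have lt1: "\<forall>x\<in>Tr. u1 (n + x) < 1" using tracked_eqD(2)[OF u1(3)] pre by blast
          have nn0: "\<And>i. 0 \<le> u0 i" using inv[OF u0(1)] by auto
          have req: "region_eq m k (wv u1 c) (wv u0 c)"
            unfolding region_eq_def
          proof (intro allI impI conjI)
            fix x z assume x: "x < k" and z: "\<bar>z\<bar> \<le> int m"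
            have "(wv u1 c x < of_int z \<longleftrightarrow> wv u0 c x < of_int z) \<and> (wv u1 c x \<le> of_int z \<longleftrightarrow> wv u0 c x \<le> of_int z)"
            proof (cases "x \<in> Tr")
              case True
              let ?y = "z - int (c x)"
              have bnd: "u0 (n + x) < 1" "0 \<le> u0 (n + x)" "u1 (n + x) < 1" "0 \<le> u1 (n + x)"
                using lt lt1 nn0 nn1 True by auto
              have 0: "u1 (n + x) \<le> 0 \<longleftrightarrow> u0 (n + x) \<le> 0" using tracked_eqD(1)[OF te1 True] by simp
              have "(u1 (n + x) < of_int ?y \<longleftrightarrow> u0 (n + x) < of_int ?y) \<and> (u1 (n + x) \<le> of_int ?y \<longleftrightarrow> u0 (n + x) \<le> of_int ?y)"
              proof -
                consider "?y < 0" | "?y = 0" | "1 \<le> ?y" by linarith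
                then show ?thesis
                proof cases
                  case 1
                  then have "real_of_int ?y < 0" by linarith
                  then show ?thesis using bnd by linarith
                next
                  case 2
                  then show ?thesis using bnd 0 by simp
                next
                  case 3
                  then have "1 \<le> real_of_int ?y" by linarith
                  then show ?thesis using bnd by linarith
                qed
              qed
              then show ?thesis unfolding wv_def by (simp add: algebra_simps)
            next
              case False
              have "m < c x" using inv[OF u0(1)] x False by auto
              then have "of_int z < wv u1 c x" "of_int z < wv u0 c x"
                using z nn0[of "n + x"] nn1[of "n + x"] unfolding wv_def by linarith+
              then show ?thesis by linarith
            qed
            then show "wv u1 c x < of_int z \<longleftrightarrow> wv u0 c x < of_int z" "wv u1 c x \<le> of_int z \<longleftrightarrow> wv u0 c x \<le> of_int z"
              by auto
            fix y assume y: "y < k"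
            have "(x, y, z) \<in> diffs (wv u1 c) \<longleftrightarrow> (x, y, z) \<in> diffs (wv u0 c)" using u0(2) u1(2) by simp
            then show "wv u1 c x - wv u1 c y < of_int z \<longleftrightarrow> wv u0 c x - wv u0 c y < of_int z"
              using x y z unfolding diffs_def by simp
          qed
          have nw0: "\<And>x. 0 \<le> wv u0 c x" using nn0 by (simp add: wv_def)
          have "\<delta> s a (wv u0 c) = (Y, s')" using C(5)[of s "wv u1 c" "wv u0 c" a, OF s nw1 nw0 req] Y by simp
          moreover have "gsat g u0" using gsat_rc[OF a(3) u0(3)] a(4) by simp
          ultimately have "?TR l' (resets (set R \<union> (+) n ` Y) u0) s' (Tr \<union> Y) c'"
            unfolding wv_def c'_def using tick_reach.letter[OF u0(1) lt a(3)] by blast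
          moreover have "wv (resets (set R \<union> (+) n ` Y) u0) c' = resets Y (wv u0 c)"
            using edge[OF a(3)] unfolding wv_def c'_def resets_def by fastforce
          moreover have "diffs (resets Y (wv u0 c)) = \<Delta>'"
            using region_eqD(3)[OF region_eq_resets[OF req, of Y]] unfolding \<Delta>'_def diffs_def by auto
          ultimately show ?thesis using u0(3) by (intro DsI[OF _ _ region_eq_resets]) auto
        qed
        then have "ok v e Y {} ?v" unfolding v e Some ok.simps using Yk by blast
        moreover have "(?v, ?b) \<in> W" using Tr Yk by (intro WI) auto
        moreover have "\<forall>x<k. x \<notin> Y \<longrightarrow> ?b x \<le> b x \<and> (x \<in> {} \<longrightarrow> ?b x < b x)"
          unfolding b c'_def by auto
        ultimately show ?thesis by blast
      qed
    qed
  qed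
  moreover have "v \<in> vertices \<and> good v" if v: "v \<in> fst ` W" for v
  proof -
    obtain s Tr c \<Delta> where *: "v = (Tr, Ds s Tr c \<Delta>, bet s)" "Tr \<subseteq> {..<k}" using v unfolding W_def by auto
    show ?thesis unfolding *(1) using good[OF *(2)] sub[OF *(2)] by blast
  qed
  then have "fst ` W \<subseteq> vertices" "\<forall>v\<in>fst ` W. good v" by blast+
  moreover have "(({..<k}, Ds s0 {..<k} (\<lambda>_. 0) (diffs (\<lambda>_. 0)), bet s0), \<lambda>x. if x \<in> {..<k} then m - 0 else 0) \<in> W"
    using WI[of "{..<k}" s0 "\<lambda>_. 0" "diffs (\<lambda>_. 0)"] by simp
  moreover have "\<forall>l\<in>I. (l, rc (\<lambda>_. 0)) \<in> Ds s0 {..<k} (\<lambda>_. 0) (diffs (\<lambda>_. 0))"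
    using tick_reach.init by (intro ballI DsI[of _ "\<lambda>_. 0"]) (auto simp: wv_def)
  ultimately show ?thesis by blast
qed

end

section \<open>From bounded budgets back to a controller\<close>

type_synonym 'l tick_state = "'l vertex \<times> (nat \<Rightarrow> nat) \<times> (nat \<Rightarrow> nat)"

locale tick_strategy = tick_game n k M T I FA FB Loc
  for n k M :: nat and T :: "'l edge set" and I FA FB Loc :: "'l set" +
  fixes W :: "('l vertex \<times> (nat \<Rightarrow> nat)) set" and N :: nat
  assumes finW: "finite W" and budW: "budgeted k ok W" and goodW: "(v, b) \<in> W \<Longrightarrow> good v"
    and boundW: "(v, b) \<in> W \<Longrightarrow> x < k \<Longrightarrow> b x < N"
begin

definition answers :: "'l vertex \<Rightarrow> (nat \<Rightarrow> nat) \<Rightarrow> nat option \<times> valuation \<Rightarrow>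
    nat set \<Rightarrow> nat set \<Rightarrow> 'l vertex \<Rightarrow> (nat \<Rightarrow> nat) \<Rightarrow> bool" where
  "answers v b e Y Tk v' b' \<longleftrightarrow> ok v e Y Tk v' \<and> (v', b') \<in> W \<and>
     (\<forall>x<k. x \<notin> Y \<longrightarrow> b' x \<le> b x \<and> (x \<in> Tk \<longrightarrow> b' x < b x))"

definition answer where
  "answer v b e = (SOME (Y, Tk, v', b'). answers v b e Y Tk v' b')"

lemma answer: "(v, b) \<in> W \<Longrightarrow> answer v b e = (Y, Tk, v', b') \<Longrightarrow> answers v b e Y Tk v' b'"
proof -
  assume vb: "(v, b) \<in> W" and eq: "answer v b e = (Y, Tk, v', b')"
  let ?P = "\<lambda>(Y, Tk, v', b'). answers v b e Y Tk v' b'"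
  have "\<exists>q. ?P q" using budW[unfolded budgeted_def, rule_format, OF vb, of e] unfolding answers_def by fast
  from someI_ex[OF this] have "?P (answer v b e)" unfolding answer_def .
  then show ?thesis unfolding eq by simp
qed

text \<open>The answers must depend on the region of an event only, hence the choice of a representative.\<close>

definition canon :: "nat set \<Rightarrow> valuation \<Rightarrow> valuation" where
  "canon X w = (SOME w'. tracked_eq X w w')"

lemma canon: "tracked_eq X w (canon X w)"
  unfolding canon_def by (rule someI[of _ w]) simp

lemma canon_cong: "tracked_eq X w w' \<Longrightarrow> canon X w = canon X w'"
proof -
  assume "tracked_eq X w w'"
  then have "tracked_eq X w = tracked_eq X w'"
    using tracked_eq_trans tracked_eq_sym by blast
  then show ?thesis unfolding canon_def by simp
qed

lemma state_exhaust: obtains Tr D \<beta> b c where "(s :: 'l tick_state) = ((Tr, D, \<beta>), b, c)"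
proof -
  obtain v b c where s: "s = (v, b, c)" by (cases s) auto
  obtain Tr D \<beta> where "v = (Tr, D, \<beta>)" by (cases v) auto
  then show ?thesis using that s by blast
qed

text \<open>A tick raises the count by 1 and lowers the budget by at least 1, so
  \<open>c x + b x < N\<close> is preserved and the counts stay bounded. A clock that is given up
  keeps its last count, at most \<open>N\<close>; the value 0 from \<open>k\<close> on makes the set
  finite.\<close>

definition states :: "'l tick_state set" where
  "states = {(v, b, c). (v, b) \<in> W \<and> (\<forall>x\<in>fst v. c x + b x < N) \<and> (\<forall>x. (x \<in> {..<k} \<longrightarrow> c x \<in> {..N}) \<and> (x \<notin> {..<k} \<longrightarrow> c x = 0))}"

lemma finite_states: "finite states"
proof -
  have "finite {c :: nat \<Rightarrow> nat. \<forall>x. (x \<in> {..<k} \<longrightarrow> c x \<in> {..N}) \<and> (x \<notin> {..<k} \<longrightarrow> c x = 0)}" (is "finite ?C")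
    by (rule finite_set_of_finite_funs) auto
  then have "finite ((\<lambda>((v, b), c). (v, b, c)) ` (W \<times> ?C))" using finW by simp
  moreover have "states \<subseteq> (\<lambda>((v, b), c). (v, b, c)) ` (W \<times> ?C)"
  proof
    fix s assume "s \<in> states"
    then obtain v b c where "s = (v, b, c)" "(v, b) \<in> W" "c \<in> ?C" unfolding states_def by blast
    then show "s \<in> (\<lambda>((v, b), c). (v, b, c)) ` (W \<times> ?C)" by (intro image_eqI[of _ _ "((v, b), c)"]) auto
  qed
  ultimately show ?thesis using finite_subset by blast
qed

lemma statesD:
  assumes "(v, b, c) \<in> states"
  shows "(v, b) \<in> W" "good v" "fst v \<subseteq> {..<k}" "finite (fst v)" "x \<in> fst v \<Longrightarrow> c x + b x < N" "c x \<le> N" "k \<le> x \<Longrightarrow> c x = 0"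
proof -
  show vb: "(v, b) \<in> W" using assms unfolding states_def by blast
  show "good v" using goodW[OF vb] .
  then show "fst v \<subseteq> {..<k}" by (cases v) simp
  then show "finite (fst v)" by (rule finite_subset) simp
  show "x \<in> fst v \<Longrightarrow> c x + b x < N" using assms unfolding states_def by blast
  have *: "(x \<in> {..<k} \<longrightarrow> c x \<in> {..N}) \<and> (x \<notin> {..<k} \<longrightarrow> c x = 0)" using assms unfolding states_def by blast
  then show "c x \<le> N" by (cases "x < k") auto
  show "k \<le> x \<Longrightarrow> c x = 0" using * by auto
qed

fun due :: "'l tick_state \<Rightarrow> valuation \<Rightarrow> bool" where
  "due (v, b, c) w \<longleftrightarrow> (\<exists>x\<in>fst v. real (c x) + 1 \<le> w x)"

text \<open>The controller acts at letters only, so ticks may be overdue. The maximum is the time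
  since the first of them; subtracting it gives the clock values at that instant, relative to the
  counts, with the foremost counted clock exactly at 1.\<close>

definition tick_vals :: "'l vertex \<Rightarrow> (nat \<Rightarrow> nat) \<Rightarrow> valuation \<Rightarrow> valuation" where
  "tick_vals v c w = (\<lambda>x. w x - real (c x) - Max ((\<lambda>x. w x - real (c x) - 1) ` fst v))"

fun advance :: "'l tick_state \<Rightarrow> valuation \<Rightarrow> 'l tick_state" where
  "advance (v, b, c) w = (case answer v b (None, canon (fst v) (tick_vals v c w)) of
     (Y, Tk, v', b') \<Rightarrow> (v', b', \<lambda>x. if x \<in> Tk then c x + 1 else c x))"

text \<open>The measure for replaying overdue ticks. A ticking clock loses budget or is given up,
  and the summand 1 makes the latter count as progress even at budget 0.\<close>

fun weight :: "'l tick_state \<Rightarrow> nat" where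
  "weight (v, b, c) = (\<Sum>x\<in>fst v. b x + 1)"

lemma tick_vals_max:
  assumes "finite (fst v)" "y \<in> fst v" "\<And>x. x \<in> fst v \<Longrightarrow> w x - real (c x) \<le> w y - real (c y)"
  shows "tick_vals v c w x = w x - real (c x) - (w y - real (c y)) + 1"
proof -
  have "Max ((\<lambda>x. w x - real (c x) - 1) ` fst v) = w y - real (c y) - 1"
    using assms by (intro Max_eqI) auto
  then show ?thesis by (simp add: tick_vals_def)
qed

lemma max_clock:
  assumes "finite (fst v)" "due (v, b, c) w"
  obtains y where "y \<in> fst v" "\<And>x. x \<in> fst v \<Longrightarrow> w x - real (c x) \<le> w y - real (c y)" "1 \<le> w y - real (c y)"
proof -
  obtain x where x: "x \<in> fst v" "real (c x) + 1 \<le> w x" using assms(2) by auto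
  let ?A = "(\<lambda>x. w x - real (c x)) ` fst v"
  have "Max ?A \<in> ?A" using assms(1) x(1) by (intro Max_in) auto
  then obtain y where y: "y \<in> fst v" "Max ?A = w y - real (c y)" by auto
  have le: "w x - real (c x) \<le> w y - real (c y)" if "x \<in> fst v" for x
    using Max_ge[of ?A "w x - real (c x)"] assms(1) that y(2) by simp
  then show ?thesis using that[OF y(1) le] x by force
qed

text \<open>The situation at the first overdue tick does not depend on when the tick is
  noticed.\<close>

lemma tick_vals_delay:
  assumes "finite (fst v)" "due (v, b, c) w"
  shows "tick_vals v c (\<lambda>x. w x + d) = tick_vals v c w"
proof
  fix x
  obtain y where y: "y \<in> fst v" "\<And>x. x \<in> fst v \<Longrightarrow> w x - real (c x) \<le> w y - real (c y)"
    using max_clock[OF assms] by blast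
  have "\<And>x. x \<in> fst v \<Longrightarrow> w x + d - real (c x) \<le> w y + d - real (c y)" using y(2) by (simp add: algebra_simps)
  then have "tick_vals v c (\<lambda>x. w x + d) x = (w x + d) - real (c x) - ((w y + d) - real (c y)) + 1"
    using tick_vals_max[OF assms(1) y(1), of "\<lambda>x. w x + d" c x] by simp
  also have "\<dots> = tick_vals v c w x" using tick_vals_max[of v y w c x, OF assms(1) y] by simp
  finally show "tick_vals v c (\<lambda>x. w x + d) x = tick_vals v c w x" .
qed

lemma advance_props:
  assumes s: "((Tr, D, \<beta>), b, c) \<in> states" and due: "due ((Tr, D, \<beta>), b, c) w"
  obtains Y Tk D' b' where
    "advance ((Tr, D, \<beta>), b, c) w = ((Tr - Y, D', \<beta>), b', \<lambda>x. if x \<in> Tk then c x + 1 else c x)"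
    "advance ((Tr, D, \<beta>), b, c) w \<in> states"
    "weight (advance ((Tr, D, \<beta>), b, c) w) < weight ((Tr, D, \<beta>), b, c)"
    "Tk = {x \<in> Tr. tick_vals (Tr, D, \<beta>) c w x = 1}"
    "\<forall>l u. (l, rc u) \<in> D \<and> (\<forall>i. 0 \<le> u i) \<and> (\<forall>x. u (n + x) = tick_vals (Tr, D, \<beta>) c w x)
       \<longrightarrow> (l, rc (resets ((+) n ` Tk) u)) \<in> D'"
proof -
  let ?v = "(Tr, D, \<beta>)"
  let ?g = "tick_vals ?v c w"
  note S = statesD[OF s]
  have fT: "finite Tr" and Trk: "Tr \<subseteq> {..<k}" using S(3,4) by auto
  obtain y where y: "y \<in> Tr" "\<And>x. x \<in> Tr \<Longrightarrow> w x - real (c x) \<le> w y - real (c y)"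
    using max_clock[OF _ due] fT by auto
  have g: "?g x = w x - real (c x) - (w y - real (c y)) + 1" for x
    using tick_vals_max[of ?v y w c x] fT y by simp
  have cn: "tracked_eq Tr ?g (canon Tr ?g)" by (rule canon)
  obtain Y Tk v' b' where ans: "answer ?v b (None, canon Tr ?g) = (Y, Tk, v', b')"
    by (cases "answer ?v b (None, canon Tr ?g)") auto
  obtain Tr' D' \<beta>' where v': "v' = (Tr', D', \<beta>')" by (cases v') auto
  note A = answer[OF S(1) ans, unfolded answers_def v' ok.simps]
  have le1: "\<forall>x\<in>Tr. canon Tr ?g x \<le> 1"
    using tracked_eqD(3)[OF cn] g y(2) by fastforce
  have A1: "Tk = {x \<in> Tr. canon Tr ?g x = 1}" "Y \<subseteq> Tk" "Tr' = Tr - Y" "\<beta>' = \<beta>"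
    "\<And>l u. (l, rc u) \<in> D \<Longrightarrow> (\<forall>i. 0 \<le> u i) \<Longrightarrow> tracked_eq Tr (\<lambda>x. u (n + x)) (canon Tr ?g)
       \<Longrightarrow> (l, rc (resets ((+) n ` Tk) u)) \<in> D'"
    using conjunct1[OF A] le1 by blast+
  have A2: "(v', b') \<in> W" "\<And>x. x < k \<Longrightarrow> x \<notin> Y \<Longrightarrow> b' x \<le> b x \<and> (x \<in> Tk \<longrightarrow> b' x < b x)"
    using A v' by blast+
  have Tk: "Tk = {x \<in> Tr. ?g x = 1}" using A1(1) tracked_eqD(4)[OF cn] by blast
  have adv: "advance (?v, b, c) w = ((Tr - Y, D', \<beta>), b', \<lambda>x. if x \<in> Tk then c x + 1 else c x)"
    using ans v' A1(3,4) by simp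
  have "advance (?v, b, c) w \<in> states"
    unfolding adv states_def mem_Collect_eq split_conv
  proof (intro conjI ballI allI impI)
    show "((Tr - Y, D', \<beta>), b') \<in> W" using A2(1) v' A1(3,4) by simp
    show "(if x \<in> Tk then c x + 1 else c x) + b' x < N" if "x \<in> fst (Tr - Y, D', \<beta>)" for x
    proof -
      have x: "x \<in> Tr" "x \<notin> Y" "x < k" using that Trk by auto
      show ?thesis using A2(2)[OF x(3,2)] S(5)[of x] x(1) by auto
    qed
    show "(if x \<in> Tk then c x + 1 else c x) \<in> {..N}" for x
      using S(5)[of x] S(6)[of x] Tk by auto
    show "(if x \<in> Tk then c x + 1 else c x) = 0" if "x \<notin> {..<k}" for x
      using that S(7)[of x] Tk Trk by auto
  qed
  moreover have "weight (advance (?v, b, c) w) < weight (?v, b, c)"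
  proof -
    have "y \<in> Tk" using Tk y(1) g by simp
    have "(\<Sum>x\<in>Tr - Y. b' x + 1) < (\<Sum>x\<in>Tr. b x + 1)"
    proof (cases "y \<in> Y")
      case True
      have "(\<Sum>x\<in>Tr - Y. b' x + 1) \<le> (\<Sum>x\<in>Tr - Y. b x + 1)"
        using A2(2) Trk by (intro sum_mono) auto
      also have "\<dots> < (\<Sum>x\<in>Tr. b x + 1)"
        using True y(1) fT by (intro sum_strict_mono2[of _ _ y]) auto
      finally show ?thesis .
    next
      case False
      have "(\<Sum>x\<in>Tr - Y. b' x + 1) < (\<Sum>x\<in>Tr - Y. b x + 1)"
        using A2(2) Trk fT y(1) False \<open>y \<in> Tk\<close> by (intro sum_strict_mono_ex1) auto
      also have "\<dots> \<le> (\<Sum>x\<in>Tr. b x + 1)" using fT by (intro sum_mono2) auto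
      finally show ?thesis .
    qed
    then show ?thesis unfolding adv by simp
  qed
  moreover have "\<forall>l u. (l, rc u) \<in> D \<and> (\<forall>i. 0 \<le> u i) \<and> (\<forall>x. u (n + x) = ?g x)
      \<longrightarrow> (l, rc (resets ((+) n ` Tk) u)) \<in> D'"
    using A1(5) cn by simp
  ultimately show ?thesis using adv Tk that by blast
qed

text \<open>Replays overdue ticks until none is left. The choice from the transitive closure allows
  the definition before termination is known; \<open>settle_induct\<close> supplies termination on
  \<open>states\<close> through \<open>weight\<close>.\<close>

definition settle :: "valuation \<Rightarrow> 'l tick_state \<Rightarrow> 'l tick_state" where
  "settle w s = (SOME s'. (\<lambda>s s'. due s w \<and> s' = advance s w)\<^sup>*\<^sup>* s s' \<and> \<not> due s' w)"

lemma settle_stop: "\<not> due s w \<Longrightarrow> settle w s = s"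
proof -
  assume nd: "\<not> due s w"
  have "(\<lambda>s s'. due s w \<and> s' = advance s w)\<^sup>*\<^sup>* s s' \<Longrightarrow> s' = s" for s'
    by (erule converse_rtranclpE) (use nd in auto)
  then show ?thesis unfolding settle_def using nd by (intro some_equality) auto
qed

lemma settle_step: "due s w \<Longrightarrow> settle w s = settle w (advance s w)"
proof -
  assume d: "due s w"
  let ?R = "\<lambda>s s'. due s w \<and> s' = advance s w"
  have "?R\<^sup>*\<^sup>* s s' \<and> \<not> due s' w \<longleftrightarrow> ?R\<^sup>*\<^sup>* (advance s w) s' \<and> \<not> due s' w" for s'
  proof
    assume a: "?R\<^sup>*\<^sup>* s s' \<and> \<not> due s' w"
    from a have "?R\<^sup>*\<^sup>* s s'" by simp
    then show "?R\<^sup>*\<^sup>* (advance s w) s' \<and> \<not> due s' w"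
      by (rule converse_rtranclpE) (use a d in auto)
  next
    assume "?R\<^sup>*\<^sup>* (advance s w) s' \<and> \<not> due s' w"
    then show "?R\<^sup>*\<^sup>* s s' \<and> \<not> due s' w" using d by (auto intro: converse_rtranclp_into_rtranclp)
  qed
  then show ?thesis unfolding settle_def by simp
qed

lemma settle_induct [consumes 1, case_names stop step]:
  assumes "s \<in> states"
    and stop: "\<And>s. s \<in> states \<Longrightarrow> \<not> due s w \<Longrightarrow> P s"
    and step: "\<And>s. s \<in> states \<Longrightarrow> due s w \<Longrightarrow> P (advance s w) \<Longrightarrow> P s"
  shows "P s"
  using assms(1)
proof (induction "weight s" arbitrary: s rule: less_induct)
  case less
  show ?case
  proof (cases "due s w")
    case True
    obtain Tr D \<beta> b c where s: "s = ((Tr, D, \<beta>), b, c)" by (rule state_exhaust)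
    have "advance s w \<in> states" "weight (advance s w) < weight s"
      by (rule advance_props[OF less.prems[unfolded s] True[unfolded s], folded s], assumption)+
    then show ?thesis using less True step by blast
  qed (use stop less in blast)
qed

lemma advance_states: "s \<in> states \<Longrightarrow> due s w \<Longrightarrow> advance s w \<in> states \<and> snd (snd (fst (advance s w))) = snd (snd (fst s))"
proof -
  assume a: "s \<in> states" "due s w"
  obtain Tr D \<beta> b c where s: "s = ((Tr, D, \<beta>), b, c)" by (rule state_exhaust)
  show ?thesis
    by (rule advance_props[OF a[unfolded s]]) (simp add: s del: advance.simps)
qed

lemma settle_states:
  assumes "s \<in> states"
  shows "settle w s \<in> states \<and> \<not> due (settle w s) w \<and> snd (snd (fst (settle w s))) = snd (snd (fst s))"
  using assms
proof (induction rule: settle_induct[where w = w])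
  case (stop s)
  then show ?case by (simp add: settle_stop)
next
  case (step s)
  then show ?case using advance_states by (simp add: settle_step)
qed

lemma due_delay: "due s w \<Longrightarrow> 0 \<le> d \<Longrightarrow> due s (\<lambda>x. w x + d)"
  by (cases s) force

lemma advance_delay:
  assumes "s \<in> states" "due s w"
  shows "advance s (\<lambda>x. w x + d) = advance s w"
proof -
  obtain v b c where s: "s = (v, b, c)" by (metis prod_cases3)
  show ?thesis using tick_vals_delay[OF statesD(4)[OF assms(1)[unfolded s]] assms(2)[unfolded s], of d] unfolding s by simp
qed

text \<open>Replaying some ticks now and the others later equals replaying all of them later. Hence
  a state that is updated at letters only behaves as if it had been kept up to date.\<close>

lemma settle_delay:
  assumes "s \<in> states" "0 \<le> d"
  shows "settle (\<lambda>x. w x + d) (settle w s) = settle (\<lambda>x. w x + d) s"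
  using assms(1)
proof (induction rule: settle_induct[where w = w])
  case (stop s)
  then show ?case by (simp add: settle_stop)
next
  case (step s)
  have "settle (\<lambda>x. w x + d) s = settle (\<lambda>x. w x + d) (advance s w)"
    using settle_step[OF due_delay[OF step(2) assms(2)]] advance_delay[OF step(1,2)] by simp
  then show ?case using step(3) settle_step[OF step(2)] by simp
qed

text \<open>Counts of counted clocks are below \<open>N\<close>, so comparing
  \<open>w x - c x\<close> with constants up to 1 means comparing \<open>w x\<close> with constants
  up to \<open>N\<close>. At an overdue tick values are taken relative to the foremost clock:
  differences are compared with constants up to 2 plus the difference of two counts, at most
  \<open>N + 1\<close>. This fixes the constant of the controller.\<close>

lemma tracked_cong:
  assumes s: "(v, b, c) \<in> states" and eq: "region_eq (N + 1) k w w'"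
  shows "due (v, b, c) w \<longleftrightarrow> due (v, b, c) w'"
    "due (v, b, c) w \<Longrightarrow> tracked_eq (fst v) (tick_vals v c w) (tick_vals v c w')"
    "tracked_eq (fst v) (\<lambda>x. w x - real (c x)) (\<lambda>x. w' x - real (c x))"
proof -
  note S = statesD[OF s]
  have cN: "c x < N" if "x \<in> fst v" for x using S(5)[OF that] by simp
  have val: "(w x < of_int z \<longleftrightarrow> w' x < of_int z) \<and> (w x \<le> of_int z \<longleftrightarrow> w' x \<le> of_int z)"
    if "x \<in> fst v" "\<bar>z\<bar> \<le> int N + 1" for x z
    using region_eqD(1,2)[OF eq, of x z] that S(3) by auto
  have dif: "(w x - w y < of_int z \<longleftrightarrow> w' x - w' y < of_int z) \<and> (w x - w y \<le> of_int z \<longleftrightarrow> w' x - w' y \<le> of_int z)"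
    if "x \<in> fst v" "y \<in> fst v" "\<bar>z\<bar> \<le> int N + 1" for x y z
    using region_eqD(3,4)[OF eq, of x z y] that S(3) by auto
  have vc: "(w x - real (c x) < of_int z \<longleftrightarrow> w' x - real (c x) < of_int z) \<and> (w x - real (c x) \<le> of_int z \<longleftrightarrow> w' x - real (c x) \<le> of_int z)"
    if "x \<in> fst v" "\<bar>z\<bar> \<le> 1" for x z
  proof -
    have "\<bar>z + int (c x)\<bar> \<le> int N + 1" using cN[OF that(1)] that(2) by linarith
    from val[OF that(1) this] show ?thesis by (simp add: algebra_simps)
  qed
  have dc: "(w x - real (c x) - (w y - real (c y)) < of_int z \<longleftrightarrow> w' x - real (c x) - (w' y - real (c y)) < of_int z) \<and>
      (w x - real (c x) - (w y - real (c y)) \<le> of_int z \<longleftrightarrow> w' x - real (c x) - (w' y - real (c y)) \<le> of_int z)"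
    if "x \<in> fst v" "y \<in> fst v" "\<bar>z\<bar> \<le> 2" for x y z
  proof -
    have "\<bar>z + int (c x) - int (c y)\<bar> \<le> int N + 1" using cN[OF that(1)] cN[OF that(2)] that(3) by linarith
    from dif[OF that(1,2) this] show ?thesis by (simp add: algebra_simps)
  qed
  have "w x - real (c x) < 1 \<longleftrightarrow> w' x - real (c x) < 1" if "x \<in> fst v" for x using vc[OF that, of 1] by simp
  then have "real (c x) + 1 \<le> w x \<longleftrightarrow> real (c x) + 1 \<le> w' x" if "x \<in> fst v" for x
    using that by (smt (verit))
  then show due: "due (v, b, c) w \<longleftrightarrow> due (v, b, c) w'" by simp
  show "tracked_eq (fst v) (\<lambda>x. w x - real (c x)) (\<lambda>x. w' x - real (c x))"
    unfolding tracked_eq_def using vc dc by (intro ballI allI impI conjI) force+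
  assume d: "due (v, b, c) w"
  obtain y where y: "y \<in> fst v" "\<And>x. x \<in> fst v \<Longrightarrow> w x - real (c x) \<le> w y - real (c y)"
    using max_clock[OF S(4) d] by blast
  have y': "w' x - real (c x) \<le> w' y - real (c y)" if "x \<in> fst v" for x
    using dc[OF that y(1), of 0] y(2)[OF that] by simp
  have g: "tick_vals v c w x = w x - real (c x) - (w y - real (c y)) + 1"
    "tick_vals v c w' x = w' x - real (c x) - (w' y - real (c y)) + 1" for x
    using tick_vals_max[of v y w c x, OF S(4) y] tick_vals_max[of v y w' c x, OF S(4) y(1) y'] by auto
  show "tracked_eq (fst v) (tick_vals v c w) (tick_vals v c w')"
    unfolding tracked_eq_def
  proof (intro ballI allI impI conjI)
    fix x z assume x: "x \<in> fst v" and z: "\<bar>z\<bar> \<le> (1::int)"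
    have "\<bar>z - 1\<bar> \<le> 2" using z by linarith
    from dc[OF x y(1) this]
    show "tick_vals v c w x < of_int z \<longleftrightarrow> tick_vals v c w' x < of_int z"
      "tick_vals v c w x \<le> of_int z \<longleftrightarrow> tick_vals v c w' x \<le> of_int z"
      unfolding g by (simp_all add: algebra_simps)
    fix x' assume x': "x' \<in> fst v"
    have "\<bar>z\<bar> \<le> 2" using z by linarith
    from dc[OF x x' this]
    show "tick_vals v c w x - tick_vals v c w x' < of_int z \<longleftrightarrow> tick_vals v c w' x - tick_vals v c w' x' < of_int z"
      unfolding g by (simp add: algebra_simps)
  qed
qed

lemma settle_cong:
  assumes "s \<in> states" "region_eq (N + 1) k w w'"
  shows "settle w s = settle w' s"
  using assms(1)
proof (induction rule: settle_induct[where w = w])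
  case (stop s)
  obtain v b c where s: "s = (v, b, c)" by (metis prod_cases3)
  have "\<not> due s w'" using tracked_cong(1)[OF stop(1)[unfolded s] assms(2)] stop(2) s by simp
  then show ?case using stop by (simp add: settle_stop)
next
  case (step s)
  obtain v b c where s: "s = (v, b, c)" by (metis prod_cases3)
  note c = tracked_cong[OF step(1)[unfolded s] assms(2)]
  have "due s w'" using c(1) step(2) s by simp
  moreover have "advance s w' = advance s w"
    using canon_cong[OF c(2)] step(2) unfolding s by simp
  ultimately show ?case using step by (simp add: settle_step)
qed

definition strat :: "'l tick_state strategy" where
  "strat s a w = (case settle w s of (v, b, c) \<Rightarrow>
     (case answer v b (Some a, canon (fst v) (\<lambda>x. w x - real (c x))) of
       (Y, Tk, v', b') \<Rightarrow> (Y, (v', b', \<lambda>x. if x \<in> Y then 0 else c x))))"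

lemma strat_props:
  assumes s: "s \<in> states" and set: "settle w s = ((Tr, D, \<beta>), b, c)"
  obtains Y D' \<beta>' b' where "strat s a w = (Y, ((Tr \<union> Y, D', \<beta>'), b', \<lambda>x. if x \<in> Y then 0 else c x))"
    "Y \<subseteq> {..<k}" "snd (strat s a w) \<in> states"
    "\<forall>l u g R l'. (l, rc u) \<in> D \<and> (\<forall>i. 0 \<le> u i) \<and> (\<forall>x. u (n + x) = w x - real (c x)) \<and>
       (l, Some a, g, R, l') \<in> T \<and> gsat g u \<longrightarrow> (l', rc (resets (set R \<union> (+) n ` Y) u)) \<in> D'"
proof -
  let ?v = "(Tr, D, \<beta>)" and ?g = "\<lambda>x. w x - real (c x)"
  have st: "(?v, b, c) \<in> states" and nd: "\<not> due (?v, b, c) w" using settle_states[OF s, of w] set by auto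
  note S = statesD[OF st]
  have cn: "tracked_eq Tr ?g (canon Tr ?g)" by (rule canon)
  obtain Y Tk v' b' where ans: "answer ?v b (Some a, canon Tr ?g) = (Y, Tk, v', b')"
    by (cases "answer ?v b (Some a, canon Tr ?g)") auto
  obtain Tr' D' \<beta>' where v': "v' = (Tr', D', \<beta>')" by (cases v') auto
  note A = answer[OF S(1) ans, unfolded answers_def v' ok.simps]
  have "\<forall>x\<in>Tr. ?g x < 1" using nd by auto
  then have lt: "\<forall>x\<in>Tr. canon Tr ?g x < 1" using tracked_eqD(2)[OF cn] by blast
  have A1: "Y \<subseteq> {..<k}" "Tr' = Tr \<union> Y"
    "\<And>l u g R l'. (l, rc u) \<in> D \<Longrightarrow> (\<forall>i. 0 \<le> u i) \<Longrightarrow> tracked_eq Tr (\<lambda>x. u (n + x)) (canon Tr ?g) \<Longrightarrow>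
       (l, Some a, g, R, l') \<in> T \<Longrightarrow> gsat g u \<Longrightarrow> (l', rc (resets (set R \<union> (+) n ` Y) u)) \<in> D'"
    using conjunct1[OF A] lt by blast+
  have A2: "(v', b') \<in> W" "\<And>x. x < k \<Longrightarrow> x \<notin> Y \<Longrightarrow> b' x \<le> b x"
    using A v' by blast+
  have eq: "strat s a w = (Y, ((Tr \<union> Y, D', \<beta>'), b', \<lambda>x. if x \<in> Y then 0 else c x))"
    unfolding strat_def set using ans v' A1(2) by simp
  have "((Tr \<union> Y, D', \<beta>'), b', \<lambda>x. if x \<in> Y then 0 else c x) \<in> states"
    unfolding states_def mem_Collect_eq split_conv
  proof (intro conjI ballI allI impI)
    show "((Tr \<union> Y, D', \<beta>'), b') \<in> W" using A2(1) v' A1(2) by simp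
    show "(if x \<in> Y then 0 else c x) + b' x < N" if "x \<in> fst (Tr \<union> Y, D', \<beta>')" for x
    proof -
      have xk: "x < k" using that A1(1) S(3) by auto
      show ?thesis using boundW[OF A2(1) xk] A2(2)[OF xk] S(5)[of x] that by auto
    qed
    show "(if x \<in> Y then 0 else c x) \<in> {..N}" for x using S(6)[of x] by auto
    show "(if x \<in> Y then 0 else c x) = 0" if "x \<notin> {..<k}" for x using that S(7)[of x] by auto
  qed
  then have "snd (strat s a w) \<in> states" using eq by simp
  moreover have "\<forall>l u g R l'. (l, rc u) \<in> D \<and> (\<forall>i. 0 \<le> u i) \<and> (\<forall>x. u (n + x) = ?g x) \<and>
       (l, Some a, g, R, l') \<in> T \<and> gsat g u \<longrightarrow> (l', rc (resets (set R \<union> (+) n ` Y) u)) \<in> D'"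
  proof (intro allI impI, elim conjE)
    fix l u g R l'
    assume a: "(l, rc u) \<in> D" "\<forall>i. 0 \<le> u i" "\<forall>x. u (n + x) = ?g x" "(l, Some a, g, R, l') \<in> T" "gsat g u"
    have "(\<lambda>x. u (n + x)) = ?g" using a(3) by simp
    then show "(l', rc (resets (set R \<union> (+) n ` Y) u)) \<in> D'" using A1(3)[OF a(1,2) _ a(4,5)] cn by simp
  qed
  ultimately show ?thesis using eq A1(1) that by blast
qed

lemma strat_controller:
  assumes "s0 \<in> states"
  shows "controller k (N + 1) states s0 strat"
  unfolding controller_def
proof (intro conjI ballI allI impI)
  fix s a and w :: valuation assume s: "s \<in> states"
  obtain Tr D \<beta> b c where set: "settle w s = ((Tr, D, \<beta>), b, c)" by (rule state_exhaust)
  obtain Y q where "strat s a w = (Y, q)" "Y \<subseteq> {..<k}" "snd (strat s a w) \<in> states"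
    by (rule strat_props[OF s set, of a]) blast
  then show "fst (strat s a w) \<subseteq> {..<k}" "snd (strat s a w) \<in> states" by simp_all
  fix w' assume eq: "region_eq (N + 1) k w w'"
  have set': "settle w' s = ((Tr, D, \<beta>), b, c)" using settle_cong[OF s eq] set by simp
  have st: "((Tr, D, \<beta>), b, c) \<in> states" using settle_states[OF s, of w] unfolding set by blast
  show "strat s a w' = strat s a w"
    using canon_cong[OF tracked_cong(3)[OF st eq]] unfolding strat_def set set' by simp
qed (use finite_states assms in auto)

text \<open>The passage from true clock values to those left after subtracting the counts, as they
  occur in the vertices of the game.\<close>

definition off :: "(nat \<Rightarrow> nat) \<Rightarrow> valuation \<Rightarrow> valuation" where
  "off c u = (\<lambda>i. if i < n then u i else u i - real (c (i - n)))"

fun holds :: "'l tick_state \<Rightarrow> 'l \<Rightarrow> valuation \<Rightarrow> bool" where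
  "holds ((Tr, D, \<beta>), b, c) l u \<longleftrightarrow> (l, rc (off c u)) \<in> D \<and> (\<forall>i. 0 \<le> off c u i) \<and>
     (\<forall>x\<in>Tr. u (n + x) \<le> real (c x) + 1)"

lemma off_delay: "off c (\<lambda>i. u i + d) = (\<lambda>i. off c u i + d)"
  unfolding off_def by auto

text \<open>Induction on \<open>weight\<close>. The delay is cut at the first instant at which a
  counted clock ticks: up to there the vertex is closed under delay, there \<open>advance\<close>
  answers the tick, and the remaining time \<alpha> is left to the induction hypothesis.\<close>

lemma holds_delay:
  assumes "s \<in> states" "holds s l u" "0 \<le> d"
  shows "holds (settle (\<lambda>x. u (n + x) + d) s) l (\<lambda>i. u i + d)"
  using assms
proof (induction "weight s" arbitrary: s u d rule: less_induct)
  case less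
  obtain Tr D \<beta> b c where s: "s = ((Tr, D, \<beta>), b, c)" by (rule state_exhaust)
  let ?w = "\<lambda>x. u (n + x) + d"
  note S = statesD[OF less.prems(1)[unfolded s]]
  have h: "(l, rc (off c u)) \<in> D" "\<And>i. 0 \<le> off c u i" "\<And>x. x \<in> Tr \<Longrightarrow> u (n + x) \<le> real (c x) + 1"
    using less.prems(2) unfolding s by auto
  have dcl: "(l, rc (\<lambda>i. off c u i + d')) \<in> D" if "0 \<le> d'" "\<And>x. x \<in> Tr \<Longrightarrow> off c u (n + x) + d' \<le> 1" for d'
    using S(2) h(1,2) that unfolding good.simps by blast
  show ?case
  proof (cases "due s ?w")
    case False
    then have w1: "?w x \<le> real (c x) + 1" if "x \<in> Tr" for x using that unfolding s by fastforce
    have "(l, rc (\<lambda>i. off c u i + d)) \<in> D"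
      using less.prems(3) w1 by (intro dcl) (auto simp: off_def algebra_simps)
    moreover have "\<forall>x\<in>Tr. u (n + x) + d \<le> real (c x) + 1" using w1 by blast
    ultimately show ?thesis using settle_stop[OF False] h(2) less.prems(3) unfolding s by (simp add: off_delay)
  next
    case True
    obtain y where y: "y \<in> Tr" "\<And>x. x \<in> Tr \<Longrightarrow> ?w x - real (c x) \<le> ?w y - real (c y)" "1 \<le> ?w y - real (c y)"
      using max_clock[OF _ True[unfolded s]] S(4) by auto
    define \<alpha> where "\<alpha> = ?w y - real (c y) - 1"
    define d1 where "d1 = d - \<alpha>"
    have g: "tick_vals (Tr, D, \<beta>) c ?w x = u (n + x) - real (c x) + d1" for x
      using tick_vals_max[of "(Tr, D, \<beta>)" y ?w c x] S(4) y(1,2) unfolding d1_def \<alpha>_def by simp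
    have \<alpha>0: "0 \<le> \<alpha>" using y(3) unfolding \<alpha>_def by simp
    have d10: "0 \<le> d1" using h(3)[OF y(1)] unfolding d1_def \<alpha>_def by simp
    have le1: "u (n + x) - real (c x) + d1 \<le> 1" if "x \<in> Tr" for x
      using y(2)[OF that] unfolding d1_def \<alpha>_def by simp
    obtain Y Tk D' b' where
      adv: "advance s ?w = ((Tr - Y, D', \<beta>), b', \<lambda>x. if x \<in> Tk then c x + 1 else c x)"
        "advance s ?w \<in> states" "weight (advance s ?w) < weight s"
      and Tk: "Tk = {x \<in> Tr. tick_vals (Tr, D, \<beta>) c ?w x = 1}"
      and D'H: "\<forall>l u'. (l, rc u') \<in> D \<and> (\<forall>i. 0 \<le> u' i) \<and> (\<forall>x. u' (n + x) = tick_vals (Tr, D, \<beta>) c ?w x)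
        \<longrightarrow> (l, rc (resets ((+) n ` Tk) u')) \<in> D'"
      by (rule advance_props[OF less.prems(1)[unfolded s] True[unfolded s], folded s]) (rule that)
    define c' where "c' = (\<lambda>x. if x \<in> Tk then c x + 1 else c x)"
    have mid: "(l, rc (\<lambda>i. off c u i + d1)) \<in> D" using le1 by (intro dcl[OF d10]) (simp add: off_def)
    have res: "resets ((+) n ` Tk) (\<lambda>i. off c u i + d1) = off c' (\<lambda>i. u i + d1)"
    proof
      fix i
      show "resets ((+) n ` Tk) (\<lambda>i. off c u i + d1) i = off c' (\<lambda>i. u i + d1) i"
      proof (cases "i < n")
        case True
        then have "i \<notin> (+) n ` Tk" by auto
        then show ?thesis using True by (simp add: resets_def off_def)
      next
        case False
        then obtain x where i: "i = n + x" using le_Suc_ex not_less by blast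
        show ?thesis using Tk g unfolding i by (simp add: resets_def off_def c'_def)
      qed
    qed
    have "(l, rc (resets ((+) n ` Tk) (\<lambda>i. off c u i + d1))) \<in> D'"
      by (rule D'H[rule_format], intro conjI allI)
        (use mid h(2) d10 g in \<open>auto simp: off_def add_nonneg_nonneg\<close>)
    then have "(l, rc (off c' (\<lambda>i. u i + d1))) \<in> D'" unfolding res .
    moreover have "0 \<le> off c' (\<lambda>i. u i + d1) i" for i
      unfolding res[symmetric] resets_def using h(2)[of i] d10 by simp
    moreover have "u (n + x) + d1 \<le> real (c' x) + 1" if "x \<in> Tr - Y" for x
      using le1[of x] that unfolding c'_def by auto
    ultimately have "holds (advance s ?w) l (\<lambda>i. u i + d1)" unfolding adv(1) c'_def by simp
    from less.hyps[OF adv(3,2) this \<alpha>0]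
    have "holds (settle (\<lambda>x. u (n + x) + d1 + \<alpha>) (advance s ?w)) l (\<lambda>i. u i + d1 + \<alpha>)" .
    moreover have "(\<lambda>x. u (n + x) + d1 + \<alpha>) = ?w" "(\<lambda>i. u i + d1 + \<alpha>) = (\<lambda>i. u i + d)"
      unfolding d1_def by auto
    ultimately show ?thesis using settle_step[OF True] by simp
  qed
qed

text \<open>The state \<open>s\<close> is only up to date to the last letter, so the configuration
  is compared with the vertex obtained by settling \<open>s\<close> at the present clock
  values.\<close>

lemma strat_invariant:
  assumes s0: "s0 = (({..<k}, D0, \<beta>0), b0, \<lambda>_. 0)" "s0 \<in> states" and I0: "\<And>l. l \<in> I \<Longrightarrow> (l, rc (\<lambda>_. 0)) \<in> D0"
    and reach: "joint_reach n T I s0 strat l u s"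
  shows "s \<in> states \<and> holds (settle (\<lambda>x. u (n + x)) s) l u"
  using reach
proof induction
  case (init l)
  have "\<not> due s0 (\<lambda>_. 0)" unfolding s0(1) by simp
  moreover have "off (\<lambda>_. 0) (\<lambda>_. 0) = (\<lambda>_. 0)" unfolding off_def by (rule ext) simp
  ultimately show ?case using I0[OF init] s0(2) unfolding s0(1) by (simp add: settle_stop)
next
  case (delay l u s d)
  have "holds (settle (\<lambda>x. u (n + x) + d) (settle (\<lambda>x. u (n + x)) s)) l (\<lambda>i. u i + d)"
    using delay settle_states by (intro holds_delay) auto
  then show ?case using settle_delay[of s d "\<lambda>x. u (n + x)"] delay by simp
next
  case (eps l u s g R l')
  obtain Tr D \<beta> b c where set: "settle (\<lambda>x. u (n + x)) s = ((Tr, D, \<beta>), b, c)" by (rule state_exhaust)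
  have st: "((Tr, D, \<beta>), b, c) \<in> states" using settle_states[of s "\<lambda>x. u (n + x)"] eps.IH unfolding set by blast
  have h: "(l, rc (off c u)) \<in> D" "\<forall>i. 0 \<le> off c u i" "\<forall>x\<in>Tr. u (n + x) \<le> real (c x) + 1"
    using eps.IH unfolding set by auto
  have e: "\<forall>x\<in>gclocks g. x < n" "\<forall>x\<in>set R. x < n" using edge[OF eps.hyps(2)] by auto
  have "gsat g u \<longleftrightarrow> gsat g (off c u)" by (rule gsat_cong) (use e(1) in \<open>simp add: off_def\<close>)
  then have "(l', rc (resets (set R) (off c u))) \<in> D"
    using statesD(2)[OF st] h(1,2) eps.hyps(2,3) unfolding good.simps by blast
  moreover have res: "resets (set R) (off c u) = off c (resets (set R) u)"
    using e(2) by (fastforce simp: resets_def off_def)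
  moreover have "(\<lambda>x. resets (set R) u (n + x)) = (\<lambda>x. u (n + x))"
    using e(2) by (fastforce simp: resets_def)
  moreover have "\<forall>i. 0 \<le> off c (resets (set R) u) i"
    unfolding res[symmetric] using h(2) by (simp add: resets_def)
  ultimately show ?case using eps.IH h(3) set by (simp add: fun_eq_iff)
next
  case (letter l u s a g R l' Y s')
  let ?w = "\<lambda>x. u (n + x)"
  obtain Tr D \<beta> b c where set: "settle ?w s = ((Tr, D, \<beta>), b, c)" by (rule state_exhaust)
  have s: "s \<in> states" using letter.IH by simp
  have nd: "\<not> due ((Tr, D, \<beta>), b, c) ?w" using settle_states[OF s, of ?w] set by simp
  have h: "(l, rc (off c u)) \<in> D" "\<And>i. 0 \<le> off c u i" using letter.IH unfolding set by auto
  obtain Y0 D' \<beta>' b' where str: "strat s a ?w = (Y0, ((Tr \<union> Y0, D', \<beta>'), b', \<lambda>x. if x \<in> Y0 then 0 else c x))"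
    "Y0 \<subseteq> {..<k}" "snd (strat s a ?w) \<in> states"
    and D0': "\<forall>l u' g R l'. (l, rc u') \<in> D \<and> (\<forall>i. 0 \<le> u' i) \<and> (\<forall>x. u' (n + x) = ?w x - real (c x)) \<and>
       (l, Some a, g, R, l') \<in> T \<and> gsat g u' \<longrightarrow> (l', rc (resets (set R \<union> (+) n ` Y0) u')) \<in> D'"
    by (rule strat_props[OF s set, of a]) (rule that)
  have Y0: "Y0 = Y" using str(1) letter.hyps(4) by simp
  have s': "s' = ((Tr \<union> Y, D', \<beta>'), b', \<lambda>x. if x \<in> Y then 0 else c x)" and Y: "Y \<subseteq> {..<k}" and st: "s' \<in> states"
    using str letter.hyps(4) by simp_all
  define c' where "c' = (\<lambda>x. if x \<in> Y then 0 else c x)"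
  let ?u = "resets (set R \<union> (+) n ` Y) u"
  have e: "\<forall>x\<in>gclocks g. x < n" "\<forall>x\<in>set R. x < n" using edge[OF letter.hyps(2)] by auto
  have "gsat g u \<longleftrightarrow> gsat g (off c u)" by (rule gsat_cong) (use e(1) in \<open>simp add: off_def\<close>)
  then have "(l', rc (resets (set R \<union> (+) n ` Y) (off c u))) \<in> D'"
    using h letter.hyps(2,3) D0'[unfolded Y0, rule_format, of l "off c u" g R l'] by (auto simp: off_def)
  moreover have res: "resets (set R \<union> (+) n ` Y) (off c u) = off c' ?u"
  proof
    fix i
    show "resets (set R \<union> (+) n ` Y) (off c u) i = off c' ?u i"
    proof (cases "i < n")
      case False
      then obtain x where i: "i = n + x" using le_Suc_ex not_less by blast
      then have "i \<notin> set R" using e(2) by auto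
      then show ?thesis unfolding i by (simp add: resets_def off_def c'_def)
    qed (simp add: resets_def off_def)
  qed
  moreover have "0 \<le> off c' ?u i" for i
    unfolding res[symmetric] using h(2)[of i] by (simp add: resets_def)
  moreover have lt: "?u (n + x) < real (c' x) + 1" if "x \<in> Tr \<union> Y" for x
    using that nd by (auto simp: resets_def c'_def)
  moreover have "settle (\<lambda>x. ?u (n + x)) s' = s'"
    by (rule settle_stop) (use lt in \<open>force simp: s' c'_def\<close>)
  ultimately show ?case using st s' unfolding c'_def by (simp add: less_imp_le)
qed

end

lemma (in tick_game) controller_bound:
  assumes ctrl: "controller k m (Q :: 'q set) s0 \<delta>" and finV: "finite Loc" "card vertices \<le> K"
    and sep: "\<forall>s l u l' u'. l \<in> FA \<longrightarrow> l' \<in> FB \<longrightarrow> joint_reach n T I s0 \<delta> l u s \<longrightarrow> \<not> joint_reach n T I s0 \<delta> l' u' s"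
  shows "\<exists>(Q' :: 'l tick_state set) s0' \<delta>'. controller k (k * (K * k ^ k * k + 1) + 1) Q' s0' \<delta>' \<and>
    (\<forall>s l u l' u'. l \<in> FA \<longrightarrow> l' \<in> FB \<longrightarrow> joint_reach n T I s0' \<delta>' l u s \<longrightarrow> \<not> joint_reach n T I s0' \<delta>' l' u' s)"
proof -
  let ?N = "k * (K * k ^ k * k + 1)"
  obtain W D0 \<beta>0 b0 where W: "budgeted k ok W" "fst ` W \<subseteq> vertices" "\<forall>v\<in>fst ` W. good v"
    "(({..<k}, D0, \<beta>0), b0) \<in> W" and D0: "\<And>l. l \<in> I \<Longrightarrow> (l, rc (\<lambda>_. 0)) \<in> D0"
    using controller_budgeted[OF ctrl sep] by blast
  have "finite vertices" unfolding vertices_def using finV(1) card_atom_space(1)[of M "n + k"] by simp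
  from budget_bound[OF this W(2) finV(2) W(1)] obtain W' where W': "finite W'" "fst ` W' = fst ` W" "budgeted k ok W'"
    "\<forall>(v, b)\<in>W'. \<forall>x<k. b x < ?N" by (elim exE conjE)
  interpret tick_strategy n k M T I FA FB Loc W' ?N
  proof
    show "finite W'" "budgeted k ok W'" using W' by auto
    show "good v" if "(v, b) \<in> W'" for v b using that W(3) W'(2) by (metis fst_conv image_eqI)
    show "b x < ?N" if "(v, b) \<in> W'" "x < k" for v b x using W'(4) that by blast
  qed
  have "({..<k}, D0, \<beta>0) \<in> fst ` W'" using W(4) W'(2) by force
  then obtain b1 where b1: "(({..<k}, D0, \<beta>0), b1) \<in> W'" by auto
  define q0 where "q0 = (({..<k}, D0, \<beta>0), b1, \<lambda>_ :: nat. 0 :: nat)"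
  have q0: "q0 \<in> states" unfolding q0_def states_def using b1 boundW[OF b1] by auto
  have "\<not> joint_reach n T I q0 strat l' u' s" if "l \<in> FA" "l' \<in> FB" "joint_reach n T I q0 strat l u s" for s l u l' u'
  proof
    assume r': "joint_reach n T I q0 strat l' u' s"
    \<comment> \<open>Ticks preserve the verdict, so the one stored in \<open>s\<close> is valid for
      every configuration reached with \<open>s\<close>, whatever ticks are overdue.\<close>
    have final: "l \<notin> (if snd (snd (fst s)) then FB else FA)" if r: "joint_reach n T I q0 strat l u s" for l u
    proof -
      have h: "s \<in> states" "holds (settle (\<lambda>x. u (n + x)) s) l u"
        using strat_invariant[OF q0_def q0 D0 r] by auto
      obtain Tr D \<beta> b c where set: "settle (\<lambda>x. u (n + x)) s = ((Tr, D, \<beta>), b, c)" by (rule state_exhaust)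
      have st: "((Tr, D, \<beta>), b, c) \<in> states" "\<beta> = snd (snd (fst s))"
        using settle_states[OF h(1), of "\<lambda>x. u (n + x)"] unfolding set by auto
      have "(l, rc (off c u)) \<in> D" using h(2) unfolding set by simp
      moreover have "\<forall>l \<alpha>. (l, \<alpha>) \<in> D \<longrightarrow> l \<notin> (if \<beta> then FB else FA)"
        using statesD(2)[OF st(1)] unfolding good.simps by blast
      ultimately show ?thesis using st(2) by blast
    qed
    show False using final[OF that(3)] final[OF r'] that(1,2) by (auto split: if_splits)
  qed
  then show ?thesis using strat_controller[OF q0] by blast
qed

text \<open>The inner product bounds the number of vertices: subsets of \<open>k\<close> clocks,
  sets of pairs of one of \<open>l\<close> locations and a set of atoms, and one bit. The layer
  around it comes from \<open>budget_bound\<close>, and the final 1 is added because replaying ticks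
  needs constants one above the budgets.\<close>

definition separation_bound :: "nat \<Rightarrow> nat \<Rightarrow> nat \<Rightarrow> nat \<Rightarrow> nat" where
  "separation_bound k n M l =
     k * ((2 ^ k * (2 ^ (l * 2 ^ (3 * ((n + k) * ((n + k) * (2 * M + 1))))) * 2)) * k ^ k * k + 1) + 1"

lemma km_separable_bounded:
  assumes sep: "km_separable k m Sig A B" and wf: "wf_ta Sig A" "wf_ta Sig B"
    and n: "clock_num A \<le> n" "clock_num B \<le> n" and M: "1 \<le> M" "consts_bounded M A" "consts_bounded M B"
    and l: "union_init A B \<subseteq> {..<l}" "\<And>p b g R q. (p, b, g, R, q) \<in> union_edges A B \<Longrightarrow> q < l"
  shows "km_separable k (separation_bound k n M l) Sig A B"
proof -
  let ?FA = "(\<lambda>q. 2 * q) ` set (final A)" and ?FB = "(\<lambda>q. 2 * q + 1) ` set (final B)"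
  interpret tick_game n k M "union_edges A B" "union_init A B" ?FA ?FB "{..<l}"
  proof
    fix p b g R q assume e: "(p, b, g, R, q) \<in> union_edges A B"
    then obtain X p' q' where X: "X = A \<or> X = B" "(p', b, g, R, q') \<in> set (trans X)"
      unfolding union_edges_def by blast
    have *: "wf_ta Sig X" "clock_num X \<le> n" "consts_bounded M X" using X(1) wf n M by auto
    have "(\<forall>x\<in>gclocks g. x < clock_num X) \<and> (\<forall>x\<in>set R. x < clock_num X)"
      using *(1) X(2) unfolding wf_ta_def by fast
    moreover have "\<forall>z\<in>gconsts g. \<bar>z\<bar> \<le> int M" using *(3) X(2) unfolding consts_bounded_def by fast
    ultimately show "(\<forall>x\<in>gclocks g. x < n) \<and> (\<forall>z\<in>gconsts g. \<bar>z\<bar> \<le> int M) \<and> (\<forall>x\<in>set R. x < n) \<and> q \<in> {..<l}"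
      using *(2) l(2)[OF e] by fastforce
  qed (use M l in auto)
  obtain Q :: "nat option set" and s0 \<delta> where c: "controller k m Q s0 \<delta>" "separating n A B s0 \<delta>"
    using km_separable_controller[OF sep wf n] by blast
  let ?K = "2 ^ k * (2 ^ (l * 2 ^ (3 * ((n + k) * ((n + k) * (2 * M + 1))))) * 2)"
  have "card vertices \<le> ?K"
    unfolding vertices_def using card_atom_space[of M "n + k"]
    by (simp add: card_cartesian_product card_Pow)
  moreover have "\<forall>s p u p' u'. p \<in> ?FA \<longrightarrow> p' \<in> ?FB \<longrightarrow> joint_reach n (union_edges A B) (union_init A B) s0 \<delta> p u s
        \<longrightarrow> \<not> joint_reach n (union_edges A B) (union_init A B) s0 \<delta> p' u' s"
    using c(2) unfolding separating_def by blast
  ultimately obtain Q' :: "nat tick_state set" and s0' \<delta>' where c': "controller k (separation_bound k n M l) Q' s0' \<delta>'"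
    and s': "\<forall>s p u p' u'. p \<in> ?FA \<longrightarrow> p' \<in> ?FB \<longrightarrow> joint_reach n (union_edges A B) (union_init A B) s0' \<delta>' p u s
        \<longrightarrow> \<not> joint_reach n (union_edges A B) (union_init A B) s0' \<delta>' p' u' s"
    using controller_bound[OF c(1)] unfolding separation_bound_def by (metis finite_lessThan)
  have "separating n A B s0' \<delta>'" unfolding separating_def using s' by blast
  then show ?thesis using controller_km_separable[OF c' _ wf n] by blast
qed

section \<open>An arithmetical certificate\<close>

definition dig :: "nat \<Rightarrow> nat \<Rightarrow> nat \<Rightarrow> nat" where
  "dig b U i = U div b ^ i mod b"

lemma dig_0 [simp]: "dig b 0 i = 0"
  by (simp add: dig_def)

lemma ex_digits:
  assumes "0 < b" "\<And>i. i < L \<Longrightarrow> p i < b"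
  shows "\<exists>U<b ^ L. \<forall>i<L. dig b U i = p i"
  using assms(2)
proof (induction L arbitrary: p)
  case (Suc L)
  obtain U where U: "U < b ^ L" "\<forall>i<L. dig b U i = p (Suc i)"
    using Suc.IH[of "\<lambda>i. p (Suc i)"] Suc.prems by auto
  have p0: "p 0 < b" using Suc.prems[of 0] by simp
  let ?U = "p 0 + b * U"
  have dv: "?U div b = U" using p0 assms(1) by simp
  have "Suc U \<le> b ^ L" using U(1) by simp
  then have "b * Suc U \<le> b * b ^ L" by (rule mult_le_mono2)
  then have "?U < b ^ Suc L" using p0 by simp
  moreover have "dig b ?U i = p i" if "i < Suc L" for i
  proof (cases i)
    case 0
    then show ?thesis using p0 by (simp add: dig_def)
  next
    case (Suc j)
    have "dig b ?U (Suc j) = dig b (?U div b) j" by (simp add: dig_def div_mult2_eq)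
    then show ?thesis using U(2) Suc that dv by simp
  qed
  ultimately show ?case by blast
qed simp

text \<open>The certificate states its initial condition for the vector code 0 only. Every code of
  the initial region has zero digits and so is covered.\<close>

lemma digits_0:
  assumes "0 < b" "U < b ^ L" "\<And>i. i < L \<Longrightarrow> dig b U i = 0"
  shows "U = 0"
  using assms(2,3)
proof (induction L arbitrary: U)
  case (Suc L)
  have "dig b (U div b) i = 0" if "i < L" for i
    using Suc.prems(2)[of "Suc i"] that by (simp add: dig_def div_mult2_eq)
  moreover have "U div b < b ^ L" using Suc.prems(1) assms(1) by (simp add: div_less_iff_less_mult mult.commute)
  ultimately have "U div b = 0" using Suc.IH by blast
  moreover have "U mod b = 0" using Suc.prems(2)[of 0] by (simp add: dig_def)
  ultimately show ?case by (metis add_0 mult_0_right mult_div_mod_eq)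
qed simp

text \<open>\<open>region_eq\<close> for grid points after multiplication by \<open>Dn\<close>. A
  constant \<open>- z\<close> moves to the other side of a difference; for single coordinates
  negative constants decide nothing, as grid points are nonnegative.\<close>

definition grid_eq :: "nat \<Rightarrow> nat \<Rightarrow> nat \<Rightarrow> (nat \<Rightarrow> nat) \<Rightarrow> (nat \<Rightarrow> nat) \<Rightarrow> bool" where
  "grid_eq M L Dn f f' \<longleftrightarrow> (\<forall>i<L. \<forall>j<L. \<forall>z<M + 1.
     (f i < z * Dn \<longleftrightarrow> f' i < z * Dn) \<and> (f i \<le> z * Dn \<longleftrightarrow> f' i \<le> z * Dn) \<and>
     (f i < f j + z * Dn \<longleftrightarrow> f' i < f' j + z * Dn) \<and> (f i + z * Dn < f j \<longleftrightarrow> f' i + z * Dn < f' j))"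

lemma grid_compare:
  assumes "0 < Dn"
  shows "grid Dn f i < of_int (int z) \<longleftrightarrow> f i < z * Dn" "grid Dn f i \<le> of_int (int z) \<longleftrightarrow> f i \<le> z * Dn"
    "grid Dn f i - grid Dn f j < of_int (int z) \<longleftrightarrow> f i < f j + z * Dn"
    "grid Dn f i - grid Dn f j < of_int (- int z) \<longleftrightarrow> f i + z * Dn < f j"
proof -
  have D: "0 < real Dn" using assms by simp
  have "grid Dn f i < of_int (int z) \<longleftrightarrow> real (f i) < real (z * Dn)"
    "grid Dn f i \<le> of_int (int z) \<longleftrightarrow> real (f i) \<le> real (z * Dn)"
    using D by (simp_all add: grid_def divide_simps)
  then show "grid Dn f i < of_int (int z) \<longleftrightarrow> f i < z * Dn" "grid Dn f i \<le> of_int (int z) \<longleftrightarrow> f i \<le> z * Dn"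
    unfolding of_nat_less_iff of_nat_le_iff .
  have "grid Dn f i - grid Dn f j < of_int (int z) \<longleftrightarrow> real (f i) < real (f j + z * Dn)"
    "grid Dn f i - grid Dn f j < of_int (- int z) \<longleftrightarrow> real (f i + z * Dn) < real (f j)"
    using D by (simp_all add: grid_def divide_simps algebra_simps)
  then show "grid Dn f i - grid Dn f j < of_int (int z) \<longleftrightarrow> f i < f j + z * Dn"
    "grid Dn f i - grid Dn f j < of_int (- int z) \<longleftrightarrow> f i + z * Dn < f j"
    unfolding of_nat_less_iff .
qed

lemma grid_nonneg: "0 \<le> grid Dn f i"
  by (simp add: grid_def)

lemma grid_eq_iff:
  assumes "0 < Dn"
  shows "grid_eq M L Dn f f' \<longleftrightarrow> region_eq M L (grid Dn f) (grid Dn f')"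
proof
  assume eq: "grid_eq M L Dn f f'"
  show "region_eq M L (grid Dn f) (grid Dn f')" unfolding region_eq_def
  proof (intro allI impI conjI)
    fix i z assume i: "i < L" and z: "\<bar>z\<bar> \<le> int M"
    define y where "y = nat \<bar>z\<bar>"
    have y: "y < M + 1" using z unfolding y_def by linarith
    note E = eq[unfolded grid_eq_def, rule_format, OF i _ y]
    have "(grid Dn f i < of_int z \<longleftrightarrow> grid Dn f' i < of_int z) \<and> (grid Dn f i \<le> of_int z \<longleftrightarrow> grid Dn f' i \<le> of_int z)"
    proof (cases "0 \<le> z")
      case True
      then have zy: "z = int y" by (simp add: y_def)
      show ?thesis unfolding zy grid_compare[OF assms] using E[OF i] by blast
    next
      case False
      then have "real_of_int z < 0" by simp
      then show ?thesis using grid_nonneg[of Dn f i] grid_nonneg[of Dn f' i] by linarith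
    qed
    then show "grid Dn f i < of_int z \<longleftrightarrow> grid Dn f' i < of_int z" "grid Dn f i \<le> of_int z \<longleftrightarrow> grid Dn f' i \<le> of_int z"
      by auto
    fix j assume j: "j < L"
    show "grid Dn f i - grid Dn f j < of_int z \<longleftrightarrow> grid Dn f' i - grid Dn f' j < of_int z"
    proof (cases "0 \<le> z")
      case True
      then have zy: "z = int y" by (simp add: y_def)
      show ?thesis unfolding zy grid_compare[OF assms] using E[OF j] by blast
    next
      case False
      then have zy: "z = - int y" by (simp add: y_def)
      show ?thesis unfolding zy grid_compare[OF assms] using E[OF j] by blast
    qed
  qed
next
  assume eq: "region_eq M L (grid Dn f) (grid Dn f')"
  show "grid_eq M L Dn f f'" unfolding grid_eq_def
  proof (intro allI impI)
    fix i j z assume i: "i < L" and j: "j < L" and z: "z < M + 1"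
    have z': "\<bar>int z\<bar> \<le> int M" "\<bar>- int z\<bar> \<le> int M" using z by auto
    show "(f i < z * Dn \<longleftrightarrow> f' i < z * Dn) \<and> (f i \<le> z * Dn \<longleftrightarrow> f' i \<le> z * Dn) \<and>
     (f i < f j + z * Dn \<longleftrightarrow> f' i < f' j + z * Dn) \<and> (f i + z * Dn < f j \<longleftrightarrow> f' i + z * Dn < f' j)"
      unfolding grid_compare[OF assms, symmetric]
      using region_eqD(1,2)[OF eq i z'(1)] region_eqD(3)[OF eq i z'(1) j] region_eqD(3)[OF eq i z'(2) j] by blast
  qed
qed

section \<open>Evaluation of coded guards at grid points\<close>

definition cmp_code :: "nat \<Rightarrow> nat \<Rightarrow> nat \<Rightarrow> bool" where
  "cmp_code c x y \<longleftrightarrow> c = 0 \<and> x < y \<or> c = 1 \<and> x \<le> y \<or> c = 2 \<and> x = y \<or> c = 3 \<and> y \<le> x \<or> c = 4 \<and> y < x"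

definition int_pos :: "nat \<Rightarrow> nat" where "int_pos z = (if even z then z div 2 else 0)"
definition int_neg :: "nat \<Rightarrow> nat" where "int_neg z = (if even z then 0 else z div 2 + 1)"

lemma int_pos_neg: "z = int (int_pos (int_encode z)) - int (int_neg (int_encode z))"
  by (auto simp: int_pos_def int_neg_def int_encode_def sum_encode_def)

lemma abs_le_int_encode: "\<bar>z\<bar> \<le> int (int_encode z)"
  by (auto simp: int_encode_def sum_encode_def)

text \<open>The constant is split into \<open>int_pos\<close> minus \<open>int_neg\<close>, one of
  which is 0, and each part is moved to the side where it is added, so that the comparison stays
  within the natural numbers. Guards on a single clock are the case \<open>y = 0\<close>.\<close>

lemma cmp_code_correct:
  assumes "0 < Dn"
  shows "cmp_code (enc_cmp c) (x + int_neg (int_encode z) * Dn) (y + int_pos (int_encode z) * Dn)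
    \<longleftrightarrow> cmp_sem c (real x / real Dn - real y / real Dn) (of_int z)"
proof -
  let ?p = "int_pos (int_encode z)" and ?q = "int_neg (int_encode z)"
  have D: "0 < real Dn" using assms by simp
  have z: "real_of_int z = real ?p - real ?q"
    using int_pos_neg[of z] by (metis of_int_diff of_int_of_nat_eq)
  have "real x / real Dn - real y / real Dn - of_int z = (real (x + ?q * Dn) - real (y + ?p * Dn)) / real Dn"
    unfolding z using D by (simp add: field_simps)
  moreover have "a - b = d / r \<Longrightarrow> 0 < r \<Longrightarrow> (a < b \<longleftrightarrow> d < 0) \<and> (a \<le> b \<longleftrightarrow> d \<le> 0) \<and> (a = b \<longleftrightarrow> d = 0)" for a b d r :: real
    by (smt (verit) divide_less_0_iff divide_nonneg_pos divide_eq_0_iff)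
  ultimately have *: "(real x / real Dn - real y / real Dn < of_int z \<longleftrightarrow> real (x + ?q * Dn) < real (y + ?p * Dn)) \<and>
    (real x / real Dn - real y / real Dn \<le> of_int z \<longleftrightarrow> real (x + ?q * Dn) \<le> real (y + ?p * Dn)) \<and>
    (real x / real Dn - real y / real Dn = of_int z \<longleftrightarrow> real (x + ?q * Dn) = real (y + ?p * Dn))"
    using D by (metis (no_types, lifting) diff_gt_0_iff_gt diff_less_0_iff_less diff_le_0_iff_le right_minus_eq)
  then show ?thesis unfolding of_nat_less_iff of_nat_le_iff of_nat_eq_iff
    by (cases c) (auto simp: cmp_code_def)
qed

text \<open>The local condition on bit \<open>h\<close> of a truth table. The tags are those of
  \<open>enc_guard\<close>; any other tag counts as false, so that every number has a truth value
  and not only codes of guards.\<close>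

definition guard_step :: "nat \<Rightarrow> nat \<Rightarrow> nat \<Rightarrow> nat \<Rightarrow> nat \<Rightarrow> bool" where
  "guard_step Dn b U h t \<longleftrightarrow> pfst h = 0
     \<or> pfst h = 1 \<and> cmp_code (list_nth (psnd h) 1)
         (dig b U (list_nth (psnd h) 0) + int_neg (list_nth (psnd h) 2) * Dn) (0 + int_pos (list_nth (psnd h) 2) * Dn)
     \<or> pfst h = 2 \<and> cmp_code (list_nth (psnd h) 2)
         (dig b U (list_nth (psnd h) 0) + int_neg (list_nth (psnd h) 3) * Dn)
         (dig b U (list_nth (psnd h) 1) + int_pos (list_nth (psnd h) 3) * Dn)
     \<or> pfst h = 3 \<and> psnd h \<notin> set_decode t
     \<or> pfst h = 4 \<and> pfst (psnd h) \<in> set_decode t \<and> psnd (psnd h) \<in> set_decode t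
     \<or> pfst h = 5 \<and> (pfst (psnd h) \<in> set_decode t \<or> psnd (psnd h) \<in> set_decode t)"

text \<open>The bits of \<open>t\<close> are the truth values of all guards with code at most \<open>g\<close>.\<close>

definition guard_code :: "nat \<Rightarrow> nat \<Rightarrow> nat \<Rightarrow> nat \<Rightarrow> bool" where
  "guard_code Dn b U g \<longleftrightarrow> (\<exists>t<2 ^ (g + 1). (\<forall>h<g + 1. h \<in> set_decode t \<longleftrightarrow> guard_step Dn b U h t) \<and> g \<in> set_decode t)"

lemma pfst_le: "pfst h \<le> h"
  by (metis le_prod_encode_1 pfst_def prod.collapse prod_decode_inverse)

lemma psnd_le: "psnd h \<le> h"
  by (metis le_prod_encode_2 psnd_def prod.collapse prod_decode_inverse)

lemma psnd_less: "pfst h \<noteq> 0 \<Longrightarrow> psnd h < h"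
proof -
  assume a: "pfst h \<noteq> 0"
  have "h = prod_encode (pfst h, psnd h)" by (simp add: pfst_def psnd_def)
  then have "h = triangle (pfst h + psnd h) + pfst h" by (simp add: prod_encode_def)
  then show ?thesis using le_triangle[of "pfst h + psnd h"] a by linarith
qed

lemma guard_step_cong:
  assumes "\<And>i. i < h \<Longrightarrow> i \<in> set_decode t \<longleftrightarrow> i \<in> set_decode t'"
  shows "guard_step Dn b U h t \<longleftrightarrow> guard_step Dn b U h t'"
proof (cases "pfst h = 0")
  case False
  then have "psnd h < h" by (rule psnd_less)
  moreover from this have "pfst (psnd h) < h" "psnd (psnd h) < h"
    using pfst_le[of "psnd h"] psnd_le[of "psnd h"] by linarith+
  ultimately show ?thesis unfolding guard_step_def using assms by simp
qed (simp add: guard_step_def)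

lemma set_encode_less:
  assumes "X \<subseteq> {..<n}" shows "set_encode X < 2 ^ n"
proof -
  have "set_encode X \<le> set_encode {..<n}"
    unfolding set_encode_def using assms by (intro sum_mono2) auto
  also have "\<dots> < 2 ^ n" unfolding set_encode_def by (induction n) (auto simp: lessThan_Suc)
  finally show ?thesis .
qed

lemma set_decode_subset: "t < 2 ^ n \<Longrightarrow> set_decode t \<subseteq> {..<n}"
proof
  fix x assume t: "t < 2 ^ n" and x: "x \<in> set_decode t"
  show "x \<in> {..<n}"
  proof (rule ccontr)
    assume "x \<notin> {..<n}"
    then have "(2::nat) ^ n \<le> 2 ^ x" by simp
    then have "t < 2 ^ x" using t by linarith
    then have "t div 2 ^ x = 0" by simp
    then show False using x by (simp add: set_decode_def)
  qed
qed

text \<open>With a nonzero tag, bit \<open>h\<close> depends on smaller bits only, since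
  \<open>psnd h < h\<close>. The table is filled from below, and setting bit \<open>g\<close> does
  not disturb the earlier ones.\<close>

lemma ex_truth_table: "\<exists>X\<subseteq>{..<g}. \<forall>h<g. h \<in> X \<longleftrightarrow> guard_step Dn b U h (set_encode X)"
proof (induction g)
  case (Suc g)
  then obtain X where X: "X \<subseteq> {..<g}" "\<And>h. h < g \<Longrightarrow> h \<in> X \<longleftrightarrow> guard_step Dn b U h (set_encode X)" by blast
  have finX: "finite X" using X(1) by (rule finite_subset) simp
  define X' where "X' = (if guard_step Dn b U g (set_encode X) then insert g X else X)"
  have finX': "finite X'" using finX by (simp add: X'_def)
  have same: "i \<in> X' \<longleftrightarrow> i \<in> X" if "i < g" for i using that by (auto simp: X'_def)
  have "h \<in> X' \<longleftrightarrow> guard_step Dn b U h (set_encode X')" if "h < Suc g" for h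
  proof -
    have "guard_step Dn b U h (set_encode X') \<longleftrightarrow> guard_step Dn b U h (set_encode X)"
      using that same finX finX' by (intro guard_step_cong) simp
    moreover have "g \<notin> X" using X(1) by auto
    ultimately show ?thesis using that X(2) same unfolding X'_def by (cases "h = g") auto
  qed
  moreover have "X' \<subseteq> {..<Suc g}" using X(1) by (auto simp: X'_def)
  ultimately show ?case by blast
qed simp

lemma guard_code_correct:
  assumes "0 < Dn"
  shows "guard_code Dn b U (enc_guard g) \<longleftrightarrow> gsat g (grid Dn (dig b U))"
proof -
  \<comment> \<open>Any table that satisfies the local conditions is correct on genuine guards, so
    it does not matter which one the existential quantifier picks.\<close>
  have truth: "enc_guard g \<in> set_decode t \<longleftrightarrow> gsat g (grid Dn (dig b U))"
    if t: "\<And>h. h < Suc (enc_guard g) \<Longrightarrow> h \<in> set_decode t \<longleftrightarrow> guard_step Dn b U h t" for t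
    using t
  proof (induction g)
    case GTrue
    then show ?case by (simp add: guard_step_def)
  next
    case (GAtom x c z)
    then show ?case using cmp_code_correct[OF assms, of c "dig b U x" z 0]
      by (simp add: guard_step_def grid_def del: list_encode.simps)
  next
    case (GDiff x y c z)
    then show ?case using cmp_code_correct[OF assms, of c "dig b U x" z "dig b U y"]
      by (simp add: guard_step_def grid_def del: list_encode.simps)
  next
    case (GNot g)
    have "enc_guard g \<le> enc_guard (GNot g)" using le_prod_encode_2[of "enc_guard g" 3] by simp
    then have "enc_guard g \<in> set_decode t \<longleftrightarrow> gsat g (grid Dn (dig b U))" by (intro GNot.IH GNot.prems) linarith
    then show ?case using GNot.prems[of "enc_guard (GNot g)"] by (simp add: guard_step_def)
  next
    case (GAnd g h)
    have "enc_guard g \<le> enc_guard (GAnd g h)" "enc_guard h \<le> enc_guard (GAnd g h)"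
      using le_prod_encode_2[of "prod_encode (enc_guard g, enc_guard h)" 4]
        le_prod_encode_1[of "enc_guard g" "enc_guard h"] le_prod_encode_2[of "enc_guard h" "enc_guard g"] by simp_all
    then have "enc_guard g \<in> set_decode t \<longleftrightarrow> gsat g (grid Dn (dig b U))"
      "enc_guard h \<in> set_decode t \<longleftrightarrow> gsat h (grid Dn (dig b U))"
      by (intro GAnd.IH GAnd.prems, linarith)+
    then show ?case using GAnd.prems[of "enc_guard (GAnd g h)"] by (simp add: guard_step_def)
  next
    case (GOr g h)
    have "enc_guard g \<le> enc_guard (GOr g h)" "enc_guard h \<le> enc_guard (GOr g h)"
      using le_prod_encode_2[of "prod_encode (enc_guard g, enc_guard h)" 5]
        le_prod_encode_1[of "enc_guard g" "enc_guard h"] le_prod_encode_2[of "enc_guard h" "enc_guard g"] by simp_all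
    then have "enc_guard g \<in> set_decode t \<longleftrightarrow> gsat g (grid Dn (dig b U))"
      "enc_guard h \<in> set_decode t \<longleftrightarrow> gsat h (grid Dn (dig b U))"
      by (intro GOr.IH GOr.prems, linarith)+
    then show ?case using GOr.prems[of "enc_guard (GOr g h)"] by (simp add: guard_step_def)
  qed
  show ?thesis
  proof
    assume "guard_code Dn b U (enc_guard g)"
    then obtain t where "\<forall>h<enc_guard g + 1. h \<in> set_decode t \<longleftrightarrow> guard_step Dn b U h t" "enc_guard g \<in> set_decode t"
      unfolding guard_code_def by blast
    then show "gsat g (grid Dn (dig b U))" using truth[of t] by simp
  next
    assume a: "gsat g (grid Dn (dig b U))"
    obtain X where X: "X \<subseteq> {..<enc_guard g + 1}"
      "\<And>h. h < enc_guard g + 1 \<Longrightarrow> h \<in> X \<longleftrightarrow> guard_step Dn b U h (set_encode X)"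
      using ex_truth_table[of "enc_guard g + 1" Dn b U] by blast
    have "finite X" using X(1) by (rule finite_subset) simp
    then have dec: "set_decode (set_encode X) = X" by simp
    have "enc_guard g \<in> set_decode (set_encode X)" using truth[of "set_encode X"] X(2) a unfolding dec by simp
    then show "guard_code Dn b U (enc_guard g)" unfolding guard_code_def
      using set_encode_less[OF X(1)] X(2) dec by (intro exI[of _ "set_encode X"]) simp
  qed
qed

text \<open>All parameters of the certificate are crude functions of the code \<open>e\<close> of the instance, which
  exceeds every number occurring in it: \<open>e\<close> clocks are reserved for the two given automata.\<close>

definition cert_den :: "nat \<Rightarrow> nat \<Rightarrow> nat" where "cert_den k e = e + k + 2"
definition cert_max :: "nat \<Rightarrow> nat \<Rightarrow> nat" where "cert_max m e = e + m + 1"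
definition cert_base :: "nat \<Rightarrow> nat \<Rightarrow> nat \<Rightarrow> nat" where
  "cert_base k m e = (Suc (e + k) * (cert_max m e + 1) + 1) * cert_den k e + 1"
definition cert_vecs :: "nat \<Rightarrow> nat \<Rightarrow> nat \<Rightarrow> nat" where "cert_vecs k m e = cert_base k m e ^ (e + k)"
definition cert_size :: "nat \<Rightarrow> nat \<Rightarrow> nat \<Rightarrow> nat" where
  "cert_size k m e = prod_encode (2 * e + 2, cert_vecs k m e)"

definition moved :: "nat \<Rightarrow> nat \<Rightarrow> nat \<Rightarrow> nat \<Rightarrow> nat \<Rightarrow> nat \<Rightarrow> nat \<Rightarrow> nat \<Rightarrow> nat" where
  "moved k m e R y d U i =
     (if list_mem i R \<or> e \<le> i \<and> i - e \<in> set_decode y then 0 else dig (cert_base k m e) U i + d)"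

text \<open>After a delay the coordinates may leave the range of digits, so the result is
  represented by any \<open>U'\<close> in the same region.\<close>

definition near :: "nat \<Rightarrow> nat \<Rightarrow> nat \<Rightarrow> nat \<Rightarrow> nat \<Rightarrow> nat \<Rightarrow> nat \<Rightarrow> nat \<Rightarrow> bool" where
  "near k m e R y d U U' \<longleftrightarrow>
     grid_eq (cert_max m e) (e + k) (cert_den k e) (moved k m e R y d U) (dig (cert_base k m e) U')"

definition same_obs :: "nat \<Rightarrow> nat \<Rightarrow> nat \<Rightarrow> nat \<Rightarrow> nat \<Rightarrow> bool" where
  "same_obs k m e U V \<longleftrightarrow> grid_eq m k (cert_den k e)
     (\<lambda>x. dig (cert_base k m e) U (e + x)) (\<lambda>x. dig (cert_base k m e) V (e + x))"

definition aut_part :: "nat \<Rightarrow> nat \<Rightarrow> nat \<Rightarrow> nat" where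
  "aut_part e i j = list_nth (list_nth e (1 + i)) j"

text \<open>A controller state is represented by the set \<open>D\<close> of codes
  \<open>prod_encode (l, U)\<close> reached with it. Quantifiers over transition codes and final
  locations stop at \<open>e\<close> because these numbers are smaller than the code of the
  instance; \<open>i\<close> selects the automaton, and \<open>2 * q + i\<close> is its location
  \<open>q\<close> in the union.\<close>

definition closed_set :: "nat \<Rightarrow> nat \<Rightarrow> nat \<Rightarrow> nat \<Rightarrow> bool" where
  "closed_set k m e D \<longleftrightarrow>
     (\<forall>l<2 * e + 2. \<forall>U<cert_vecs k m e. \<forall>d<cert_base k m e. \<forall>U'<cert_vecs k m e.
        prod_encode (l, U) \<in> set_decode D \<and> near k m e 0 0 d U U' \<longrightarrow> prod_encode (l, U') \<in> set_decode D) \<and>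
     (\<forall>i<2. \<forall>t<e. \<forall>U<cert_vecs k m e. \<forall>U'<cert_vecs k m e.
        list_mem t (aut_part e i 3) \<and> list_nth t 1 = 0 \<and> prod_encode (2 * list_nth t 0 + i, U) \<in> set_decode D \<and>
        guard_code (cert_den k e) (cert_base k m e) U (list_nth t 2) \<and> near k m e (list_nth t 3) 0 0 U U'
        \<longrightarrow> prod_encode (2 * list_nth t 4 + i, U') \<in> set_decode D) \<and>
     (\<forall>q<e. \<forall>U<cert_vecs k m e. \<forall>q'<e. \<forall>U'<cert_vecs k m e.
        \<not> (list_mem q (aut_part e 0 2) \<and> list_mem q' (aut_part e 1 2) \<and>
           prod_encode (2 * q, U) \<in> set_decode D \<and> prod_encode (2 * q' + 1, U') \<in> set_decode D))"

text \<open>\<open>V\<close> stands for the observed region: only its digits from \<open>e\<close>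
  on, those of the controller clocks, are compared. The bits of \<open>y\<close> are the clocks to
  reset.\<close>

definition succ_set :: "nat \<Rightarrow> nat \<Rightarrow> nat \<Rightarrow> nat \<Rightarrow> nat \<Rightarrow> nat \<Rightarrow> nat \<Rightarrow> nat \<Rightarrow> bool" where
  "succ_set k m e D a V y D' \<longleftrightarrow>
     (\<forall>i<2. \<forall>t<e. \<forall>U<cert_vecs k m e. \<forall>U'<cert_vecs k m e.
        list_mem t (aut_part e i 3) \<and> list_nth t 1 = Suc a \<and> prod_encode (2 * list_nth t 0 + i, U) \<in> set_decode D \<and>
        guard_code (cert_den k e) (cert_base k m e) U (list_nth t 2) \<and> same_obs k m e U V \<and>
        near k m e (list_nth t 3) y 0 U U'
        \<longrightarrow> prod_encode (2 * list_nth t 4 + i, U') \<in> set_decode D')"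

text \<open>\<open>W\<close> codes the set of controller states, each of them the code of a set,
  hence the double exponential bound. For every state, letter and observation some answer and
  successor within \<open>W\<close> must exist; choosing one each time yields a controller.\<close>

definition sep_code :: "nat \<Rightarrow> nat \<Rightarrow> nat \<Rightarrow> bool" where
  "sep_code k m e \<longleftrightarrow> (\<exists>W<2 ^ (2 ^ cert_size k m e).
     (\<exists>D<2 ^ cert_size k m e. D \<in> set_decode W \<and>
        (\<forall>i<2. \<forall>q<e. list_mem q (aut_part e i 1) \<longrightarrow> prod_encode (2 * q + i, 0) \<in> set_decode D)) \<and>
     (\<forall>D<2 ^ cert_size k m e. D \<in> set_decode W \<longrightarrow> closed_set k m e D \<and>
        (\<forall>a<e. list_mem a (list_nth e 0) \<longrightarrow> (\<forall>V<cert_vecs k m e. \<exists>y<2 ^ k. \<exists>D'<2 ^ cert_size k m e.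
           D' \<in> set_decode W \<and> succ_set k m e D a V y D'))))"

lemma recursive1_dig [recursive_intros]:
  assumes "recursive1 b" "recursive1 U" "recursive1 i" shows "recursive1 (\<lambda>x. dig (b x) (U x) (i x))"
  unfolding dig_def by (intro recursive_intros assms)

lemma recursive1_cert_den [recursive_intros]:
  assumes "recursive1 k" "recursive1 e" shows "recursive1 (\<lambda>x. cert_den (k x) (e x))"
  unfolding cert_den_def by (intro recursive_intros assms)

lemma recursive1_cert_max [recursive_intros]:
  assumes "recursive1 m" "recursive1 e" shows "recursive1 (\<lambda>x. cert_max (m x) (e x))"
  unfolding cert_max_def by (intro recursive_intros assms)

lemma recursive1_cert [recursive_intros]:
  assumes "recursive1 k" "recursive1 m" "recursive1 e"
  shows "recursive1 (\<lambda>x. cert_base (k x) (m x) (e x))" "recursive1 (\<lambda>x. cert_vecs (k x) (m x) (e x))"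
    "recursive1 (\<lambda>x. cert_size (k x) (m x) (e x))"
  unfolding cert_size_def cert_vecs_def cert_base_def by (intro recursive_intros assms)+

lemma recursive1_moved [recursive_intros]:
  assumes "recursive1 k" "recursive1 m" "recursive1 e" "recursive1 R" "recursive1 y" "recursive1 d" "recursive1 U" "recursive1 i"
  shows "recursive1 (\<lambda>x. moved (k x) (m x) (e x) (R x) (y x) (d x) (U x) (i x))"
  unfolding moved_def by (intro recursive_intros assms)

lemma recursive_pred_near [recursive_intros]:
  assumes "recursive1 k" "recursive1 m" "recursive1 e" "recursive1 R" "recursive1 y" "recursive1 d" "recursive1 U" "recursive1 U'"
  shows "recursive_pred (\<lambda>x. near (k x) (m x) (e x) (R x) (y x) (d x) (U x) (U' x))"
  unfolding near_def grid_eq_def by (intro recursive_intros assms assms[THEN recursive1_comp1])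

lemma recursive_pred_same_obs [recursive_intros]:
  assumes "recursive1 k" "recursive1 m" "recursive1 e" "recursive1 U" "recursive1 V"
  shows "recursive_pred (\<lambda>x. same_obs (k x) (m x) (e x) (U x) (V x))"
  unfolding same_obs_def grid_eq_def by (intro recursive_intros assms assms[THEN recursive1_comp1])

lemma recursive1_aut_part [recursive_intros]:
  assumes "recursive1 e" "recursive1 i" "recursive1 j" shows "recursive1 (\<lambda>x. aut_part (e x) (i x) (j x))"
  unfolding aut_part_def by (intro recursive_intros assms)

lemma recursive_pred_guard_code [recursive_intros]:
  assumes "recursive1 d" "recursive1 b" "recursive1 U" "recursive1 g"
  shows "recursive_pred (\<lambda>x. guard_code (d x) (b x) (U x) (g x))"
  unfolding guard_code_def guard_step_def cmp_code_def int_pos_def int_neg_def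
  by (intro recursive_intros assms assms[THEN recursive1_comp1])

lemma recursive_pred_closed_set [recursive_intros]:
  assumes "recursive1 k" "recursive1 m" "recursive1 e" "recursive1 D"
  shows "recursive_pred (\<lambda>x. closed_set (k x) (m x) (e x) (D x))"
  unfolding closed_set_def by (intro recursive_intros assms assms[THEN recursive1_comp1])

lemma recursive_pred_succ_set [recursive_intros]:
  assumes "recursive1 k" "recursive1 m" "recursive1 e" "recursive1 D" "recursive1 a" "recursive1 V" "recursive1 y" "recursive1 D'"
  shows "recursive_pred (\<lambda>x. succ_set (k x) (m x) (e x) (D x) (a x) (V x) (y x) (D' x))"
  unfolding succ_set_def by (intro recursive_intros assms assms[THEN recursive1_comp1])

lemma recursive_pred_sep_code:
  assumes "recursive1 k" "recursive1 m" "recursive1 e"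
  shows "recursive_pred (\<lambda>x. sep_code (k x) (m x) (e x))"
  unfolding sep_code_def by (intro recursive_intros assms assms[THEN recursive1_comp1])

lemma recursive1_separation_bound [recursive_intros]:
  assumes "recursive1 k" "recursive1 n" "recursive1 M" "recursive1 l"
  shows "recursive1 (\<lambda>x. separation_bound (k x) (n x) (M x) (l x))"
  unfolding separation_bound_def by (intro recursive_intros assms)

section \<open>Correctness of the certificate on coded instances\<close>

lemma abs_const_le_enc_guard: "z \<in> gconsts g \<Longrightarrow> \<bar>z\<bar> \<le> int (enc_guard g)"
proof (induction g)
  case (GAtom x c y)
  have "int_encode y < list_encode [x, enc_cmp c, int_encode y]" by (rule mem_less_list_encode) simp
  also have "\<dots> \<le> enc_guard (GAtom x c y)" using le_prod_encode_2 by (simp del: list_encode.simps)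
  finally show ?case using GAtom abs_le_int_encode[of y] by simp
next
  case (GDiff x x' c y)
  have "int_encode y < list_encode [x, x', enc_cmp c, int_encode y]" by (rule mem_less_list_encode) simp
  also have "\<dots> \<le> enc_guard (GDiff x x' c y)" using le_prod_encode_2 by (simp del: list_encode.simps)
  finally show ?case using GDiff abs_le_int_encode[of y] by simp
next
  case (GNot g)
  then show ?case using le_prod_encode_2[of "enc_guard g" 3] by simp
next
  case (GAnd g h)
  then show ?case
    using le_prod_encode_2[of "prod_encode (enc_guard g, enc_guard h)" 4]
      le_prod_encode_1[of "enc_guard g" "enc_guard h"] le_prod_encode_2[of "enc_guard h" "enc_guard g"] by auto
next
  case (GOr g h)
  then show ?case
    using le_prod_encode_2[of "prod_encode (enc_guard g, enc_guard h)" 5]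
      le_prod_encode_1[of "enc_guard g" "enc_guard h"] le_prod_encode_2[of "enc_guard h" "enc_guard g"] by auto
qed simp

lemma prod_encode_less: "a < a' \<Longrightarrow> b \<le> b' \<Longrightarrow> prod_encode (a, b) < prod_encode (a', b')"
  unfolding prod_encode_def using triangle_mono[of "a + b" "a' + b'"] by simp

locale coded_instance =
  fixes Sig :: "nat list" and A B :: ta and e :: nat
  assumes wfA: "wf_ta Sig A" and wfB: "wf_ta Sig B" and e_def: "e = enc_instance (Sig, A, B)"
begin

definition pick :: "nat \<Rightarrow> ta" where "pick i = (if i = 0 then A else B)"

lemma code_parts:
  "list_nth e 0 = list_encode Sig"
  "i < 2 \<Longrightarrow> list_nth e (1 + i) = enc_ta (pick i)"
  "i < 2 \<Longrightarrow> enc_ta (pick i) < e" "list_encode Sig < e"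
proof -
  have e: "e = list_encode [list_encode Sig, enc_ta A, enc_ta B]" by (simp add: e_def enc_instance_def)
  show "list_nth e 0 = list_encode Sig" unfolding e by (simp del: list_encode.simps)
  show "list_encode Sig < e" unfolding e by (rule mem_less_list_encode) simp
  assume "i < 2"
  then consider "i = 0" | "i = 1" by linarith
  then show "list_nth e (1 + i) = enc_ta (pick i)"
    unfolding e pick_def by cases (simp_all del: list_encode.simps)
  show "enc_ta (pick i) < e" unfolding e pick_def by (rule mem_less_list_encode) simp
qed

lemma aut_parts:
  assumes "i < 2"
  shows "aut_part e i 1 = list_encode (initial (pick i))" "aut_part e i 2 = list_encode (final (pick i))"
    "aut_part e i 3 = list_encode (map enc_trans (trans (pick i)))"
    "clock_num (pick i) < e" "q \<in> set (initial (pick i)) \<Longrightarrow> q < e" "q \<in> set (final (pick i)) \<Longrightarrow> q < e"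
    "\<tau> \<in> set (trans (pick i)) \<Longrightarrow> enc_trans \<tau> < e"
proof -
  show "aut_part e i 1 = list_encode (initial (pick i))" "aut_part e i 2 = list_encode (final (pick i))"
    "aut_part e i 3 = list_encode (map enc_trans (trans (pick i)))"
    unfolding aut_part_def code_parts(2)[OF assms] enc_ta_def by (simp_all del: list_encode.simps)
  have lt: "x < e" if "x \<in> set [clock_num (pick i), list_encode (initial (pick i)), list_encode (final (pick i)),
      list_encode (map enc_trans (trans (pick i)))]" for x
    using mem_less_list_encode[OF that] code_parts(3)[OF assms] unfolding enc_ta_def by linarith
  show "clock_num (pick i) < e" by (rule lt) simp
  show "q < e" if "q \<in> set (initial (pick i))"
    using mem_less_list_encode[OF that] lt[of "list_encode (initial (pick i))"] by simp
  show "q < e" if "q \<in> set (final (pick i))"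
    using mem_less_list_encode[OF that] lt[of "list_encode (final (pick i))"] by simp
  show "enc_trans \<tau> < e" if \<tau>: "\<tau> \<in> set (trans (pick i))"
  proof -
    have "enc_trans \<tau> \<in> set (map enc_trans (trans (pick i)))" using \<tau> by simp
    from mem_less_list_encode[OF this] show ?thesis
      using lt[of "list_encode (map enc_trans (trans (pick i)))"] by simp
  qed
qed

lemma trans_parts:
  "list_nth (enc_trans (q, b, g, R, q')) 0 = q" "list_nth (enc_trans (q, b, g, R, q')) 1 = enc_opt b"
  "list_nth (enc_trans (q, b, g, R, q')) 2 = enc_guard g" "list_nth (enc_trans (q, b, g, R, q')) 3 = list_encode R"
  "list_nth (enc_trans (q, b, g, R, q')) 4 = q'"
  by (simp_all del: list_encode.simps)

lemma trans_less:
  assumes "i < 2" "(q, b, g, R, q') \<in> set (trans (pick i))"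
  shows "q' < e" "enc_guard g < e"
proof -
  have "x < e" if "x \<in> set [q, enc_opt b, enc_guard g, list_encode R, q']" for x
    using mem_less_list_encode[OF that] aut_parts(7)[OF assms] by (simp del: list_encode.simps)
  then show "q' < e" "enc_guard g < e" by simp_all
qed

lemma union_edges_iff:
  "(l, b, g, R, l') \<in> union_edges A B \<longleftrightarrow>
     (\<exists>i<2. \<exists>q q'. l = 2 * q + i \<and> l' = 2 * q' + i \<and> (q, b, g, R, q') \<in> set (trans (pick i)))"
proof -
  have "(\<exists>i<2. P i) \<longleftrightarrow> P 0 \<or> P 1" for P :: "nat \<Rightarrow> bool"
    by (auto simp: less_2_cases_iff)
  then show ?thesis unfolding union_edges_def pick_def by auto
qed

lemma union_init_iff: "l \<in> union_init A B \<longleftrightarrow> (\<exists>i<2. \<exists>q. l = 2 * q + i \<and> q \<in> set (initial (pick i)))"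
proof -
  have "(\<exists>i<2. P i) \<longleftrightarrow> P 0 \<or> P 1" for P :: "nat \<Rightarrow> bool"
    by (auto simp: less_2_cases_iff)
  then show ?thesis unfolding union_init_def pick_def by auto
qed

lemma wf_pick: "wf_ta Sig (pick i)"
  unfolding pick_def using wfA wfB by simp

lemma edge_props:
  assumes "(l, b, g, R, l') \<in> union_edges A B"
  shows "\<forall>x\<in>gclocks g. x < e" "\<forall>z\<in>gconsts g. \<bar>z\<bar> \<le> int e" "\<forall>x\<in>set R. x < e" "l' < 2 * e + 2"
    "\<And>a. b = Some a \<Longrightarrow> a \<in> set Sig"
proof -
  obtain i q q' where i: "i < 2" "l' = 2 * q' + i" "(q, b, g, R, q') \<in> set (trans (pick i))"
    using assms unfolding union_edges_iff by blast
  have w: "(\<forall>a. b = Some a \<longrightarrow> a \<in> set Sig) \<and> (\<forall>x\<in>gclocks g. x < clock_num (pick i)) \<and> (\<forall>x\<in>set R. x < clock_num (pick i))"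
    using wf_pick[of i] i(3) unfolding wf_ta_def by fast
  have c: "clock_num (pick i) < e" using aut_parts(4)[OF i(1)] .
  show "\<forall>x\<in>gclocks g. x < e" "\<forall>x\<in>set R. x < e" using w c by (meson order_less_trans)+
  show "\<And>a. b = Some a \<Longrightarrow> a \<in> set Sig" using w by blast
  show "l' < 2 * e + 2" using trans_less(1)[OF i(1,3)] i(1,2) by simp
  show "\<forall>z\<in>gconsts g. \<bar>z\<bar> \<le> int e"
  proof
    fix z assume "z \<in> gconsts g"
    from abs_const_le_enc_guard[OF this] show "\<bar>z\<bar> \<le> int e" using trans_less(2)[OF i(1,3)] by linarith
  qed
qed

context
  fixes k m :: nat
begin

abbreviation "den \<equiv> cert_den k e"
abbreviation "bs \<equiv> cert_base k m e"
abbreviation "vecs \<equiv> cert_vecs k m e"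
abbreviation "mx \<equiv> cert_max m e"
abbreviation "gv U \<equiv> grid den (dig bs U)"

lemma den_pos: "0 < den" and bs_pos: "0 < bs"
  by (simp_all add: cert_den_def cert_base_def)

lemma near_iff:
  "near k m e (list_encode R) y d U U' \<longleftrightarrow>
     region_eq mx (e + k) (resets (set R \<union> (+) e ` set_decode y) (\<lambda>i. gv U i + real d / real den)) (gv U')"
proof -
  have "grid den (moved k m e (list_encode R) y d U) = resets (set R \<union> (+) e ` set_decode y) (\<lambda>i. gv U i + real d / real den)"
  proof
    fix i
    have "i \<in> (+) e ` set_decode y \<longleftrightarrow> e \<le> i \<and> i - e \<in> set_decode y"
      by (auto simp: image_iff) (metis le_add_diff_inverse)
    then show "grid den (moved k m e (list_encode R) y d U) i = resets (set R \<union> (+) e ` set_decode y) (\<lambda>i. gv U i + real d / real den) i"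
      unfolding grid_def moved_def resets_def by (simp add: add_divide_distrib)
  qed
  then show ?thesis unfolding near_def grid_eq_iff[OF den_pos] by simp
qed

lemma near_delay_iff: "near k m e 0 0 d U U' \<longleftrightarrow> region_eq mx (e + k) (\<lambda>i. gv U i + real d / real den) (gv U')"
  using near_iff[of "[]" 0 d U U'] by (simp add: resets_def)

lemma near_resets_iff:
  "near k m e (list_encode R) y 0 U U' \<longleftrightarrow> region_eq mx (e + k) (resets (set R \<union> (+) e ` set_decode y) (gv U)) (gv U')"
  using near_iff[of R y 0 U U'] by simp

lemma same_obs_iff: "same_obs k m e U V \<longleftrightarrow> region_eq m k (\<lambda>x. gv U (e + x)) (\<lambda>x. gv V (e + x))"
  unfolding same_obs_def grid_eq_iff[OF den_pos] by (simp add: grid_def)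

lemma representative_delay:
  assumes "\<And>i. 0 \<le> u i" "0 \<le> d"
  obtains U d' where "U < vecs" "d' < bs" "region_eq mx (e + k) u (gv U)"
    "region_eq mx (e + k) (\<lambda>i. u i + d) (\<lambda>i. gv U i + real d' / real den)"
proof -
  \<comment> \<open>The parameters are made for this: \<open>cert_den\<close> exceeds
    \<open>e + k + 1\<close> as the grid requires, and \<open>cert_base\<close> is one more than the
    bound on coordinates and delay.\<close>
  have "Suc (e + k) < den" by (simp add: cert_den_def)
  from region_grid_delay[of "e + k" u d den mx, OF assms(1) assms(2) this]
  obtain p d' where p: "region_eq mx (e + k) u (grid den p)" "region_eq mx (e + k) (\<lambda>i. u i + d) (grid den (\<lambda>i. p i + d'))"
    "\<And>i. p i < bs" "d' < bs" unfolding cert_base_def by (auto simp: less_Suc_eq_le)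
  obtain U where U: "U < vecs" "\<And>i. i < e + k \<Longrightarrow> dig bs U i = p i"
    using ex_digits[OF bs_pos, of "e + k" p] p(3) unfolding cert_vecs_def by blast
  have "region_eq mx (e + k) (grid den p) (gv U)" by (rule region_eq_cong) (simp add: grid_def U(2))
  moreover have "region_eq mx (e + k) (grid den (\<lambda>i. p i + d')) (\<lambda>i. gv U i + real d' / real den)"
    by (rule region_eq_cong) (simp add: grid_def U(2) add_divide_distrib)
  ultimately show ?thesis using that[OF U(1) p(4)] p(1,2) region_eq_trans by blast
qed

lemma representative:
  assumes "\<And>i. 0 \<le> u i"
  obtains U where "U < vecs" "region_eq mx (e + k) u (gv U)"
  using representative_delay[of u 0, OF assms] by auto

lemma gsat_edge:
  assumes "(l, b, g, R, l') \<in> union_edges A B" "region_eq mx (e + k) u (gv U)"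
  shows "gsat g u \<longleftrightarrow> guard_code den bs U (enc_guard g)"
proof -
  have "gsat g u \<longleftrightarrow> gsat g (gv U)"
  proof (rule gsat_region_eq[OF assms(2)])
    show "\<forall>x\<in>gclocks g. x < e + k" using edge_props(1)[OF assms(1)] by (simp add: trans_less_add1)
    show "\<forall>z\<in>gconsts g. \<bar>z\<bar> \<le> int mx" using edge_props(2)[OF assms(1)] unfolding cert_max_def by fastforce
  qed
  then show ?thesis using guard_code_correct[OF den_pos] by blast
qed

lemma obs_region_eq: "region_eq mx (e + k) u v \<Longrightarrow> region_eq m k (\<lambda>x. u (e + x)) (\<lambda>x. v (e + x))"
  by (rule region_eq_mono[OF region_eq_shift]) (auto simp: cert_max_def)

lemma edge_code:
  assumes "(l, b, g, R, l') \<in> union_edges A B"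
  obtains i t where "i < 2" "t < e" "list_mem t (aut_part e i 3)" "list_nth t 1 = enc_opt b" "l = 2 * list_nth t 0 + i"
    "list_nth t 2 = enc_guard g" "list_nth t 3 = list_encode R" "l' = 2 * list_nth t 4 + i"
proof -
  obtain i q q' where i: "i < 2" "l = 2 * q + i" "l' = 2 * q' + i" "(q, b, g, R, q') \<in> set (trans (pick i))"
    using assms unfolding union_edges_iff by blast
  let ?t = "enc_trans (q, b, g, R, q')"
  have "list_mem ?t (aut_part e i 3)" unfolding aut_parts(3)[OF i(1)] list_mem_encode using i(4) by force
  then show ?thesis using that[of i ?t] i trans_parts[of q b g R q'] aut_parts(7)[OF i(1,4)]
    by (simp del: enc_trans.simps)
qed

lemma code_edge:
  assumes "i < 2" "list_mem t (aut_part e i 3)"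
  obtains b g R where "(2 * list_nth t 0 + i, b, g, R, 2 * list_nth t 4 + i) \<in> union_edges A B"
    "list_nth t 1 = enc_opt b" "list_nth t 2 = enc_guard g" "list_nth t 3 = list_encode R"
proof -
  obtain q b g R q' where \<tau>: "(q, b, g, R, q') \<in> set (trans (pick i))" "t = enc_trans (q, b, g, R, q')"
    using assms unfolding aut_parts(3)[OF assms(1)] list_mem_encode by auto
  have "(2 * q + i, b, g, R, 2 * q' + i) \<in> union_edges A B" unfolding union_edges_iff using assms(1) \<tau>(1) by blast
  then show ?thesis using that[of b g R] trans_parts[of q b g R q'] unfolding \<tau>(2) by (simp del: enc_trans.simps)
qed

text \<open>A state is replaced by the set of codes of the regions reached with it. States with
  equal sets are merged, which is harmless because the conditions mention only the set and any one
  of the merged states can provide the answer.\<close>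

lemma controller_sep_code:
  assumes ctrl: "controller k m (Q :: 'q set) s0 \<delta>" and sep: "separating e A B s0 \<delta>"
  shows "sep_code k m e"
proof -
  let ?JR = "joint_reach e (union_edges A B) (union_init A B) s0 \<delta>"
  note C = controllerD[OF ctrl]
  have loc: "l < 2 * e + 2" if "?JR l u s" for l u s
    using that
  proof induction
    case (init l)
    then obtain i q where i: "i < 2" "l = 2 * q + i" "q \<in> set (initial (pick i))" unfolding union_init_iff by blast
    then show ?case using aut_parts(5)[OF i(1,3)] by simp
  next
    case (eps l u s g R l')
    show ?case using edge_props(4)[OF eps.hyps(2)] .
  next
    case (letter l u s a g R l' Y s')
    show ?case using edge_props(4)[OF letter.hyps(2)] .
  qed
  define X where "X s = {prod_encode (l, U) | l U. U < vecs \<and> (\<exists>u. ?JR l u s \<and> region_eq mx (e + k) u (gv U))}" for s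
  define c where "c s = set_encode (X s)" for s
  have Xsub: "X s \<subseteq> {..<cert_size k m e}" for s
    unfolding X_def cert_size_def using loc by (auto intro!: prod_encode_less)
  then have finX: "finite (X s)" for s using finite_subset by blast
  have dec: "set_decode (c s) = X s" for s unfolding c_def using finX by simp
  have cless: "c s < 2 ^ cert_size k m e" for s unfolding c_def using set_encode_less[OF Xsub] .
  have XI: "prod_encode (l, U) \<in> X s" if "U < vecs" "?JR l u s" "region_eq mx (e + k) u (gv U)" for l U u s
    unfolding X_def using that by blast
  have XD: "U < vecs \<and> (\<exists>u. ?JR l u s \<and> region_eq mx (e + k) u (gv U))" if "prod_encode (l, U) \<in> X s" for l U s
    using that unfolding X_def by auto
  define W where "W = set_encode (c ` Q)"
  have Wless: "W < 2 ^ (2 ^ cert_size k m e)" unfolding W_def using cless by (intro set_encode_less) auto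
  have decW: "set_decode W = c ` Q" unfolding W_def using C(1) by simp
  have "closed_set k m e (c s)" for s
    unfolding closed_set_def dec
  proof (intro conjI allI impI notI; elim conjE)
    \<comment> \<open>\<open>U\<close> merely lies in the region of a reachable \<open>u\<close>.
      Its delay is matched by a delay of \<open>u\<close>, which is a genuine step.\<close>
    fix l U d U' assume a: "U' < vecs" "prod_encode (l, U) \<in> X s" "near k m e 0 0 d U U'"
    obtain u where u: "?JR l u s" "region_eq mx (e + k) u (gv U)" using XD[OF a(2)] by blast
    have nn: "\<And>i. 0 \<le> u i" using joint_reach_nonneg[OF u(1)] .
    obtain d' where d': "0 \<le> d'" "region_eq mx (e + k) (\<lambda>i. gv U i + real d / real den) (\<lambda>i. u i + d')"
      using region_eq_delay[OF region_eq_sym[OF u(2)], of "real d / real den"] nn grid_nonneg by auto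
    have "region_eq mx (e + k) (\<lambda>i. u i + d') (gv U')"
      using region_eq_trans[OF region_eq_sym[OF d'(2)]] a(3) unfolding near_delay_iff by blast
    then show "prod_encode (l, U') \<in> X s" using joint_reach.delay[OF u(1) d'(1)] a(1) by (intro XI)
  next
    fix i t U U' assume a: "i < 2" "U' < vecs" "list_mem t (aut_part e i 3)" "list_nth t 1 = 0"
      "prod_encode (2 * list_nth t 0 + i, U) \<in> X s" "guard_code den bs U (list_nth t 2)" "near k m e (list_nth t 3) 0 0 U U'"
    obtain b g R where t: "(2 * list_nth t 0 + i, b, g, R, 2 * list_nth t 4 + i) \<in> union_edges A B"
      "list_nth t 1 = enc_opt b" "list_nth t 2 = enc_guard g" "list_nth t 3 = list_encode R"
      using code_edge[OF a(1,3)] by blast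
    have b: "b = None" using t(2) a(4) by (cases b) auto
    obtain u where u: "?JR (2 * list_nth t 0 + i) u s" "region_eq mx (e + k) u (gv U)" using XD[OF a(5)] by blast
    have "gsat g u" using gsat_edge[OF t(1) u(2)] a(6) t(3) by simp
    from joint_reach.eps[OF u(1) t(1)[unfolded b] this]
    have "?JR (2 * list_nth t 4 + i) (resets (set R) u) s" .
    moreover have "region_eq mx (e + k) (resets (set R) u) (gv U')"
      using region_eq_trans[OF region_eq_resets[OF u(2), of "set R"]] a(7) unfolding t(4) near_resets_iff by simp
    ultimately show "prod_encode (2 * list_nth t 4 + i, U') \<in> X s" using a(2) by (intro XI)
  next
    fix q U q' U' assume a: "list_mem q (aut_part e 0 2)" "list_mem q' (aut_part e 1 2)"
      "prod_encode (2 * q, U) \<in> X s" "prod_encode (2 * q' + 1, U') \<in> X s"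
    have "q \<in> set (final A)" "q' \<in> set (final B)"
      using a(1,2) aut_parts(2)[of 0] aut_parts(2)[of 1] by (simp_all add: pick_def)
    then show False using XD[OF a(3)] XD[OF a(4)] sep unfolding separating_def by blast
  qed
  moreover have "\<exists>y<2 ^ k. \<exists>D'<2 ^ cert_size k m e. D' \<in> set_decode W \<and> succ_set k m e (c s) a V y D'"
    if s: "s \<in> Q" and V: "V < vecs" for s a V
  proof -
    let ?w = "\<lambda>x. gv V (e + x)"
    obtain Y s' where Y: "\<delta> s a ?w = (Y, s')" by force
    have nw: "\<And>x. 0 \<le> ?w x" by (rule grid_nonneg)
    have Yk: "Y \<subseteq> {..<k}" and s': "s' \<in> Q" using C(3)[of s ?w a, OF s nw] C(4)[of s ?w a, OF s nw] Y by auto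
    have "finite Y" using Yk by (rule finite_subset) simp
    then have Yd: "set_decode (set_encode Y) = Y" by simp
    have "succ_set k m e (c s) a V (set_encode Y) (c s')"
      unfolding succ_set_def dec
    proof (intro allI impI; elim conjE)
      fix i t U U' assume a: "i < 2" "U' < vecs" "list_mem t (aut_part e i 3)" "list_nth t 1 = Suc a"
        "prod_encode (2 * list_nth t 0 + i, U) \<in> X s" "guard_code den bs U (list_nth t 2)" "same_obs k m e U V"
        "near k m e (list_nth t 3) (set_encode Y) 0 U U'"
      obtain b g R where t: "(2 * list_nth t 0 + i, b, g, R, 2 * list_nth t 4 + i) \<in> union_edges A B"
        "list_nth t 1 = enc_opt b" "list_nth t 2 = enc_guard g" "list_nth t 3 = list_encode R"
        using code_edge[OF a(1,3)] by blast
      have b: "b = Some a" using t(2) a(4) by (cases b) auto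
      obtain u where u: "?JR (2 * list_nth t 0 + i) u s" "region_eq mx (e + k) u (gv U)" using XD[OF a(5)] by blast
      have "gsat g u" using gsat_edge[OF t(1) u(2)] a(6) t(3) by simp
      moreover have "\<delta> s a (\<lambda>x. u (e + x)) = (Y, s')"
      proof -
        have "region_eq m k ?w (\<lambda>x. u (e + x))"
          using region_eq_sym[OF region_eq_trans[OF obs_region_eq[OF u(2)] a(7)[unfolded same_obs_iff]]] .
        then show ?thesis using C(5)[of s ?w "\<lambda>x. u (e + x)" a] s nw joint_reach_nonneg[OF u(1)] Y by simp
      qed
      ultimately have "?JR (2 * list_nth t 4 + i) (resets (set R \<union> (+) e ` Y) u) s'"
        by (rule joint_reach.letter[OF u(1) t(1)[unfolded b]])
      moreover have "region_eq mx (e + k) (resets (set R \<union> (+) e ` Y) u) (gv U')"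
        using region_eq_trans[OF region_eq_resets[OF u(2), of "set R \<union> (+) e ` Y"]] a(8) unfolding t(4) near_resets_iff Yd by blast
      ultimately show "prod_encode (2 * list_nth t 4 + i, U') \<in> X s'" using a(2) by (intro XI)
    qed
    then show ?thesis using set_encode_less[OF Yk] cless s' decW by blast
  qed
  moreover have "\<forall>i<2. \<forall>q<e. list_mem q (aut_part e i 1) \<longrightarrow> prod_encode (2 * q + i, 0) \<in> set_decode (c s0)"
  proof (intro allI impI)
    fix i q :: nat assume i: "i < 2" "list_mem q (aut_part e i 1)"
    then have "2 * q + i \<in> union_init A B" unfolding union_init_iff using aut_parts(1)[OF i(1)] by auto
    then have "?JR (2 * q + i) (\<lambda>_. 0) s0" by (rule joint_reach.init)
    moreover have "0 < vecs" using bs_pos by (simp add: cert_vecs_def)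
    ultimately show "prod_encode (2 * q + i, 0) \<in> set_decode (c s0)"
      unfolding dec by (intro XI) (auto intro: region_eq_cong simp: grid_def)
  qed
  ultimately have cert: "(\<exists>D<2 ^ cert_size k m e. D \<in> set_decode W \<and>
        (\<forall>i<2. \<forall>q<e. list_mem q (aut_part e i 1) \<longrightarrow> prod_encode (2 * q + i, 0) \<in> set_decode D)) \<and>
     (\<forall>D<2 ^ cert_size k m e. D \<in> set_decode W \<longrightarrow> closed_set k m e D \<and>
        (\<forall>a<e. list_mem a (list_nth e 0) \<longrightarrow> (\<forall>V<cert_vecs k m e. \<exists>y<2 ^ k. \<exists>D'<2 ^ cert_size k m e.
           D' \<in> set_decode W \<and> succ_set k m e D a V y D')))"
    using cless[of s0] C(2) unfolding decW by blast
  show ?thesis unfolding sep_code_def by (rule exI[of _ W], rule conjI[OF Wless cert])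
qed

text \<open>The numbers in \<open>W\<close> become the states. An observed valuation is replaced by
  a grid point of its region, chosen equally for equivalent valuations, and the certificate supplies
  the answer there. Letters outside \<open>Sig\<close> occur on no edge, and the controller idles on
  them.\<close>

lemma sep_code_controller:
  assumes "sep_code k m e"
  shows "\<exists>(Q :: nat set) s0 \<delta>. controller k m Q s0 \<delta> \<and> separating e A B s0 \<delta>"
proof -
  obtain W s0 where s0: "s0 < 2 ^ cert_size k m e" "s0 \<in> set_decode W"
    and init: "\<And>i q. i < 2 \<Longrightarrow> q < e \<Longrightarrow> list_mem q (aut_part e i 1) \<Longrightarrow> prod_encode (2 * q + i, 0) \<in> set_decode s0"
    and cl: "\<And>D. D < 2 ^ cert_size k m e \<Longrightarrow> D \<in> set_decode W \<Longrightarrow> closed_set k m e D"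
    and su: "\<And>D a V. D < 2 ^ cert_size k m e \<Longrightarrow> D \<in> set_decode W \<Longrightarrow> a < e \<Longrightarrow> list_mem a (list_nth e 0) \<Longrightarrow> V < vecs
      \<Longrightarrow> \<exists>y<2 ^ k. \<exists>D'<2 ^ cert_size k m e. D' \<in> set_decode W \<and> succ_set k m e D a V y D'"
    using assms unfolding sep_code_def by blast
  define Q where "Q = {D \<in> set_decode W. D < 2 ^ cert_size k m e}"
  define obs where "obs w = (SOME V. V < vecs \<and> region_eq m k w (\<lambda>x. gv V (e + x)))" for w :: valuation
  define ans where "ans D a V = (SOME p. fst p < 2 ^ k \<and> snd p \<in> Q \<and> succ_set k m e D a V (fst p) (snd p))" for D a V
  define \<delta> where "\<delta> D a w = (if a \<in> set Sig then (set_decode (fst (ans D a (obs w))), snd (ans D a (obs w))) else ({}, D))"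
    for D a and w :: valuation
  have obs: "obs w < vecs \<and> region_eq m k w (\<lambda>x. gv (obs w) (e + x))" if w: "\<And>x. 0 \<le> w x" for w
  proof -
    define u where "u i = (if e \<le> i then w (i - e) else 0)" for i
    have nn: "0 \<le> u i" for i using w by (simp add: u_def)
    obtain U where U: "U < vecs" "region_eq mx (e + k) u (gv U)" by (rule representative[of u, OF nn])
    have "(\<lambda>x. u (e + x)) = w" by (simp add: u_def)
    then have "U < vecs \<and> region_eq m k w (\<lambda>x. gv U (e + x))" using obs_region_eq[OF U(2)] U(1) by simp
    then show ?thesis unfolding obs_def by (rule someI)
  qed
  have obs_cong: "obs w = obs w'" if "region_eq m k w w'" for w w'
  proof -
    have "region_eq m k w v \<longleftrightarrow> region_eq m k w' v" for v
      using that region_eq_trans region_eq_sym by blast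
    then show ?thesis unfolding obs_def by simp
  qed
  have ans: "fst (ans D a V) < 2 ^ k \<and> snd (ans D a V) \<in> Q \<and> succ_set k m e D a V (fst (ans D a V)) (snd (ans D a V))"
    if "D \<in> Q" "a \<in> set Sig" "V < vecs" for D a V
  proof -
    have "a < e" using mem_less_list_encode[OF that(2)] code_parts(4) by simp
    moreover have "list_mem a (list_nth e 0)" unfolding code_parts(1) list_mem_encode using that(2) .
    ultimately have "\<exists>y<2 ^ k. \<exists>D'<2 ^ cert_size k m e. D' \<in> set_decode W \<and> succ_set k m e D a V y D'"
      using su[of D a V] that(1,3) unfolding Q_def by blast
    then have "\<exists>p. fst p < 2 ^ k \<and> snd p \<in> Q \<and> succ_set k m e D a V (fst p) (snd p)" unfolding Q_def by auto
    from someI_ex[OF this] show ?thesis unfolding ans_def .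
  qed
  have ctrl: "controller k m Q s0 \<delta>"
    unfolding controller_def
  proof (intro conjI ballI allI impI)
    show "finite Q" "s0 \<in> Q" using s0 by (simp_all add: Q_def)
    fix D a and w :: valuation assume D: "D \<in> Q" and w: "\<forall>x. 0 \<le> w x"
    have V: "obs w < vecs" using obs w by blast
    show "fst (\<delta> D a w) \<subseteq> {..<k}" "snd (\<delta> D a w) \<in> Q"
      using ans[OF D _ V, of a] set_decode_subset[of "fst (ans D a (obs w))" k] D unfolding \<delta>_def by auto
    fix w' assume "region_eq m k w w'"
    from obs_cong[OF this] show "\<delta> D a w' = \<delta> D a w" unfolding \<delta>_def by simp
  qed
  let ?JR = "joint_reach e (union_edges A B) (union_init A B) s0 \<delta>"
  \<comment> \<open>All codes of the region are demanded, not one: a step of the certificate starts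
    from a particular \<open>U\<close>, chosen to match a given delay, and the invariant has to
    provide that \<open>U\<close>.\<close>
  have inv: "s \<in> Q \<and> l < 2 * e + 2 \<and> (\<forall>U<vecs. region_eq mx (e + k) u (gv U) \<longrightarrow> prod_encode (l, U) \<in> set_decode s)"
    if "?JR l u s" for l u s
    using that
  proof induction
    case (init l)
    then obtain i q where i: "i < 2" "l = 2 * q + i" "q \<in> set (initial (pick i))" unfolding union_init_iff by blast
    have q: "q < e" "list_mem q (aut_part e i 1)" using aut_parts(5)[OF i(1,3)] aut_parts(1)[OF i(1)] i(3) by auto
    have "prod_encode (l, U) \<in> set_decode s0" if U: "U < vecs" "region_eq mx (e + k) (\<lambda>_. 0) (gv U)" for U
    proof -
      have "dig bs U j = 0" if "j < e + k" for j
      proof -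
        have "gv U j \<le> of_int 0" using region_eqD(2)[OF U(2) that, of 0] by simp
        then show ?thesis using den_pos by (simp add: grid_def divide_le_0_iff)
      qed
      then have "U = 0" using digits_0[OF bs_pos] U(1) unfolding cert_vecs_def by blast
      then show ?thesis using \<open>\<And>i q. i < 2 \<Longrightarrow> q < e \<Longrightarrow> list_mem q (aut_part e i 1) \<Longrightarrow> prod_encode (2 * q + i, 0) \<in> set_decode s0\<close>[OF i(1) q] i(2) by simp
    qed
    then show ?case using s0 q(1) i(1,2) by (simp add: Q_def)
  next
    case (delay l u s d)
    have cs: "closed_set k m e s" using delay.IH cl unfolding Q_def by blast
    have "prod_encode (l, U') \<in> set_decode s" if U': "U' < vecs" "region_eq mx (e + k) (\<lambda>i. u i + d) (gv U')" for U'
    proof -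
      obtain U d' where U: "U < vecs" "d' < bs" "region_eq mx (e + k) u (gv U)"
        "region_eq mx (e + k) (\<lambda>i. u i + d) (\<lambda>i. gv U i + real d' / real den)"
        using representative_delay[of u d] joint_reach_nonneg[OF delay.hyps(1)] delay.hyps(2) by blast
      have "near k m e 0 0 d' U U'" unfolding near_delay_iff using region_eq_trans[OF region_eq_sym[OF U(4)] U'(2)] .
      moreover have "prod_encode (l, U) \<in> set_decode s" "l < 2 * e + 2" using delay.IH U by auto
      ultimately show ?thesis using cs U(1,2) U'(1) unfolding closed_set_def by blast
    qed
    then show ?case using delay.IH by blast
  next
    case (eps l u s g R l')
    have cs: "closed_set k m e s" using eps.IH cl unfolding Q_def by blast
    obtain i t where t: "i < 2" "t < e" "list_mem t (aut_part e i 3)" "list_nth t 1 = enc_opt None" "l = 2 * list_nth t 0 + i"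
      "list_nth t 2 = enc_guard g" "list_nth t 3 = list_encode R" "l' = 2 * list_nth t 4 + i"
      using edge_code[OF eps.hyps(2)] by blast
    obtain U where U: "U < vecs" "region_eq mx (e + k) u (gv U)"
      using representative[of u] joint_reach_nonneg[OF eps.hyps(1)] by blast
    have m: "prod_encode (2 * list_nth t 0 + i, U) \<in> set_decode s" "guard_code den bs U (list_nth t 2)" "list_nth t 1 = 0"
      using eps.IH U gsat_edge[OF eps.hyps(2) U(2)] eps.hyps(3) t by auto
    have "prod_encode (l', U') \<in> set_decode s" if U': "U' < vecs" "region_eq mx (e + k) (resets (set R) u) (gv U')" for U'
    proof -
      have "near k m e (list_nth t 3) 0 0 U U'" unfolding t(7) near_resets_iff
        using region_eq_trans[OF region_eq_sym[OF region_eq_resets[OF U(2), of "set R"]] U'(2)] by simp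
      then show ?thesis using cs m t(1-3) U(1) U'(1) unfolding closed_set_def t(8) by blast
    qed
    then show ?case using eps.IH edge_props(4)[OF eps.hyps(2)] by blast
  next
    case (letter l u s a g R l' Y s')
    have s: "s \<in> Q" using letter.IH by blast
    have a: "a \<in> set Sig" using edge_props(5)[OF letter.hyps(2)] by blast
    let ?w = "\<lambda>x. u (e + x)"
    have V: "obs ?w < vecs" "region_eq m k ?w (\<lambda>x. gv (obs ?w) (e + x))"
      using obs[of ?w] joint_reach_nonneg[OF letter.hyps(1)] by auto
    define y where "y = fst (ans s a (obs ?w))"
    have Y: "Y = set_decode y" and s': "s' = snd (ans s a (obs ?w))"
      using letter.hyps(4) a unfolding \<delta>_def y_def by auto
    have su': "s' \<in> Q" "succ_set k m e s a (obs ?w) y s'" using ans[OF s a V(1)] unfolding s' y_def by auto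
    obtain i t where t: "i < 2" "t < e" "list_mem t (aut_part e i 3)" "list_nth t 1 = enc_opt (Some a)" "l = 2 * list_nth t 0 + i"
      "list_nth t 2 = enc_guard g" "list_nth t 3 = list_encode R" "l' = 2 * list_nth t 4 + i"
      using edge_code[OF letter.hyps(2)] by blast
    obtain U where U: "U < vecs" "region_eq mx (e + k) u (gv U)"
      using representative[of u] joint_reach_nonneg[OF letter.hyps(1)] by blast
    have m: "prod_encode (2 * list_nth t 0 + i, U) \<in> set_decode s" "guard_code den bs U (list_nth t 2)" "list_nth t 1 = Suc a"
      using letter.IH U gsat_edge[OF letter.hyps(2) U(2)] letter.hyps(3) t by auto
    have so: "same_obs k m e U (obs ?w)" unfolding same_obs_iff
      using region_eq_trans[OF region_eq_sym[OF obs_region_eq[OF U(2)]] V(2)] .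
    have "prod_encode (l', U') \<in> set_decode s'"
      if U': "U' < vecs" "region_eq mx (e + k) (resets (set R \<union> (+) e ` Y) u) (gv U')" for U'
    proof -
      have "near k m e (list_nth t 3) y 0 U U'" unfolding t(7) near_resets_iff Y[symmetric]
        using region_eq_trans[OF region_eq_sym[OF region_eq_resets[OF U(2), of "set R \<union> (+) e ` Y"]] U'(2)] .
      then show ?thesis using su'(2) so m t(1-3) U(1) U'(1) unfolding succ_set_def t(8) by blast
    qed
    then show ?case using su'(1) edge_props(4)[OF letter.hyps(2)] by blast
  qed
  have "separating e A B s0 \<delta>"
    unfolding separating_def
  proof
    assume "\<exists>s q u q' u'. q \<in> set (final A) \<and> q' \<in> set (final B) \<and> ?JR (2 * q) u s \<and> ?JR (2 * q' + 1) u' s"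
    then obtain s q u q' u' where *: "q \<in> set (final A)" "q' \<in> set (final B)" "?JR (2 * q) u s" "?JR (2 * q' + 1) u' s"
      by blast
    obtain U where U: "U < vecs" "region_eq mx (e + k) u (gv U)"
      using representative[of u] joint_reach_nonneg[OF *(3)] by blast
    obtain U' where U': "U' < vecs" "region_eq mx (e + k) u' (gv U')"
      using representative[of u'] joint_reach_nonneg[OF *(4)] by blast
    have m: "prod_encode (2 * q, U) \<in> set_decode s" "prod_encode (2 * q' + 1, U') \<in> set_decode s" "s \<in> Q"
      using inv[OF *(3)] inv[OF *(4)] U U' by auto
    have "closed_set k m e s" using m(3) cl unfolding Q_def by blast
    moreover have "q < e" "q' < e" "list_mem q (aut_part e 0 2)" "list_mem q' (aut_part e 1 2)"
      using *(1,2) aut_parts(2,6)[of 0] aut_parts(2,6)[of 1] by (simp_all add: pick_def)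
    ultimately show False using m U(1) U'(1) unfolding closed_set_def by blast
  qed
  then show ?thesis using ctrl by blast
qed

lemma sep_code_iff: "sep_code k m e \<longleftrightarrow> km_separable k m Sig A B"
proof -
  have n: "clock_num A \<le> e" "clock_num B \<le> e"
    using aut_parts(4)[of 0] aut_parts(4)[of 1] by (simp_all add: pick_def)
  show ?thesis
  proof
    assume "sep_code k m e"
    from sep_code_controller[OF this] obtain Q :: "nat set" and s0 \<delta>
      where c: "controller k m Q s0 \<delta>" "separating e A B s0 \<delta>" by (elim exE conjE)
    show "km_separable k m Sig A B" by (rule controller_km_separable[OF c wfA wfB n])
  next
    assume "km_separable k m Sig A B"
    from km_separable_controller[OF this wfA wfB n] obtain Q :: "nat option set" and s0 \<delta>
      where c: "controller k m Q s0 \<delta>" "separating e A B s0 \<delta>" by (elim exE conjE)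
    show "sep_code k m e" by (rule controller_sep_code[OF c])
  qed
qed

end

text \<open>\<open>e\<close> exceeds the number of clocks and bounds the constants of both automata,
  \<open>e + 1\<close> is in addition at least 1, as the game requires of \<open>M\<close>, and all
  locations of the union are below \<open>2 * e + 2\<close>.\<close>

lemma k_separable_iff: "k_separable k Sig A B \<longleftrightarrow> km_separable k (separation_bound k e (e + 1) (2 * e + 2)) Sig A B"
proof
  assume "k_separable k Sig A B"
  then obtain m where m: "km_separable k m Sig A B" unfolding k_separable_def by blast
  have n: "clock_num A \<le> e" "clock_num B \<le> e"
    using aut_parts(4)[of 0] aut_parts(4)[of 1] by (simp_all add: pick_def)
  have cb: "consts_bounded (e + 1) (pick i)" if i: "i < 2" for i
  proof -
    have "\<forall>z\<in>gconsts g. \<bar>z\<bar> \<le> int (e + 1)" if t: "(q, b, g, R, q') \<in> set (trans (pick i))" for q b g R q'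
    proof -
      have "(2 * q + i, b, g, R, 2 * q' + i) \<in> union_edges A B" unfolding union_edges_iff using i t by blast
      from edge_props(2)[OF this] show ?thesis by fastforce
    qed
    then show ?thesis unfolding consts_bounded_def by fast
  qed
  have "union_init A B \<subseteq> {..<2 * e + 2}"
  proof
    fix l assume "l \<in> union_init A B"
    then obtain i q where i: "i < 2" "l = 2 * q + i" "q \<in> set (initial (pick i))" unfolding union_init_iff by blast
    then show "l \<in> {..<2 * e + 2}" using aut_parts(5)[OF i(1,3)] by simp
  qed
  then show "km_separable k (separation_bound k e (e + 1) (2 * e + 2)) Sig A B"
    using km_separable_bounded[OF m wfA wfB n, of "e + 1" "2 * e + 2"] cb[of 0] cb[of 1] edge_props(4)
    by (simp add: pick_def)
qed (auto simp: k_separable_def)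

end

theorem theorem1:
  fixes k m :: nat
  shows "decidable enc_instance valid_instance (\<lambda>(Sig, A, B). km_separable k m Sig A B)
       \<and> decidable enc_instance valid_instance (\<lambda>(Sig, A, B). k_separable k Sig A B)"
proof
  have *: "sep_code k m' (enc_instance (Sig, A, B)) \<longleftrightarrow> km_separable k m' Sig A B"
    "k_separable k Sig A B \<longleftrightarrow> km_separable k (separation_bound k (enc_instance (Sig, A, B))
       (enc_instance (Sig, A, B) + 1) (2 * enc_instance (Sig, A, B) + 2)) Sig A B"
    if "valid_instance (Sig, A, B)" for Sig A B m'
  proof -
    interpret coded_instance Sig A B "enc_instance (Sig, A, B)"
      by standard (use that in \<open>auto simp: valid_instance_def\<close>)
    show "sep_code k m' (enc_instance (Sig, A, B)) \<longleftrightarrow> km_separable k m' Sig A B" by (rule sep_code_iff)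
    show "k_separable k Sig A B \<longleftrightarrow> km_separable k (separation_bound k (enc_instance (Sig, A, B))
       (enc_instance (Sig, A, B) + 1) (2 * enc_instance (Sig, A, B) + 2)) Sig A B" by (rule k_separable_iff)
  qed
  have "recursive_pred (\<lambda>e. sep_code k m e)"
    by (intro recursive_pred_sep_code recursive_intros)
  then obtain r where r: "\<And>x. eval r [x] (if sep_code k m x then 1 else 0)"
    unfolding recursive_pred_def recursive1_def by blast
  have "eval r [enc_instance x] (if (\<lambda>(Sig, A, B). km_separable k m Sig A B) x then 1 else 0)"
    if "valid_instance x" for x
    using r[of "enc_instance x"] *(1) that by (cases x) auto
  then show "decidable enc_instance valid_instance (\<lambda>(Sig, A, B). km_separable k m Sig A B)"
    unfolding decidable_def by blast
  \<comment> \<open>The sufficient constant is a recursive function of the code, so the second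
    problem is decided by the same certificate with a computed \<open>m\<close>.\<close>
  have "recursive_pred (\<lambda>e. sep_code k (separation_bound k e (e + 1) (2 * e + 2)) e)"
    by (intro recursive_pred_sep_code recursive_intros)
  then obtain r' where r': "\<And>x. eval r' [x] (if sep_code k (separation_bound k x (x + 1) (2 * x + 2)) x then 1 else 0)"
    unfolding recursive_pred_def recursive1_def by blast
  have "eval r' [enc_instance x] (if (\<lambda>(Sig, A, B). k_separable k Sig A B) x then 1 else 0)"
    if "valid_instance x" for x
    using r'[of "enc_instance x"] * that by (cases x) auto
  then show "decidable enc_instance valid_instance (\<lambda>(Sig, A, B). k_separable k Sig A B)"
    unfolding decidable_def by blast
qed

end
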